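(* Let $n\ge 1$, let $F=F(x,y,\omega,q)$ be a smooth real-valued function of $(x,y,\omega,q)\in\mathbb{R}\times\mathbb{R}^{n-1}\times\mathbb{R}\times\mathbb{R}^{n-1}$, and let $\omega_0:\mathbb{R}^{n-1}\to\mathbb{R}$ be smooth. Suppose that for all $y\in\mathbb{R}^{n-1}$ one has $$F(0,y,\omega_0(y),\partial_y\omega_0(y))=0,\qquad F_q(0,y,\omega_0(y),\partial_y\omega_0(y))=0,$$ and $$F_\omega(0,y,\omega_0(y),\partial_y\omega_0(y))<1.$$ Then for sufficiently small $x\ge 0$ there exists a unique smooth real-valued solution $\omega(x,y)$ of the initial value problem $$x\,\partial_x\omega=F(x,y,\omega,\partial_y\omega),\qquad \omega(0,y)=\omega_0(y).$$ That is, there is a smooth solution on some open neighborhood of $\{0\}\times\mathbb{R}^{n-1}$ in $[0,\infty)\times\mathbb{R}^{n-1}$, and any two smooth solutions defined on such neighborhoods agree on some (possibly smaller) neighborhood of $\{0\}\times\mathbb{R}^{n-1}$ in $[0,\infty)\times\mathbb{R}^{n-1}$.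
   Context: Smooth means infinitely differentiable (up to and including the boundary $x=0$ for functions on subsets of $\{x\ge 0\}$). $(x,y)$ are coordinates on $\mathbb{R}^n$ with $x\ge 0$ and $y\in\mathbb{R}^{n-1}$; $\partial_y\omega=(\partial_{y^1}\omega,\dots,\partial_{y^{n-1}}\omega)$. Subscripts on $F$ denote partial derivatives: $F_q=(F_{q_1},\dots,F_{q_{n-1}})$ and $F_\omega=\partial F/\partial\omega$. When $n=1$ there are no variables $y,q$. *)

theory Defs
  imports "HOL-Analysis.Analysis"
begin

text \<open>
  The space of vectors with coordinates indexed by a finite set \<open>J\<close>, realised as a coordinate
  subspace of \<^typ>\<open>real ^ 'm\<close>.  A finite index type is never empty, so \<^typ>\<open>real ^ 'm\<close> alone
  cannot be zero-dimensional; the subspace can (\<open>J = {}\<close>), and with \<open>J = UNIV\<close> it is the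
  whole of \<^typ>\<open>real ^ 'm\<close>.
\<close>

definition coord_space :: "'m::finite set \<Rightarrow> (real^'m) set"
  where "coord_space J = {v. \<forall>i. i \<notin> J \<longrightarrow> v $ i = 0}"

text \<open>
  Differentiability up to the boundary.  The derivative is taken within \<open>S\<close>, so it is one-sided at
  boundary points, and all derivatives are required to be continuous on \<open>S\<close>, boundary included.
  Below, \<open>S\<close> is always a relatively open subset of a linear space \<open>E\<close> or of a closed half-space
  of \<open>E\<close>, so \<open>f' z v\<close> is uniquely determined for \<open>v \<in> E\<close>; for \<open>v \<notin> E\<close> it may be chosen freely
  (for instance by composing \<open>f' z\<close> with a projection onto \<open>E\<close>), so such \<open>v\<close> impose no condition.
\<close>

primrec Ck_on :: "nat \<Rightarrow> 'a::real_normed_vector set \<Rightarrow> ('a \<Rightarrow> real) \<Rightarrow> bool" where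
  "Ck_on 0 S f \<longleftrightarrow> continuous_on S f"
| "Ck_on (Suc k) S f \<longleftrightarrow>
     (\<exists>f'. (\<forall>z\<in>S. (f has_derivative f' z) (at z within S)) \<and> (\<forall>v. Ck_on k S (\<lambda>z. f' z v)))"

definition smooth_on :: "'a::real_normed_vector set \<Rightarrow> ('a \<Rightarrow> real) \<Rightarrow> bool"
  where "smooth_on S f \<longleftrightarrow> (\<forall>k. Ck_on k S f)"

definition grad :: "'m::finite set \<Rightarrow> (real^'m \<Rightarrow> real) \<Rightarrow> real^'m \<Rightarrow> real^'m"
  where "grad J g y = (\<chi> i. if i \<in> J then deriv (\<lambda>t. g (y + t *\<^sub>R axis i 1)) 0 else 0)"

definition half_space :: "'m::finite set \<Rightarrow> (real \<times> (real^'m)) set"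
  where "half_space J = {0..} \<times> coord_space J"

definition boundary_nbhd :: "'m::finite set \<Rightarrow> (real \<times> (real^'m)) set \<Rightarrow> bool"
  where "boundary_nbhd J U \<longleftrightarrow>
    openin (top_of_set (half_space J)) U \<and> {0} \<times> coord_space J \<subseteq> U"

text \<open>
  Only the values of \<open>\<omega>\<close> on \<open>U\<close> matter: the derivatives at a point of \<open>U\<close> depend only on \<open>\<omega>\<close> on a
  relative neighbourhood of that point in the half-space.  The \<open>x\<close>-derivative is taken within
  \<open>[0,\<infinity>)\<close>, hence is one-sided at \<open>x = 0\<close>.
\<close>

definition smooth_solution ::
  "'m::finite set \<Rightarrow> (real \<times> (real^'m) \<times> real \<times> (real^'m) \<Rightarrow> real) \<Rightarrow> (real^'m \<Rightarrow> real) \<Rightarrow>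
     (real \<times> (real^'m)) set \<Rightarrow> (real \<times> (real^'m) \<Rightarrow> real) \<Rightarrow> bool"
  where "smooth_solution J F \<omega>\<^sub>0 U \<omega> \<longleftrightarrow>
    smooth_on U \<omega> \<and>
    (\<forall>(x, y) \<in> U. x * vector_derivative (\<lambda>s. \<omega> (s, y)) (at x within {0..})
       = F (x, y, \<omega> (x, y), grad J (\<lambda>y'. \<omega> (x, y')) y)) \<and>
    (\<forall>y \<in> coord_space J. \<omega> (0, y) = \<omega>\<^sub>0 y)"

end

theory Submission
  imports Defs
begin

text \<open>
  Why the problem is well posed.  The equation \<open>x \<partial>\<^sub>x \<omega> = F (x, y, \<omega>, \<partial>\<^sub>y \<omega>)\<close> is of first order, so its solutions are
  swept out by characteristic curves; what is special is that all of them start at equilibria.  After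
  subtracting \<open>\<omega>\<^sub>0\<close> from the unknown, \<open>F\<close> and \<open>F\<^sub>q\<close> vanish at the points \<open>(0, y, 0, 0)\<close>, and the characteristic
  system \<open>x Y' = - F\<^sub>q\<close>, \<open>x W' = F - Q \<cdot> F\<^sub>q\<close>, \<open>x Q' = F\<^sub>y + F\<^sub>\<omega> Q\<close> is at rest there.  Its linearisation has the
  eigenvalues \<open>F\<^sub>\<omega>\<close> and \<open>0\<close>, all below 1, whereas \<open>x\<close> itself grows with rate 1.  Hence exactly one smooth
  curve leaves each equilibrium, and together these curves fill a neighbourhood of \<open>x = 0\<close>.

  Existence of the curves.  Writing the unknown as equilibrium plus \<open>x z\<close> gives \<open>x z' = - (m + 1) z + g (x, \<eta>, z)\<close>,
  where \<open>g\<close> is Lipschitz in \<open>z\<close> with a constant \<open>L < m + 1\<close>.  The operator \<open>x \<partial>\<^sub>x + m + 1\<close> is inverted by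
  an average over the ray \<open>(s x, \<eta>)\<close> of norm \<open>1 / (m + 1)\<close>, so \<open>z\<close> is the fixed point of a contraction, with no
  singular integral in sight.  The derivatives of \<open>z\<close> are fixed points of linear equations of the same kind,
  whence smoothness in \<open>x\<close> and \<open>\<eta>\<close> together, including \<open>x = 0\<close> (\<open>singular_ode_smooth_solution\<close>,
  \<open>singular_system_solution\<close>).  Smooth cutoffs make all the bounds global.

  From curves to a solution.  The map \<open>\<eta> \<mapsto> Y (x, \<eta>)\<close> is a small perturbation of the identity and has a smooth
  inverse; carrying \<open>W\<close> along defines \<open>u\<close>.  That \<open>Q\<close> is the gradient of \<open>u\<close> amounts to the vanishing of a
  defect that satisfies \<open>x \<partial>\<^sub>x d = F\<^sub>\<omega> d\<close> (\<open>characteristic_strip\<close>, \<open>solution_on_ball\<close>).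

  Uniqueness.  The difference of two solutions is \<open>O(x)\<close> and satisfies \<open>x \<partial>\<^sub>x d = a d + b \<cdot> \<partial>\<^sub>y d\<close> with \<open>a \<le> \<alpha> < 1\<close>
  and \<open>b = O(x)\<close>.  A maximum principle forces \<open>d = 0\<close> near \<open>x = 0\<close> (\<open>transport_unique\<close>).  It also
  proves the vanishing of the defect above, and it allows the solutions on larger and larger
  balls to be glued (\<open>half_space_existence\<close>).
\<close>

section \<open>Differentiability of order k for vector-valued functions\<close>

text \<open>
  The characteristics and their derivatives take values in vector spaces, so the recursion of
  \<^const>\<open>Ck_on\<close> is repeated for an arbitrary normed space as codomain.
\<close>

primrec ck_on :: "nat \<Rightarrow> 'a::real_normed_vector set \<Rightarrow> ('a \<Rightarrow> 'b::real_normed_vector) \<Rightarrow> bool" where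
  "ck_on 0 S f \<longleftrightarrow> continuous_on S f"
| "ck_on (Suc k) S f \<longleftrightarrow>
     (\<exists>f'. (\<forall>z\<in>S. (f has_derivative f' z) (at z within S)) \<and> (\<forall>v. ck_on k S (\<lambda>z. f' z v)))"

lemma ck_on_cong: "(\<And>z. z \<in> S \<Longrightarrow> f z = g z) \<Longrightarrow> ck_on k S f \<Longrightarrow> ck_on k S g"
proof (cases k)
  case 0
  assume "\<And>z. z \<in> S \<Longrightarrow> f z = g z" "ck_on k S f"
  then show ?thesis using 0 by (simp cong: continuous_on_cong_simp)
next
  case (Suc n)
  assume eq: "\<And>z. z \<in> S \<Longrightarrow> f z = g z" and "ck_on k S f"
  then obtain f' where "\<forall>z\<in>S. (f has_derivative f' z) (at z within S)" "\<forall>v. ck_on n S (\<lambda>z. f' z v)"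
    using Suc by auto
  then show ?thesis unfolding Suc ck_on.simps
    using has_derivative_transform[of _ S g f] eq by metis
qed

lemma ck_on_continuous: "ck_on k S f \<Longrightarrow> continuous_on S f"
  by (cases k) (auto intro: has_derivative_continuous_on)

lemma ck_on_SucD: "ck_on (Suc k) S f \<Longrightarrow> ck_on k S f"
proof (induction k arbitrary: f)
  case 0
  then show ?case using ck_on_continuous by (metis ck_on.simps(1))
next
  case (Suc k)
  then obtain f' where "\<forall>z\<in>S. (f has_derivative f' z) (at z within S)"
      "\<forall>v. ck_on (Suc k) S (\<lambda>z. f' z v)"
    by (metis ck_on.simps(2))
  then show ?case using Suc.IH by (metis ck_on.simps(2))
qed

lemma ck_on_mono: "ck_on k S f \<Longrightarrow> j \<le> k \<Longrightarrow> ck_on j S f"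
proof (induction k)
  case (Suc k)
  then show ?case using ck_on_SucD le_Suc_eq by blast
qed simp

lemma ck_on_subset: "ck_on k S f \<Longrightarrow> T \<subseteq> S \<Longrightarrow> ck_on k T f"
proof (induction k arbitrary: f)
  case 0
  then show ?case by (auto intro: continuous_on_subset)
next
  case (Suc k)
  then obtain f' where "\<forall>z\<in>S. (f has_derivative f' z) (at z within S)" "\<forall>v. ck_on k S (\<lambda>z. f' z v)"
    by auto
  then show ?case using Suc has_derivative_subset[of f _ _ S T] unfolding ck_on.simps by blast
qed

lemma ck_on_const: "ck_on k S (\<lambda>z. c)"
proof (induction k arbitrary: c)
  case (Suc k)
  then show ?case by (auto intro!: exI[of _ "\<lambda>z v. 0"])
qed simp

lemma ck_on_linear: assumes "bounded_linear h" shows "ck_on k S h"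
proof (cases k)
  case 0
  then show ?thesis using assms by (simp add: linear_continuous_on)
next
  case (Suc n)
  then show ?thesis
    using assms by (auto intro!: exI[of _ "\<lambda>z. h"] bounded_linear_imp_has_derivative ck_on_const)
qed

lemma ck_on_linear_compose:
  assumes h: "bounded_linear h" shows "ck_on k S f \<Longrightarrow> ck_on k S (\<lambda>z. h (f z))"
proof (induction k arbitrary: f)
  case 0
  then show ?case using bounded_linear.continuous_on[OF h] by simp
next
  case (Suc k)
  then obtain f' where "\<forall>z\<in>S. (f has_derivative f' z) (at z within S)" "\<forall>v. ck_on k S (\<lambda>z. f' z v)"
    by auto
  then show ?case using Suc.IH
    by (auto intro!: exI[of _ "\<lambda>z v. h (f' z v)"] bounded_linear.has_derivative[OF h])
qed

lemma ck_on_add: "ck_on k S f \<Longrightarrow> ck_on k S g \<Longrightarrow> ck_on k S (\<lambda>z. f z + g z)"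
proof (induction k arbitrary: f g)
  case 0
  then show ?case by (auto intro: continuous_intros)
next
  case (Suc k)
  obtain f' where f: "\<forall>z\<in>S. (f has_derivative f' z) (at z within S)" "\<forall>v. ck_on k S (\<lambda>z. f' z v)"
    using Suc by auto
  obtain g' where g: "\<forall>z\<in>S. (g has_derivative g' z) (at z within S)" "\<forall>v. ck_on k S (\<lambda>z. g' z v)"
    using Suc by auto
  show ?case using f g Suc.IH
    by (auto intro!: exI[of _ "\<lambda>z v. f' z v + g' z v"] has_derivative_add)
qed

lemma ck_on_bilinear:
  assumes h: "bounded_bilinear h"
  shows "ck_on k S f \<Longrightarrow> ck_on k S g \<Longrightarrow> ck_on k S (\<lambda>z. h (f z) (g z))"
proof (induction k arbitrary: f g)
  case 0
  then show ?case using bounded_bilinear.continuous_on[OF h] by simp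
next
  case (Suc k)
  obtain f' where f: "\<forall>z\<in>S. (f has_derivative f' z) (at z within S)" "\<forall>v. ck_on k S (\<lambda>z. f' z v)"
    using Suc by auto
  obtain g' where g: "\<forall>z\<in>S. (g has_derivative g' z) (at z within S)" "\<forall>v. ck_on k S (\<lambda>z. g' z v)"
    using Suc by auto
  show ?case using f g Suc.IH Suc.prems[THEN ck_on_SucD]
    by (auto intro!: exI[of _ "\<lambda>z v. h (f z) (g' z v) + h (f' z v) (g z)"]
        bounded_bilinear.FDERIV[OF h] ck_on_add)
qed

lemma ck_on_sum: "(\<And>i. i \<in> I \<Longrightarrow> ck_on k S (f i)) \<Longrightarrow> ck_on k S (\<lambda>z. \<Sum>i\<in>I. f i z)"
  by (induction I rule: infinite_finite_induct) (auto intro: ck_on_const ck_on_add)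

lemma ck_on_Pair: "ck_on k S f \<Longrightarrow> ck_on k S g \<Longrightarrow> ck_on k S (\<lambda>z. (f z, g z))"
proof -
  assume f: "ck_on k S f" and g: "ck_on k S g"
  have "ck_on k S (\<lambda>z. (f z, 0) + (0, g z))"
    by (intro ck_on_add ck_on_linear_compose[OF _ f] ck_on_linear_compose[OF _ g])
      (auto intro!: bounded_linear_Pair bounded_linear_ident bounded_linear_zero)
  then show ?thesis by simp
qed

text \<open>
  A derivative is controlled through its values on basis vectors, because \<^const>\<open>ck_on\<close> speaks only
  about the directional derivatives \<open>\<lambda>z. f' z v\<close> for fixed \<open>v\<close>.
\<close>

lemma linear_basis_expansion:
  fixes h :: "'a::euclidean_space \<Rightarrow> 'b::real_vector"
  assumes "linear h" shows "h v = (\<Sum>b\<in>Basis. (v \<bullet> b) *\<^sub>R h b)"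
proof -
  have "h v = h (\<Sum>b\<in>Basis. (v \<bullet> b) *\<^sub>R b)" by (simp add: euclidean_representation)
  then show ?thesis using assms by (simp add: linear_sum linear_scale)
qed

text \<open>
  The derivative of \<open>g \<circ> f\<close> in direction \<open>v\<close> has the moving argument \<open>f' z v\<close>.  Expanding it in the
  basis of the middle space turns it into a finite sum of products of functions of class one lower,
  to which the induction hypothesis and the product rule apply.
\<close>

lemma ck_on_compose:
  fixes f :: "'a::real_normed_vector \<Rightarrow> 'b::euclidean_space" and g :: "'b \<Rightarrow> 'c::real_normed_vector"
  shows "ck_on k T g \<Longrightarrow> ck_on k S f \<Longrightarrow> f ` S \<subseteq> T \<Longrightarrow> ck_on k S (\<lambda>z. g (f z))"
proof (induction k arbitrary: f g)
  case 0
  then show ?case by (auto intro: continuous_on_compose2)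
next
  case (Suc k)
  obtain f' where f: "\<And>z. z\<in>S \<Longrightarrow> (f has_derivative f' z) (at z within S)" "\<And>v. ck_on k S (\<lambda>z. f' z v)"
    using Suc.prems(2) by (metis ck_on.simps(2))
  obtain g' where g: "\<And>z. z\<in>T \<Longrightarrow> (g has_derivative g' z) (at z within T)" "\<And>v. ck_on k T (\<lambda>z. g' z v)"
    using Suc.prems(1) by (metis ck_on.simps(2))
  have 1: "((\<lambda>z. g (f z)) has_derivative (\<lambda>v. g' (f z) (f' z v))) (at z within S)" if "z \<in> S" for z
    using has_derivative_in_compose2[of T g "\<lambda>z. g' z" f S z "f' z"] g f Suc.prems(3) that by blast
  have 2: "ck_on k S (\<lambda>z. \<Sum>b\<in>Basis. (f' z v \<bullet> b) *\<^sub>R g' (f z) b)" for v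
    by (intro ck_on_sum ck_on_bilinear[OF bounded_bilinear_scaleR]
        ck_on_linear_compose[OF bounded_linear_inner_left] f Suc.IH g Suc.prems(2)[THEN ck_on_SucD] Suc.prems)
  have 3: "ck_on k S (\<lambda>z. g' (f z) (f' z v))" for v
  proof (rule ck_on_cong[OF _ 2])
    fix z assume "z \<in> S"
    then have "linear (g' (f z))" using g(1) Suc.prems(3) has_derivative_linear by blast
    then show "(\<Sum>b\<in>Basis. (f' z v \<bullet> b) *\<^sub>R g' (f z) b) = g' (f z) (f' z v)"
      by (rule linear_basis_expansion[symmetric])
  qed
  show ?case unfolding ck_on.simps
    by (intro exI[of _ "\<lambda>z v. g' (f z) (f' z v)"] conjI ballI allI 1 3)
qed

abbreviation D :: "('a::real_normed_vector \<Rightarrow> 'b::real_normed_vector) \<Rightarrow> 'a \<Rightarrow> 'a \<Rightarrow> 'b"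
  where "D f z \<equiv> frechet_derivative f (at z)"

lemma ck_on_open_Suc:
  assumes "open S" "ck_on (Suc k) S f"
  shows "z \<in> S \<Longrightarrow> (f has_derivative D f z) (at z)" and "ck_on k S (\<lambda>z. D f z v)"
proof -
  obtain f' where f': "\<forall>z\<in>S. (f has_derivative f' z) (at z within S)" "\<forall>v. ck_on k S (\<lambda>z. f' z v)"
    using assms by auto
  then have 1: "(f has_derivative f' z) (at z)" if "z \<in> S" for z
    using assms that by (metis at_within_open)
  then have 2: "f' z = D f z" if "z \<in> S" for z using frechet_derivative_at that by blast
  show "z \<in> S \<Longrightarrow> (f has_derivative D f z) (at z)" using 1 2 by metis
  show "ck_on k S (\<lambda>z. D f z v)" by (rule ck_on_cong[of S "\<lambda>z. f' z v"]) (use 2 f' in auto)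
qed

definition csmooth :: "('a::real_normed_vector \<Rightarrow> 'b::real_normed_vector) \<Rightarrow> bool"
  where "csmooth f \<longleftrightarrow> (\<forall>k. ck_on k UNIV f)"

lemma csmooth_deriv: "csmooth f \<Longrightarrow> (f has_derivative D f z) (at z)"
  unfolding csmooth_def using ck_on_open_Suc(1)[of UNIV] by (metis UNIV_I open_UNIV)

lemma csmooth_D: "csmooth f \<Longrightarrow> csmooth (\<lambda>z. D f z v)"
  unfolding csmooth_def using ck_on_open_Suc(2)[of UNIV] by (metis open_UNIV)

lemma csmooth_linear_D: "csmooth f \<Longrightarrow> linear (D f z)"
  using csmooth_deriv has_derivative_linear by blast

lemma csmooth_continuous: "csmooth f \<Longrightarrow> continuous_on S f"
  unfolding csmooth_def using ck_on_continuous continuous_on_subset subset_UNIV by metis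

text \<open>
  A family of functions that is closed under differentiation consists of smooth functions; the
  exponentially flat functions below are recognised as smooth in this way.
\<close>

lemma csmooth_coinduct:
  assumes "P f" and step: "\<And>f. P f \<Longrightarrow> \<exists>f'. (\<forall>z. (f has_derivative f' z) (at z)) \<and> (\<forall>v. P (\<lambda>z. f' z v))"
  shows "csmooth f"
proof -
  have "ck_on k UNIV f" if "P f" for k f
    using that
  proof (induction k arbitrary: f)
    case 0
    then show ?case using step[OF 0] by (auto intro: has_derivative_continuous_on)
  next
    case (Suc k)
    then show ?case using step[OF Suc.prems] by auto
  qed
  then show ?thesis using assms(1) by (auto simp: csmooth_def)
qed

named_theorems csm

lemma csmooth_linear: "bounded_linear h \<Longrightarrow> csmooth h"
  by (simp add: csmooth_def ck_on_linear)

lemma csmooth_compose: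
  fixes f :: "'a::real_normed_vector \<Rightarrow> 'b::euclidean_space"
  shows "csmooth g \<Longrightarrow> csmooth f \<Longrightarrow> csmooth (\<lambda>z. g (f z))"
  unfolding csmooth_def using ck_on_compose[where T = UNIV] by blast

lemma csmooth_const[csm]: "csmooth (\<lambda>z. c)"
  by (simp add: csmooth_def ck_on_const)

lemma csmooth_id[csm]: "csmooth (\<lambda>z. z)"
  by (simp add: csmooth_linear bounded_linear_ident)

lemma csmooth_linear_compose:
  "bounded_linear h \<Longrightarrow> csmooth f \<Longrightarrow> csmooth (\<lambda>z. h (f z))"
  by (simp add: csmooth_def ck_on_linear_compose)

lemmas csmooth_fst[csm] = csmooth_linear_compose[OF bounded_linear_fst]
lemmas csmooth_snd[csm] = csmooth_linear_compose[OF bounded_linear_snd]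
lemmas csmooth_minus[csm] = csmooth_linear_compose[OF bounded_linear_minus[OF bounded_linear_ident]]

lemma csmooth_bilinear:
  "bounded_bilinear h \<Longrightarrow> csmooth f \<Longrightarrow> csmooth g \<Longrightarrow> csmooth (\<lambda>z. h (f z) (g z))"
  by (simp add: csmooth_def ck_on_bilinear)

lemmas csmooth_scaleR[csm] = csmooth_bilinear[OF bounded_bilinear_scaleR]
lemmas csmooth_inner[csm] = csmooth_bilinear[OF bounded_bilinear_inner]
lemmas csmooth_mult[csm] = csmooth_bilinear[OF bounded_bilinear_mult]

lemma csmooth_add[csm]: "csmooth f \<Longrightarrow> csmooth g \<Longrightarrow> csmooth (\<lambda>z. f z + g z)"
  by (simp add: csmooth_def ck_on_add)

lemma csmooth_diff[csm]: "csmooth f \<Longrightarrow> csmooth g \<Longrightarrow> csmooth (\<lambda>z. f z - g z)"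
  using csmooth_add[of f "\<lambda>z. - g z", OF _ csmooth_minus] by simp

lemma csmooth_sum[csm]: "(\<And>i. i \<in> I \<Longrightarrow> csmooth (f i)) \<Longrightarrow> csmooth (\<lambda>z. \<Sum>i\<in>I. f i z)"
  unfolding csmooth_def by (intro allI ck_on_sum) blast

lemma csmooth_Pair[csm]: "csmooth f \<Longrightarrow> csmooth g \<Longrightarrow> csmooth (\<lambda>z. (f z, g z))"
  by (simp add: csmooth_def ck_on_Pair)

lemma csmooth_power[csm]: "csmooth f \<Longrightarrow> csmooth (\<lambda>z. f z ^ n :: real)"
proof (induction n)
  case 0
  then show ?case by (simp add: csmooth_const)
next
  case (Suc n)
  then show ?case using csmooth_mult[of f "\<lambda>z. f z ^ n"] by simp
qed

lemma csmooth_D_eval[csm]: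
  fixes f :: "'a::euclidean_space \<Rightarrow> 'b::real_normed_vector" and g v :: "'c::real_normed_vector \<Rightarrow> 'a"
  assumes f: "csmooth f" and g: "csmooth g" and v: "csmooth v"
  shows "csmooth (\<lambda>z. D f (g z) (v z))"
proof -
  have "csmooth (\<lambda>z. \<Sum>b\<in>Basis. (v z \<bullet> b) *\<^sub>R D f (g z) b)"
    by (intro csm csmooth_compose[OF csmooth_D[OF f] g] v)
  moreover have "(\<lambda>z. \<Sum>b\<in>Basis. (v z \<bullet> b) *\<^sub>R D f (g z) b) = (\<lambda>z. D f (g z) (v z))"
    by (rule ext) (rule linear_basis_expansion[OF csmooth_linear_D[OF f], symmetric])
  ultimately show ?thesis by simp
qed

lemma D_compose:
  assumes "csmooth g" "csmooth f"
  shows "D (\<lambda>z. g (f z)) z v = D g (f z) (D f z v)"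
proof -
  have "((\<lambda>z. g (f z)) has_derivative (\<lambda>v. D g (f z) (D f z v))) (at z)"
    using diff_chain_at[OF csmooth_deriv[OF assms(2)] csmooth_deriv[OF assms(1)]] by (simp add: o_def)
  from frechet_derivative_at[OF this] show ?thesis by (rule fun_cong[symmetric])
qed

lemma D_Pair:
  assumes "csmooth f" "csmooth g"
  shows "D (\<lambda>z. (f z, g z)) z v = (D f z v, D g z v)"
  by (rule fun_cong[OF frechet_derivative_at[symmetric]])
    (intro has_derivative_Pair csmooth_deriv assms)

lemma D_bilinear:
  assumes h: "bounded_bilinear h" and "csmooth f" "csmooth g"
  shows "D (\<lambda>z. h (f z) (g z)) z v = h (f z) (D g z v) + h (D f z v) (g z)"
  by (rule fun_cong[OF frechet_derivative_at[symmetric]])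
    (intro bounded_bilinear.FDERIV[OF h] csmooth_deriv assms)

lemma D_linear_compose:
  assumes h: "bounded_linear h" and "csmooth f"
  shows "D (\<lambda>z. h (f z)) z v = h (D f z v)"
  by (rule fun_cong[OF frechet_derivative_at[symmetric]])
    (intro bounded_linear.has_derivative[OF h] csmooth_deriv assms)

lemma D_linear: "bounded_linear h \<Longrightarrow> D h z v = h v"
  by (rule fun_cong[OF frechet_derivative_at[symmetric]]) (rule bounded_linear_imp_has_derivative)

lemma D_add: "csmooth f \<Longrightarrow> csmooth g \<Longrightarrow> D (\<lambda>z. f z + g z) z v = D f z v + D g z v"
  by (rule fun_cong[OF frechet_derivative_at[symmetric]]) (intro has_derivative_add csmooth_deriv)

lemma D_diff: "csmooth f \<Longrightarrow> csmooth g \<Longrightarrow> D (\<lambda>z. f z - g z) z v = D f z v - D g z v"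
  by (rule fun_cong[OF frechet_derivative_at[symmetric]]) (intro has_derivative_diff csmooth_deriv)

section \<open>Parameter integrals, division by a coordinate, mixed derivatives\<close>

text \<open>
  Differentiation under the integral sign, with the derivative in \<open>p\<close> extracted from a joint derivative
  in \<open>(s, p)\<close>.  In this form the integrand of the derivative is again a directional derivative, so
  the step can be iterated.
\<close>

lemma has_derivative_integral_param:
  fixes h :: "real \<times> 'a::euclidean_space \<Rightarrow> 'b::euclidean_space"
  assumes h: "\<And>q. (h has_derivative h' q) (at q)" and c: "\<And>v. continuous_on UNIV (\<lambda>q. h' q v)"
  shows "((\<lambda>p. integral {0..1} (\<lambda>s. h (s, p))) has_derivative
     (\<lambda>v. integral {0..1} (\<lambda>s. h' (s, p) (0, v)))) (at p)"
proof -
  define fx where "fx p s = Blinfun (\<lambda>v. h' (s, p) (0, v))" for p s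
  have bl: "bounded_linear (\<lambda>v. h' (s, p) (0, v))" for s p
    using bounded_linear_compose[OF has_derivative_bounded_linear[OF h]
       bounded_linear_Pair[OF bounded_linear_zero bounded_linear_ident]] by (simp add: o_def)
  have fx: "blinfun_apply (fx p s) v = h' (s, p) (0, v)" for p s v
    unfolding fx_def using bl by (simp add: bounded_linear_Blinfun_apply)
  have cont: "continuous_on UNIV h" by (rule has_derivative_continuous_on) (use h in blast)
  have "((\<lambda>p. integral (cbox 0 1) (\<lambda>s. h (s, p))) has_derivative integral (cbox 0 1) (fx p)) (at p within UNIV)"
  proof (rule leibniz_rule)
    fix p s
    have "((\<lambda>p. h (s, p)) has_derivative (\<lambda>v. h' (s, p) (0, v))) (at p)"
      by (rule has_derivative_compose[OF _ h]) (auto intro!: derivative_eq_intros)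
    moreover have "blinfun_apply (fx p s) = (\<lambda>v. h' (s, p) (0, v))" using fx by auto
    ultimately show "((\<lambda>p. h (s, p)) has_derivative blinfun_apply (fx p s)) (at p within UNIV)" by simp
  next
    fix p
    show "(\<lambda>s. h (s, p)) integrable_on cbox 0 1"
      by (intro integrable_continuous continuous_on_compose2[OF cont] continuous_intros) auto
  next
    show "continuous_on (UNIV \<times> cbox 0 1) (\<lambda>(p, s). fx p s)"
      unfolding split_beta
      by (rule continuous_on_blinfun_componentwise)
       (auto simp: fx intro!: continuous_on_compose2[OF c] continuous_intros)
  qed auto
  moreover have "blinfun_apply (integral (cbox 0 1) (fx p)) = (\<lambda>v. integral {0..1} (\<lambda>s. h' (s, p) (0, v)))"
  proof
    fix v
    have "continuous_on {0..1} (fx p)"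
      by (rule continuous_on_blinfun_componentwise)
       (auto simp: fx intro!: continuous_on_compose2[OF c] continuous_intros)
    then have "fx p integrable_on cbox 0 1" by (simp add: integrable_continuous_real)
    then show "blinfun_apply (integral (cbox 0 1) (fx p)) v = integral {0..1} (\<lambda>s. h' (s, p) (0, v))"
      by (simp add: blinfun_apply_integral fx)
  qed
  ultimately show ?thesis by simp
qed

lemma ck_on_integral_param:
  fixes h :: "real \<times> 'a::euclidean_space \<Rightarrow> 'b::euclidean_space"
  shows "ck_on k UNIV h \<Longrightarrow> ck_on k UNIV (\<lambda>p. integral {0..1} (\<lambda>s. h (s, p)))"
proof (induction k arbitrary: h)
  case 0
  then have c: "continuous_on UNIV h" by simp
  have "continuous_on UNIV (\<lambda>p. integral (cbox 0 1) (\<lambda>s. h (s, p)))"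
    by (rule integral_continuous_on_param)
      (auto simp: split_beta intro!: continuous_on_compose2[OF c] continuous_intros)
  then show ?case by simp
next
  case (Suc k)
  then obtain h' where h: "\<And>q. (h has_derivative h' q) (at q)" "\<And>v. ck_on k UNIV (\<lambda>q. h' q v)"
    by auto
  then show ?case
    using has_derivative_integral_param[OF h(1) ck_on_continuous[OF h(2)]] Suc.IH[OF h(2)[of "(0, _)"]]
    unfolding ck_on.simps by (intro exI[of _ "\<lambda>p v. integral {0..1} (\<lambda>s. h' (s, p) (0, v))"]) simp
qed

lemma csmooth_integral_param:
  fixes h :: "real \<times> 'a::euclidean_space \<Rightarrow> 'b::euclidean_space"
  shows "csmooth h \<Longrightarrow> csmooth (\<lambda>p. integral {0..1} (\<lambda>s. h (s, p)))"
  by (simp add: csmooth_def ck_on_integral_param)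

lemma csmooth_ftc:
  fixes f :: "'a::real_normed_vector \<Rightarrow> 'b::banach"
  assumes f: "csmooth f"
  shows "f (z + v) - f z = integral {0..1} (\<lambda>s. D f (z + s *\<^sub>R v) v)"
proof -
  have "((\<lambda>s. D f (z + s *\<^sub>R v) v) has_integral (f (z + 1 *\<^sub>R v) - f (z + 0 *\<^sub>R v))) {0..1}"
  proof (rule fundamental_theorem_of_calculus)
    fix s :: real
    have "((\<lambda>s. f (z + s *\<^sub>R v)) has_derivative (\<lambda>t. D f (z + s *\<^sub>R v) (t *\<^sub>R v))) (at s within {0..1})"
      by (rule has_derivative_compose[OF _ csmooth_deriv[OF f]]) (auto intro!: derivative_eq_intros)
    then show "((\<lambda>s. f (z + s *\<^sub>R v)) has_vector_derivative D f (z + s *\<^sub>R v) v) (at s within {0..1})"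
      by (simp add: has_vector_derivative_def linear_scale[OF csmooth_linear_D[OF f]])
  qed auto
  then show ?thesis by (simp add: integral_unique)
qed

text \<open>
  By the fundamental theorem of calculus on the segment from \<open>(0, p)\<close> to \<open>(x, p)\<close>, the quotient
  \<open>h (x, p) / x\<close> is the integral of the \<open>x\<close>-derivative of \<open>h\<close> over \<open>(s x, p)\<close>, \<open>0 \<le> s \<le> 1\<close>, and this integral is smooth up
  to \<open>x = 0\<close>.
\<close>

lemma hadamard_quotient:
  fixes h :: "real \<times> 'a::euclidean_space \<Rightarrow> 'b::euclidean_space"
  assumes h: "csmooth h" and h0: "\<And>p. h (0, p) = 0"
  obtains g where "csmooth g" "\<And>x p. h (x, p) = x *\<^sub>R g (x, p)" "\<And>p. g (0, p) = D h (0, p) (1, 0)"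
proof
  define g where "g q = integral {0..1} (\<lambda>s. D h (s * fst q, snd q) (1, 0))" for q
  show "csmooth g"
  proof -
    have "csmooth (\<lambda>r. D h (fst r * fst (snd r), snd (snd r)) (1, 0))" by (intro csm h)
    from csmooth_integral_param[OF this] show ?thesis unfolding g_def by simp
  qed
  show "h (x, p) = x *\<^sub>R g (x, p)" for x p
  proof -
    have "h (x, p) = integral {0..1} (\<lambda>s. D h (s * x, p) (x, 0))"
      using csmooth_ftc[OF h, of "(0, p)" "(x, 0)"] h0 by simp
    also have "\<dots> = integral {0..1} (\<lambda>s. x *\<^sub>R D h (s * x, p) (1, 0))"
      using linear_scale[OF csmooth_linear_D[OF h], of _ x "(1, 0)"] by simp
    finally show ?thesis by (simp add: g_def)
  qed
  show "g (0, p) = D h (0, p) (1, 0)" for p by (simp add: g_def)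
qed

text \<open>
  The increment \<open>f (w + s a) - f w\<close> is \<open>s\<close> times an average of \<open>D f \<cdot> a\<close>.  Differentiating in \<open>w\<close> along \<open>b\<close>
  gives \<open>D f (z + s a) b - D f z b = s I(s)\<close>, where \<open>I\<close> is smooth and \<open>I(0)\<close> is the derivative along
  \<open>b\<close> of \<open>D f \<cdot> a\<close>; the derivative of both sides at \<open>s = 0\<close> is the claim.
\<close>

lemma symmetric_second_derivative:
  fixes f :: "'a::euclidean_space \<Rightarrow> 'b::euclidean_space"
  assumes f: "csmooth f"
  shows "D (\<lambda>z. D f z a) z b = D (\<lambda>z. D f z b) z a"
proof -
  define I where "I s = integral {0..1} (\<lambda>r. D (\<lambda>z. D f z a) (z + (r * s) *\<^sub>R a) b)" for s :: real
  have fa: "csmooth (\<lambda>z. D f z a)" by (rule csmooth_D[OF f])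
  have key: "D f (z + s *\<^sub>R a) b - D f z b = s *\<^sub>R I s" for s
  proof -
    have 1: "f (w + s *\<^sub>R a) - f w = s *\<^sub>R integral {0..1} (\<lambda>r. D f (w + (r * s) *\<^sub>R a) a)" for w
      using csmooth_ftc[OF f, of w "s *\<^sub>R a"] by (simp add: linear_scale[OF csmooth_linear_D[OF f]])
    have sm: "csmooth (\<lambda>q. D f (snd q + (fst q * s) *\<^sub>R a) a)" by (intro csm f)
    have "((\<lambda>w. f (w + s *\<^sub>R a) - f w) has_derivative (\<lambda>v. D f (z + s *\<^sub>R a) v - D f z v)) (at z)"
      by (intro has_derivative_diff csmooth_deriv f has_derivative_compose[OF _ csmooth_deriv[OF f]])
        (auto intro!: derivative_eq_intros)
    moreover have "((\<lambda>w. s *\<^sub>R integral {0..1} (\<lambda>r. D f (w + (r * s) *\<^sub>R a) a)) has_derivative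
       (\<lambda>v. s *\<^sub>R integral {0..1} (\<lambda>r. D (\<lambda>z. D f z a) (z + (r * s) *\<^sub>R a) v))) (at z)"
    proof -
      have d: "((\<lambda>q. D f (snd q + (fst q * s) *\<^sub>R a) a) has_derivative
          (\<lambda>v. D (\<lambda>z. D f z a) (snd q + (fst q * s) *\<^sub>R a) (snd v + (fst v * s) *\<^sub>R a))) (at q)" for q
        by (rule has_derivative_compose[OF _ csmooth_deriv[OF fa]]) (auto intro!: derivative_eq_intros)
      have "((\<lambda>w. integral {0..1} (\<lambda>r. D f (w + (r * s) *\<^sub>R a) a)) has_derivative
       (\<lambda>v. integral {0..1} (\<lambda>r. D (\<lambda>z. D f z a) (z + (r * s) *\<^sub>R a) v))) (at z)"
        using has_derivative_integral_param[OF d, of z]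
          csmooth_continuous[OF csmooth_D_eval[OF fa, of "\<lambda>q. snd q + (fst q * s) *\<^sub>R a" "\<lambda>_. _"]]
        by (simp add: csm)
      then show ?thesis by (rule has_derivative_scaleR_right)
    qed
    ultimately have "(\<lambda>v. D f (z + s *\<^sub>R a) v - D f z v) =
        (\<lambda>v. s *\<^sub>R integral {0..1} (\<lambda>r. D (\<lambda>z. D f z a) (z + (r * s) *\<^sub>R a) v))"
      unfolding 1 by (rule has_derivative_unique)
    from fun_cong[OF this, of b] show ?thesis by (simp add: I_def)
  qed
  have "csmooth (\<lambda>q. D (\<lambda>z. D f z a) (z + (fst q * snd q) *\<^sub>R a) b)"
    by (intro csm fa)
  from csmooth_integral_param[OF this] have "csmooth I" by (simp add: I_def[abs_def])
  then have "((\<lambda>s. s *\<^sub>R I s) has_derivative (\<lambda>t. 0 *\<^sub>R D I 0 t + t *\<^sub>R I 0)) (at 0)"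
    by (intro bounded_bilinear.FDERIV[OF bounded_bilinear_scaleR] csmooth_deriv) (auto intro: derivative_eq_intros)
  then have 1: "((\<lambda>s. D f (z + s *\<^sub>R a) b - D f z b) has_derivative (\<lambda>t. t *\<^sub>R I 0)) (at 0)"
    using key by simp
  have "((\<lambda>s. D f (z + s *\<^sub>R a) b) has_derivative (\<lambda>t. D (\<lambda>z. D f z b) (z + 0 *\<^sub>R a) (t *\<^sub>R a))) (at 0)"
    by (rule has_derivative_compose[OF _ csmooth_deriv[OF csmooth_D[OF f]]]) (auto intro!: derivative_eq_intros)
  then have "((\<lambda>s. D f (z + s *\<^sub>R a) b - D f z b) has_derivative (\<lambda>t. D (\<lambda>z. D f z b) z (t *\<^sub>R a) - 0)) (at 0)"
    by (intro has_derivative_diff) auto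
  with 1 have "(\<lambda>t. t *\<^sub>R I 0) = (\<lambda>t. D (\<lambda>z. D f z b) z (t *\<^sub>R a) - 0)" by (rule has_derivative_unique)
  then have "1 *\<^sub>R I 0 = D (\<lambda>z. D f z b) z (1 *\<^sub>R a) - 0" by (rule fun_cong)
  then show ?thesis by (simp add: I_def)
qed

section \<open>Singular equations and smooth dependence on parameters\<close>

text \<open>
  On functions regular at \<open>x = 0\<close> this averaging along the ray \<open>s \<mapsto> (s x, v)\<close> inverts the singular operator
  \<open>x \<partial>\<^sub>x + (m + 1)\<close>; see \<open>ravg_derivative_eq\<close>.  Its sup norm is \<open>1 / (m + 1)\<close>, which is what makes
  equations of the form \<open>x z' = - (m + 1) z + g\<close> contractive.
\<close>

definition ravg :: "nat \<Rightarrow> (real \<times> 'v \<Rightarrow> 'z) \<Rightarrow> real \<times> 'v::euclidean_space \<Rightarrow> 'z::euclidean_space"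
  where "ravg m k p = integral {0..1} (\<lambda>s. s ^ m *\<^sub>R k (s * fst p, snd p))"

lemma power_has_integral_01: "((\<lambda>s::real. s ^ m) has_integral 1 / (real m + 1)) {0..1}"
proof -
  have "((\<lambda>s::real. s ^ m) has_integral (1 ^ Suc m / (real m + 1) - 0 ^ Suc m / (real m + 1))) {0..1}"
  proof (rule fundamental_theorem_of_calculus)
    fix s :: real
    have e: "real (Suc m) * s ^ m / (real m + 1) = s ^ m" unfolding of_nat_Suc by (simp add: field_simps add_eq_0_iff)
    have "((\<lambda>s. s ^ Suc m / (real m + 1)) has_real_derivative (real (Suc m) * s ^ m) / (real m + 1)) (at s within {0..1})"
      by (rule DERIV_cdivide) (rule has_field_derivative_at_within, use DERIV_pow[of "Suc m" s] in simp)
    then show "((\<lambda>s. s ^ Suc m / (real m + 1)) has_vector_derivative s ^ m) (at s within {0..1})"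
      unfolding has_real_derivative_iff_has_vector_derivative using e by simp
  qed auto
  then show ?thesis by simp
qed

lemma ravg_integrand_continuous:
  fixes k :: "real \<times> 'v::euclidean_space \<Rightarrow> 'z::euclidean_space"
  assumes "continuous_on UNIV k"
  shows "(\<lambda>s. s ^ m *\<^sub>R k (s * fst p, snd p)) integrable_on {0..1}"
  by (intro integrable_continuous_real continuous_intros continuous_on_compose2[OF assms]) auto

lemma ravg_diff:
  fixes k l :: "real \<times> 'v::euclidean_space \<Rightarrow> 'z::euclidean_space"
  assumes "continuous_on UNIV k" "continuous_on UNIV l"
  shows "ravg m k p - ravg m l p = ravg m (\<lambda>q. k q - l q) p"
  unfolding ravg_def
  by (subst integral_diff[symmetric]) (auto intro: ravg_integrand_continuous assms simp: scaleR_diff_right)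

lemma norm_ravg_le:
  fixes k :: "real \<times> 'v::euclidean_space \<Rightarrow> 'z::euclidean_space"
  assumes k: "continuous_on UNIV k" and B: "\<And>s. 0 \<le> s \<Longrightarrow> s \<le> 1 \<Longrightarrow> norm (k (s * fst p, snd p)) \<le> B"
  shows "norm (ravg m k p) \<le> B / (real m + 1)"
proof -
  have I: "((\<lambda>s::real. s ^ m * B) has_integral 1 / (real m + 1) * B) {0..1}"
    by (rule has_integral_mult_left[OF power_has_integral_01])
  have "norm (integral {0..1} (\<lambda>s. s ^ m *\<^sub>R k (s * fst p, snd p))) \<le> integral {0..1} (\<lambda>s. s ^ m * B)"
    by (rule integral_norm_bound_integral[OF ravg_integrand_continuous[OF k]])
      (use I B in \<open>auto intro!: mult_left_mono\<close>)
  also have "\<dots> = B / (real m + 1)" using integral_unique[OF I] by simp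
  finally show ?thesis by (simp add: ravg_def)
qed

lemma norm_scaled_le: "0 \<le> s \<Longrightarrow> s \<le> 1 \<Longrightarrow> norm (s * fst p, snd p) \<le> norm (p :: real \<times> 'v::real_normed_vector)"
  by (cases p) (auto simp: norm_Pair abs_mult power_mult_distrib power_le_one intro!: real_sqrt_le_mono mult_left_le_one_le)

lemma ravg_continuous:
  fixes k :: "real \<times> 'v::euclidean_space \<Rightarrow> 'z::euclidean_space"
  assumes "continuous_on UNIV k"
  shows "continuous_on UNIV (ravg m k)"
proof -
  have "ck_on 0 UNIV (\<lambda>q. fst q ^ m *\<^sub>R k (fst q * fst (snd q), snd (snd q)))"
    by (simp, intro continuous_intros continuous_on_compose2[OF assms]) auto
  from ck_on_integral_param[OF this] show ?thesis by (simp add: ravg_def[abs_def])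
qed

lemma continuous_on_linear_eval:
  fixes k' :: "'a::topological_space \<Rightarrow> 'b::euclidean_space \<Rightarrow> 'c::real_normed_vector"
  assumes "\<And>v. continuous_on UNIV (\<lambda>q. k' q v)" and "\<And>q. linear (k' q)"
    and "continuous_on S f" "continuous_on S w"
  shows "continuous_on S (\<lambda>x. k' (f x) (w x))"
proof -
  have "continuous_on S (\<lambda>x. \<Sum>b\<in>Basis. (w x \<bullet> b) *\<^sub>R k' (f x) b)"
    by (intro continuous_intros continuous_on_compose2[OF assms(1)] assms) auto
  then show ?thesis by (simp flip: linear_basis_expansion[OF assms(2)])
qed

lemma ravg_has_derivative:
  fixes k :: "real \<times> 'v::euclidean_space \<Rightarrow> 'z::euclidean_space"
  assumes k: "\<And>q. (k has_derivative k' q) (at q)" and c: "\<And>v. continuous_on UNIV (\<lambda>q. k' q v)"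
  shows "(ravg m k has_derivative
    (\<lambda>v. integral {0..1} (\<lambda>s. s ^ m *\<^sub>R k' (s * fst p, snd p) (s * fst v, snd v)))) (at p)"
proof -
  have kc: "continuous_on UNIV k" by (rule has_derivative_continuous_on) (use k in blast)
  have lin: "linear (k' q)" for q using k has_derivative_linear by blast
  define h where "h q = fst q ^ m *\<^sub>R k (fst q * fst (snd q), snd (snd q))" for q :: "real \<times> real \<times> 'v"
  define h' where "h' q w = fst q ^ m *\<^sub>R k' (fst q * fst (snd q), snd (snd q)) (fst q * fst (snd w) + fst w * fst (snd q), snd (snd w))
      + (of_nat m * (fst w * fst q ^ (m - 1))) *\<^sub>R k (fst q * fst (snd q), snd (snd q))" for q w :: "real \<times> real \<times> 'v"
  have hd: "(h has_derivative h' q) (at q)" for q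
  proof -
    have "((\<lambda>q. k (fst q * fst (snd q), snd (snd q))) has_derivative
       (\<lambda>w. k' (fst q * fst (snd q), snd (snd q)) (fst q * fst (snd w) + fst w * fst (snd q), snd (snd w)))) (at q)"
      by (rule has_derivative_compose[OF _ k]) (auto intro!: derivative_eq_intros)
    moreover have "((\<lambda>q. fst q ^ m) has_derivative (\<lambda>w. of_nat m * (fst w * fst q ^ (m - 1)))) (at q)"
      by (auto intro!: derivative_eq_intros simp: mult_ac)
    ultimately show ?thesis unfolding h_def h'_def by (rule has_derivative_scaleR[rotated])
  qed
  have "continuous_on UNIV (\<lambda>q. h' q w)" for w
    unfolding h'_def
    by (intro continuous_intros continuous_on_linear_eval[OF c lin] continuous_on_compose2[OF kc]) auto
  from has_derivative_integral_param[OF hd this, of p]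
  show ?thesis by (simp add: ravg_def[abs_def] h_def h'_def)
qed

lemma ravg_ck_on:
  fixes k :: "real \<times> 'v::euclidean_space \<Rightarrow> 'z::euclidean_space"
  assumes "ck_on j UNIV k"
  shows "ck_on j UNIV (ravg m k)"
proof -
  have s: "csmooth (\<lambda>q::real \<times> real \<times> 'v. (fst q * fst (snd q), snd (snd q)))"
       "csmooth (\<lambda>q::real \<times> real \<times> 'v. fst q ^ m)"
    by (intro csm)+
  have "ck_on j UNIV (\<lambda>q. fst q ^ m *\<^sub>R k (fst q * fst (snd q), snd (snd q)))"
    by (intro ck_on_bilinear[OF bounded_bilinear_scaleR] ck_on_compose[OF assms])
      (use s in \<open>auto simp: csmooth_def\<close>)
  from ck_on_integral_param[OF this] show ?thesis by (simp add: ravg_def[abs_def])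
qed

primrec picard :: "nat \<Rightarrow> ((real \<times> 'v) \<times> 'z \<Rightarrow> 'z) \<Rightarrow> nat \<Rightarrow> real \<times> 'v::euclidean_space \<Rightarrow> 'z::euclidean_space" where
  "picard m g 0 = (\<lambda>p. 0)"
| "picard m g (Suc n) = ravg m (\<lambda>q. g (q, picard m g n q))"

lemma continuous_comp_graph:
  "continuous_on UNIV g \<Longrightarrow> continuous_on UNIV z \<Longrightarrow> continuous_on UNIV (\<lambda>q. g (q, z q))"
  by (rule continuous_on_compose2[of UNIV g]) (auto intro!: continuous_intros)

lemma picard_continuous: "continuous_on UNIV g \<Longrightarrow> continuous_on UNIV (picard m g n)"
  by (induction n) (auto intro!: ravg_continuous continuous_comp_graph)

lemma continuous_on_all_balls:
  fixes z :: "'a::real_normed_vector \<Rightarrow> 'b::topological_space"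
  assumes "\<And>R. continuous_on (cball 0 R) z"
  shows "continuous_on UNIV z"
proof -
  have "continuous (at p) z" for p
    using continuous_on_subset[OF assms[of "norm p + 1"] ball_subset_cball]
    by (rule continuous_on_interior) (simp add: interior_open)
  then show ?thesis by (simp add: continuous_at_imp_continuous_on)
qed

text \<open>
  On a ball, which every dilation \<open>(x, v) \<mapsto> (s x, v)\<close> maps into itself, the Picard map contracts the sup
  norm by the factor \<open>L / (m + 1)\<close>.  Since the balls exhaust the space, the limit exists globally even
  though \<open>g\<close> may be unbounded.
\<close>

lemma picard_limit:
  fixes g :: "(real \<times> 'v::euclidean_space) \<times> 'z::euclidean_space \<Rightarrow> 'z"
  assumes g: "continuous_on UNIV g" and lip: "\<And>p z z'. norm (g (p, z) - g (p, z')) \<le> L * norm (z - z')"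
    and L: "0 \<le> L" "L < real m + 1"
  shows "\<exists>z. continuous_on UNIV z \<and> (\<forall>p. z p = ravg m (\<lambda>q. g (q, z q)) p) \<and>
    (\<forall>R. uniform_limit (cball 0 R) (picard m g) z sequentially)"
proof -
  define q where "q = L / (real m + 1)"
  have q: "0 \<le> q" "q < 1" using L by (auto simp: q_def)
  define f where "f n p = picard m g (Suc n) p - picard m g n p" for n p
  define z where "z p = (\<Sum>n. f n p)" for p
  have tel: "(\<Sum>i<n. f i p) = picard m g n p" for n p
    unfolding f_def by (subst sum_lessThan_telescope) simp
  have ul: "uniform_limit (cball 0 R) (picard m g) z sequentially" for R
  proof -
    have "compact (picard m g 1 ` cball 0 R)"
      by (intro compact_continuous_image continuous_on_subset[OF picard_continuous[OF g]]) auto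
    then obtain C where C: "\<And>p. p \<in> cball 0 R \<Longrightarrow> norm (picard m g 1 p) \<le> C"
      by (meson bounded_iff compact_imp_bounded imageI)
    have "norm (f n p) \<le> C * q ^ n" if "p \<in> cball 0 R" for n p
      using that
    proof (induction n arbitrary: p)
      case 0
      then show ?case using C by (simp add: f_def)
    next
      case (Suc n)
      have cc: "continuous_on UNIV (\<lambda>q. g (q, picard m g i q))" for i
        by (intro continuous_comp_graph picard_continuous g)
      have "f (Suc n) p = ravg m (\<lambda>q. g (q, picard m g (Suc n) q) - g (q, picard m g n q)) p"
        unfolding ravg_diff[OF cc cc, symmetric] by (simp add: f_def)
      also have "norm \<dots> \<le> (L * (C * q ^ n)) / (real m + 1)"
      proof (rule norm_ravg_le)
        fix s :: real assume s: "0 \<le> s" "s \<le> 1"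
        let ?p = "(s * fst p, snd p)"
        have "?p \<in> cball 0 R" using norm_scaled_le[OF s, of p] Suc.prems by simp
        then have "norm (f n ?p) \<le> C * q ^ n" by (rule Suc.IH)
        then show "norm (g (?p, picard m g (Suc n) ?p) - g (?p, picard m g n ?p)) \<le> L * (C * q ^ n)"
          using lip[of ?p "picard m g (Suc n) ?p" "picard m g n ?p"] mult_left_mono[OF _ L(1)]
          unfolding f_def by (meson order_trans)
      qed (intro continuous_intros cc)
      also have "\<dots> = C * q ^ Suc n" by (simp add: q_def)
      finally show ?case .
    qed
    then have "uniform_limit (cball 0 R) (\<lambda>n p. \<Sum>i<n. f i p) z sequentially"
      unfolding z_def using q by (intro Weierstrass_m_test) (auto intro!: summable_mult summable_geometric)
    then show ?thesis unfolding tel by (simp add: eta_contract_eq)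
  qed
  have zc: "continuous_on UNIV z"
    by (intro continuous_on_all_balls uniform_limit_theorem[OF _ ul])
      (auto intro!: always_eventually continuous_on_subset[OF picard_continuous[OF g]])
  have fix_eq: "z p = ravg m (\<lambda>q. g (q, z q)) p" for p
  proof -
    have 1: "(\<lambda>n. picard m g (Suc n) p) \<longlonglongrightarrow> z p"
      using tendsto_uniform_limitI[OF ul[of "norm p"], of p] by (intro LIMSEQ_Suc) simp
    have "(\<lambda>n. picard m g (Suc n) p) \<longlonglongrightarrow> ravg m (\<lambda>q. g (q, z q)) p"
    proof (rule metric_LIMSEQ_I)
      fix e :: real assume "0 < e"
      define d where "d = e / (L + 1)"
      have d: "0 < d" "L * d < e"
        using \<open>0 < e\<close> L mult_strict_right_mono[of L "L+1" d] by (auto simp: d_def field_simps)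
      obtain N where N: "\<And>n r. n \<ge> N \<Longrightarrow> r \<in> cball 0 (norm p) \<Longrightarrow> dist (picard m g n r) (z r) < d"
        using ul[of "norm p"] d unfolding uniform_limit_sequentially_iff by blast
      have "dist (picard m g (Suc n) p) (ravg m (\<lambda>q. g (q, z q)) p) < e" if "n \<ge> N" for n
      proof -
        have "norm (picard m g (Suc n) p - ravg m (\<lambda>q. g (q, z q)) p) \<le> (L * d) / (real m + 1)"
          unfolding picard.simps
        proof (subst ravg_diff, goal_cases)
          case 3
          show ?case
          proof (rule norm_ravg_le)
            fix s :: real assume s: "0 \<le> s" "s \<le> 1"
            let ?p = "(s * fst p, snd p)"
            have "?p \<in> cball 0 (norm p)" using norm_scaled_le[OF s, of p] by simp
            from N[OF that this] have "norm (picard m g n ?p - z ?p) \<le> d" unfolding dist_norm by (rule less_imp_le)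
            then show "norm (g (?p, picard m g n ?p) - g (?p, z ?p)) \<le> L * d"
              using lip[of ?p "picard m g n ?p" "z ?p"] mult_left_mono[OF _ L(1)] by (meson order_trans)
          qed (intro continuous_intros continuous_comp_graph g zc picard_continuous)
        qed (intro continuous_comp_graph g zc picard_continuous)+
        also have "\<dots> \<le> L * d" using L d divide_left_mono[of 1 "real m + 1" "L * d"] by simp
        finally show ?thesis using d by (simp add: dist_norm)
      qed
      then show "\<exists>no. \<forall>n\<ge>no. dist (picard m g (Suc n) p) (ravg m (\<lambda>q. g (q, z q)) p) < e" by blast
    qed
    then show ?thesis using 1 LIMSEQ_unique by blast
  qed
  show ?thesis using zc fix_eq ul by blast
qed

lemma ravg_fixed_point_exists:
  fixes g :: "(real \<times> 'v::euclidean_space) \<times> 'z::euclidean_space \<Rightarrow> 'z"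
  assumes "continuous_on UNIV g" and "\<And>p z z'. norm (g (p, z) - g (p, z')) \<le> L * norm (z - z')"
    and "0 \<le> L" "L < real m + 1"
  shows "\<exists>z. continuous_on UNIV z \<and> (\<forall>p. z p = ravg m (\<lambda>q. g (q, z q)) p)"
  using picard_limit[OF assms] by blast

lemma ravg_fixed_point_unique:
  fixes g :: "(real \<times> 'v::euclidean_space) \<times> 'z::euclidean_space \<Rightarrow> 'z"
  assumes g: "continuous_on UNIV g" and lip: "\<And>p z z'. norm (g (p, z) - g (p, z')) \<le> L * norm (z - z')"
    and L: "0 \<le> L" "L < real m + 1"
    and z1: "continuous_on UNIV z1" "\<And>p. z1 p = ravg m (\<lambda>q. g (q, z1 q)) p"
    and z2: "continuous_on UNIV z2" "\<And>p. z2 p = ravg m (\<lambda>q. g (q, z2 q)) p"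
  shows "z1 p = z2 p"
proof -
  have "\<exists>w\<in>cball 0 (norm p). \<forall>y\<in>cball 0 (norm p). norm (z1 y - z2 y) \<le> norm (z1 w - z2 w)"
    by (intro continuous_attains_sup continuous_intros continuous_on_subset[OF z1(1)] continuous_on_subset[OF z2(1)]) auto
  then obtain w where w: "w \<in> cball 0 (norm p)" "\<And>y. y\<in>cball 0 (norm p) \<Longrightarrow> norm (z1 y - z2 y) \<le> norm (z1 w - z2 w)"
    by blast
  have "z1 w - z2 w = ravg m (\<lambda>q. g (q, z1 q) - g (q, z2 q)) w"
    by (subst z1(2), subst z2(2), rule ravg_diff) (intro continuous_comp_graph g z1 z2)+
  also have "norm \<dots> \<le> (L * norm (z1 w - z2 w)) / (real m + 1)"
  proof (rule norm_ravg_le)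
    fix s :: real assume s: "0 \<le> s" "s \<le> 1"
    let ?p = "(s * fst w, snd w)"
    have "?p \<in> cball 0 (norm p)" using norm_scaled_le[OF s, of w] w(1) by simp
    then show "norm (g (?p, z1 ?p) - g (?p, z2 ?p)) \<le> L * norm (z1 w - z2 w)"
      using lip[of ?p "z1 ?p" "z2 ?p"] mult_left_mono[OF w(2) L(1)] by (meson order_trans)
  qed (intro continuous_intros continuous_comp_graph g z1 z2)
  finally have "norm (z1 w - z2 w) * (real m + 1 - L) \<le> 0" by (simp add: field_simps)
  then have "norm (z1 w - z2 w) = 0" using L by (auto simp: mult_le_0_iff)
  then show ?thesis using w(2)[of p] by simp
qed

lemma lipschitz_derivative_le:
  fixes f :: "'a::real_normed_vector \<Rightarrow> 'b::real_normed_vector"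
  assumes d: "(f has_derivative f') (at x)" and lip: "\<And>t. norm (f (x + t *\<^sub>R a) - f x) \<le> L * norm (t *\<^sub>R a)"
  shows "norm (f' a) \<le> L * norm a"
proof -
  have lin: "linear f'" using d by (rule has_derivative_linear)
  have "norm (f' a) \<le> L * norm a + e" if "e > 0" for e
  proof (cases "a = 0")
    case False
    define e' where "e' = e / norm a"
    have "e' > 0" using that False by (simp add: e'_def)
    then obtain d where d: "d > 0" "\<And>y. norm (y - x) < d \<Longrightarrow> norm (f y - f x - f' (y - x)) \<le> e' * norm (y - x)"
      using d unfolding has_derivative_at_alt by blast
    define t where "t = d / (2 * norm a)"
    have t: "t > 0" "t * norm a < d" using d False by (auto simp: t_def)
    have "norm (f (x + t *\<^sub>R a) - f x - f' (t *\<^sub>R a)) \<le> e' * norm (t *\<^sub>R a)"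
      using d(2)[of "x + t *\<^sub>R a"] t by simp
    moreover have "norm (f' (t *\<^sub>R a)) \<le> norm (f (x + t *\<^sub>R a) - f x) + norm (f (x + t *\<^sub>R a) - f x - f' (t *\<^sub>R a))"
      by (metis norm_minus_commute norm_triangle_sub)
    ultimately have "norm (f' (t *\<^sub>R a)) \<le> L * norm (t *\<^sub>R a) + e' * norm (t *\<^sub>R a)"
      using lip[of t] by linarith
    then have "t * norm (f' a) \<le> t * (L * norm a + e)"
      using t False by (simp add: linear_scale[OF lin] e'_def algebra_simps)
    then show ?thesis using t by simp
  qed (use that linear_0[OF lin] in simp)
  then show ?thesis by (rule field_le_epsilon)
qed

text \<open>
  Locally uniform convergence \<open>f n \<rightarrow> z\<close> passes through a continuous function of the graph, because the
  graphs eventually stay in one compact set on which that function is uniformly continuous.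
\<close>

lemma uniform_limit_graph:
  fixes G :: "'a::euclidean_space \<times> 'b::euclidean_space \<Rightarrow> 'c::metric_space"
  assumes G: "continuous_on UNIV G" and K: "compact K" and z: "continuous_on UNIV z"
    and lim: "uniform_limit K f z sequentially"
  shows "uniform_limit K (\<lambda>n p. G (p, f n p)) (\<lambda>p. G (p, z p)) sequentially"
  unfolding uniform_limit_sequentially_iff
proof (intro allI impI)
  fix e :: real assume e: "e > 0"
  have "compact (z ` K)" by (intro compact_continuous_image continuous_on_subset[OF z] K) auto
  then obtain M where M: "\<And>p. p \<in> K \<Longrightarrow> norm (z p) \<le> M" by (meson bounded_iff compact_imp_bounded imageI)
  have "uniformly_continuous_on (K \<times> cball 0 (M + 1)) G"
    by (intro compact_uniformly_continuous continuous_on_subset[OF G] compact_Times K) auto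
  then obtain d where d: "d > 0" "\<And>x x'. x \<in> K \<times> cball 0 (M + 1) \<Longrightarrow> x' \<in> K \<times> cball 0 (M + 1) \<Longrightarrow>
      dist x' x < d \<Longrightarrow> dist (G x') (G x) < e"
    using e unfolding uniformly_continuous_on_def by metis
  obtain N where N: "\<And>n p. n \<ge> N \<Longrightarrow> p \<in> K \<Longrightarrow> dist (f n p) (z p) < min d 1"
    using lim d(1) unfolding uniform_limit_sequentially_iff by (metis min_less_iff_conj zero_less_one)
  have "dist (G (p, f n p)) (G (p, z p)) < e" if "n \<ge> N" "p \<in> K" for n p
  proof (rule d(2))
    have "norm (f n p) \<le> norm (z p) + dist (f n p) (z p)"
      by (metis dist_norm norm_triangle_sub add.commute)
    then show "(p, f n p) \<in> K \<times> cball 0 (M + 1)" using M[OF that(2)] N[OF that] that by simp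
    show "(p, z p) \<in> K \<times> cball 0 (M + 1)" using M[OF that(2)] that by simp
    show "dist (p, f n p) (p, z p) < d" using N[OF that] by (simp add: dist_Pair_Pair)
  qed
  then show "\<exists>N. \<forall>n\<ge>N. \<forall>x\<in>K. dist (G (x, f n x)) (G (x, z x)) < e" by blast
qed

text \<open>
  A dilation multiplies the basis vector of the first coordinate by \<open>s\<close> and fixes the other ones, so
  differentiating a radial average along a basis vector raises its exponent by this weight.
\<close>

definition dilation_weight :: "real \<times> 'v::real_vector \<Rightarrow> nat"
  where "dilation_weight e = (if snd e = 0 then 1 else 0)"

lemma dilate_basis:
  "e \<in> Basis \<Longrightarrow> (s * fst e, snd e) = s ^ dilation_weight e *\<^sub>R (e :: real \<times> 'v::euclidean_space)"
  by (auto simp: dilation_weight_def Basis_prod_def)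

text \<open>
  Formally, the derivative \<open>a e\<close> of the fixed point along \<open>e\<close> solves the linearised fixed point equation,
  which is a contraction with the same constant \<open>L\<close> and an exponent that is at least as large; hence
  it has a continuous solution.  The derivatives of the Picard iterates satisfy the same equation up to
  an error that tends to zero locally uniformly, so they converge to \<open>a e\<close>, and the limit of the iterates
  is differentiable with derivative built from the \<open>a e\<close>.
\<close>

lemma fixed_point_C1:
  fixes g :: "(real \<times> 'v::euclidean_space) \<times> 'z::euclidean_space \<Rightarrow> 'z"
  assumes g: "ck_on (Suc 0) UNIV g" and lip: "\<And>p z z'. norm (g (p, z) - g (p, z')) \<le> L * norm (z - z')"
    and L: "0 \<le> L" "L < real m + 1"
    and z: "continuous_on UNIV z" "\<And>p. z p = ravg m (\<lambda>q. g (q, z q)) p"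
  obtains a where "\<And>e. continuous_on UNIV (a e)"
    "\<And>e p. a e p = ravg (m + dilation_weight e) (\<lambda>q. D g (q, z q) (e, a e q)) p"
    "\<And>p. (z has_derivative (\<lambda>v. \<Sum>e\<in>Basis. (v \<bullet> e) *\<^sub>R a e p)) (at p)"
proof -
  have gd: "(g has_derivative D g q) (at q)" and gc: "continuous_on UNIV (\<lambda>q. D g q v)" for q v
    using ck_on_open_Suc[OF open_UNIV g] by auto
  have gc0: "continuous_on UNIV g" using ck_on_continuous[OF g] .
  have lin: "linear (D g q)" for q using gd has_derivative_linear by blast
  have Dlip: "norm (D g (q, y) (e, b) - D g (q, y) (e, b')) \<le> L * norm (b - b')" for q y e b b'
  proof -
    have "D g (q, y) (e, b) - D g (q, y) (e, b') = D g (q, y) (0, b - b')"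
      by (simp flip: linear_diff[OF lin])
    moreover have "norm (D g (q, y) (0, b - b')) \<le> L * norm (0::real\<times>'v, b - b')"
      by (rule lipschitz_derivative_le[OF gd]) (use lip[of q "y + t *\<^sub>R (b - b')" y for t] in \<open>simp add: norm_Pair\<close>)
    ultimately show ?thesis by (simp add: norm_Pair)
  qed
  define G where "G e r = D g (fst r, z (fst r)) (e, snd r)" for e :: "real \<times> 'v" and r :: "(real \<times> 'v) \<times> 'z"
  have Gc: "continuous_on UNIV (G e)" for e
    unfolding G_def by (intro continuous_on_linear_eval[OF gc lin] continuous_intros continuous_on_compose2[OF z(1)]) auto
  have "\<exists>y. continuous_on UNIV y \<and> (\<forall>p. y p = ravg (m + dilation_weight e) (\<lambda>q. G e (q, y q)) p)" for e
  proof -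
    have "norm (G e (p, y) - G e (p, y')) \<le> L * norm (y - y')" for p y y'
      unfolding G_def fst_conv snd_conv by (rule Dlip)
    moreover have "L < real (m + dilation_weight e) + 1" using L by simp
    ultimately show ?thesis by (rule ravg_fixed_point_exists[OF Gc _ L(1)])
  qed
  then have "\<exists>a. \<forall>e. continuous_on UNIV (a e) \<and> (\<forall>p. a e p = ravg (m + dilation_weight e) (\<lambda>q. G e (q, a e q)) p)"
    by (intro choice allI)
  then obtain a where a0: "\<forall>e. continuous_on UNIV (a e) \<and> (\<forall>p. a e p = ravg (m + dilation_weight e) (\<lambda>q. G e (q, a e q)) p)"
    by (rule exE)
  have a: "continuous_on UNIV (a e)" "a e p = ravg (m + dilation_weight e) (\<lambda>q. D g (q, z q) (e, a e q)) p" for e p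
    using a0 unfolding G_def fst_conv snd_conv by blast+
  have zlim: "uniform_limit (cball 0 R) (picard m g) z sequentially" for R
  proof -
    obtain z' where z': "continuous_on UNIV z'" "\<And>p. z' p = ravg m (\<lambda>q. g (q, z' q)) p"
        "\<And>R. uniform_limit (cball 0 R) (picard m g) z' sequentially"
      using picard_limit[OF gc0 lip L] by blast
    have "z = z'" by (rule ext, rule ravg_fixed_point_unique[OF gc0 lip L z z'(1,2)])
    then show ?thesis using z'(3) by simp
  qed
  have pck: "ck_on (Suc 0) UNIV (picard m g n)" for n
  proof (induction n)
    case 0
    then show ?case unfolding picard.simps by (rule ck_on_const)
  next
    case (Suc n)
    then show ?case unfolding picard.simps
      by (intro ravg_ck_on ck_on_compose[OF g] ck_on_Pair ck_on_linear[OF bounded_linear_ident] Suc subset_UNIV)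
  qed
  have pd: "(picard m g n has_derivative D (picard m g n) q) (at q)"
    and pc: "continuous_on UNIV (\<lambda>q. D (picard m g n) q v)" for n q v
    using ck_on_open_Suc[OF open_UNIV pck] by auto
  have plin: "linear (D (picard m g n) q)" for n q using pd has_derivative_linear by blast
  have intc: "continuous_on UNIV (\<lambda>q. D g (q, picard m g n q) (v, D (picard m g n) q v))" for n v
    by (intro continuous_on_linear_eval[OF gc lin] continuous_intros continuous_on_linear_eval[OF pc plin]
        picard_continuous gc0)
  have step: "D (picard m g (Suc n)) p e =
      ravg (m + dilation_weight e) (\<lambda>q. D g (q, picard m g n q) (e, D (picard m g n) q e)) p"
    if e: "e \<in> Basis" for n p and e :: "real \<times> 'v"
  proof -
    have kd: "((\<lambda>q. g (q, picard m g n q)) has_derivative (\<lambda>v. D g (q, picard m g n q) (v, D (picard m g n) q v))) (at q)" for q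
      by (rule has_derivative_compose[OF _ gd]) (intro has_derivative_Pair pd has_derivative_ident)
    from frechet_derivative_at[OF ravg_has_derivative[OF kd intc, of m p]]
    have "D (picard m g (Suc n)) p e = integral {0..1} (\<lambda>s. s ^ m *\<^sub>R
        D g ((s * fst p, snd p), picard m g n (s * fst p, snd p))
        ((s * fst e, snd e), D (picard m g n) (s * fst p, snd p) (s * fst e, snd e)))"
      by (auto dest!: fun_cong[of _ _ e])
    also have "\<dots> = integral {0..1} (\<lambda>s. s ^ (m + dilation_weight e) *\<^sub>R
        D g ((s * fst p, snd p), picard m g n (s * fst p, snd p)) (e, D (picard m g n) (s * fst p, snd p) e))"
      unfolding dilate_basis[OF e] linear_scale[OF plin] scaleR_Pair[symmetric] linear_scale[OF lin]
      by (simp add: power_add)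
    finally show ?thesis by (simp add: ravg_def)
  qed
  have dlim: "\<exists>N. \<forall>n\<ge>N. \<forall>p\<in>cball 0 R. norm (D (picard m g n) p e - a e p) \<le> \<epsilon>"
    if e: "e \<in> Basis" and eps: "0 < \<epsilon>" for e :: "real \<times> 'v" and R \<epsilon> :: real
  proof -
    define M where "M = real (m + dilation_weight e) + 1"
    define q where "q = L / M"
    have M1: "1 \<le> M" "L < M" using L by (auto simp: M_def)
    have q: "0 \<le> q" "q < 1" using L M1 by (auto simp: q_def)
    define \<delta> where "\<delta> = (\<epsilon>/2) * (1 - q)"
    have \<delta>: "0 < \<delta>" using eps q by (simp add: \<delta>_def)
    have "continuous_on UNIV (\<lambda>r. D g r (e, a e (fst r)))"
      by (intro continuous_on_linear_eval[OF gc lin] continuous_intros continuous_on_compose2[OF a(1)]) auto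
    from uniform_limit_graph[OF this compact_cball z(1) zlim]
    have "uniform_limit (cball 0 R) (\<lambda>n p. D g (p, picard m g n p) (e, a e p)) (\<lambda>p. D g (p, z p) (e, a e p)) sequentially"
      by simp
    then obtain N where N: "\<And>n p. n \<ge> N \<Longrightarrow> p \<in> cball 0 R \<Longrightarrow>
        dist (D g (p, picard m g n p) (e, a e p)) (D g (p, z p) (e, a e p)) < \<delta>"
      using \<delta> unfolding uniform_limit_sequentially_iff by blast
    have "compact ((\<lambda>p. D (picard m g N) p e - a e p) ` cball 0 R)"
      by (intro compact_continuous_image continuous_intros continuous_on_subset[OF pc] continuous_on_subset[OF a(1)]) auto
    then obtain B where B: "\<And>p. p \<in> cball 0 R \<Longrightarrow> norm (D (picard m g N) p e - a e p) \<le> B"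
      by (meson bounded_iff compact_imp_bounded imageI)
    \<comment> \<open>The defect of one step is \<open>\<delta>\<close>; all the steps together contribute \<open>\<delta> / (1 - q) = \<epsilon> / 2\<close>.\<close>
    have bound: "norm (D (picard m g (N + i)) p e - a e p) \<le> q ^ i * B + \<epsilon>/2" if "p \<in> cball 0 R" for i p
      using that
    proof (induction i arbitrary: p)
      case 0
      then show ?case using B[of p] eps by simp
    next
      case (Suc i)
      let ?b = "q ^ i * B + \<epsilon>/2"
      have "D (picard m g (N + Suc i)) p e - a e p = ravg (m + dilation_weight e)
         (\<lambda>q. D g (q, picard m g (N + i) q) (e, D (picard m g (N + i)) q e) - D g (q, z q) (e, a e q)) p"
        unfolding add_Suc_right step[OF e]
        by (subst a(2), rule ravg_diff) (intro intc continuous_on_linear_eval[OF gc lin] continuous_intros z a)+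
      also have "norm \<dots> \<le> (L * ?b + \<delta>) / M"
        unfolding M_def
      proof (rule norm_ravg_le)
        fix s :: real assume s: "0 \<le> s" "s \<le> 1"
        let ?p = "(s * fst p, snd p)"
        have K: "?p \<in> cball 0 R" using norm_scaled_le[OF s, of p] Suc.prems by simp
        have "norm (D g (?p, picard m g (N + i) ?p) (e, D (picard m g (N + i)) ?p e)
              - D g (?p, picard m g (N + i) ?p) (e, a e ?p)) \<le> L * ?b"
          using Dlip mult_left_mono[OF Suc.IH[OF K] L(1)] by (meson order_trans)
        moreover have "norm (D g (?p, picard m g (N + i) ?p) (e, a e ?p) - D g (?p, z ?p) (e, a e ?p)) \<le> \<delta>"
          using N[OF _ K, of "N + i"] by (simp add: dist_norm)
        ultimately show "norm (D g (?p, picard m g (N + i) ?p) (e, D (picard m g (N + i)) ?p e) - D g (?p, z ?p) (e, a e ?p)) \<le> L * ?b + \<delta>"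
          by (rule norm_diff_triangle_le)
      qed (intro continuous_intros intc continuous_on_linear_eval[OF gc lin] z a)
      also have "\<dots> \<le> q * ?b + \<delta>"
        using M1 \<delta> divide_left_mono[of 1 M \<delta>] by (simp add: q_def add_divide_distrib)
      also have "\<dots> = q ^ Suc i * B + \<epsilon>/2" by (simp add: \<delta>_def field_simps)
      finally show ?case .
    qed
    have "(\<lambda>i. q ^ i * B) \<longlonglongrightarrow> 0 * B" by (intro tendsto_mult LIMSEQ_realpow_zero q tendsto_const)
    then have "\<forall>\<^sub>F i in sequentially. q ^ i * B < \<epsilon>/2"
      by (rule order_tendstoD(2)) (use eps in simp)
    then obtain i0 where i0: "\<And>i. i \<ge> i0 \<Longrightarrow> q ^ i * B < \<epsilon>/2" unfolding eventually_sequentially by blast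
    have "norm (D (picard m g n) p e - a e p) \<le> \<epsilon>" if n: "n \<ge> N + i0" and "p \<in> cball 0 R" for n p
    proof -
      obtain i where i: "n = N + i" "i \<ge> i0" using n by (metis add.assoc le_add1 le_Suc_ex)
      show ?thesis using bound[OF that(2), of i] i0[OF i(2)] i(1) by simp
    qed
    then show ?thesis by blast
  qed
  have "(z has_derivative (\<lambda>v. \<Sum>e\<in>Basis. (v \<bullet> e) *\<^sub>R a e p)) (at p)" for p
  proof -
    define S where "S = ball (0::real \<times> 'v) (norm p + 1)"
    have pS: "p \<in> S" "open S" "convex S" by (auto simp: S_def)
    have lim: "(\<lambda>n. picard m g n x) \<longlonglongrightarrow> z x" for x
      using tendsto_uniform_limitI[OF zlim[of "norm x"], of x] by simp
    have "\<exists>zz. \<forall>x\<in>S. (\<lambda>n. picard m g n x) \<longlonglongrightarrow> zz x \<and>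
        (zz has_derivative (\<lambda>v. \<Sum>e\<in>Basis. (v \<bullet> e) *\<^sub>R a e x)) (at x within S)"
    proof (rule has_derivative_sequence[OF pS(3) _ _ pS(1) lim])
      show "(picard m g n has_derivative D (picard m g n) x) (at x within S)" for n x
        using pd has_derivative_at_withinI by blast
      fix \<epsilon> :: real assume \<epsilon>: "\<epsilon> > 0"
      let ?d = "real DIM(real \<times> 'v)"
      have "\<forall>\<^sub>F n in sequentially. \<forall>e\<in>Basis. \<forall>x\<in>S. norm (D (picard m g n) x e - a e x) \<le> \<epsilon> / ?d"
      proof (rule eventually_ball_finite[OF finite_Basis], rule ballI)
        fix e :: "real \<times> 'v" assume "e \<in> Basis"
        then show "\<forall>\<^sub>F n in sequentially. \<forall>x\<in>S. norm (D (picard m g n) x e - a e x) \<le> \<epsilon> / ?d"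
          using dlim[of e "\<epsilon> / ?d" "norm p + 1"] \<epsilon> unfolding eventually_sequentially S_def
          by (force simp: less_imp_le)
      qed
      then show "\<forall>\<^sub>F n in sequentially. \<forall>x\<in>S. \<forall>h. norm (D (picard m g n) x h - (\<Sum>e\<in>Basis. (h \<bullet> e) *\<^sub>R a e x)) \<le> \<epsilon> * norm h"
      proof eventually_elim
        case (elim n)
        show ?case
        proof (intro ballI allI)
          fix x h assume x: "x \<in> S"
          have "D (picard m g n) x h - (\<Sum>e\<in>Basis. (h \<bullet> e) *\<^sub>R a e x) =
              (\<Sum>e\<in>Basis. (h \<bullet> e) *\<^sub>R (D (picard m g n) x e - a e x))"
            by (subst linear_basis_expansion[OF plin]) (simp add: sum_subtractf scaleR_diff_right)
          also have "norm \<dots> \<le> (\<Sum>e\<in>(Basis::(real\<times>'v) set). norm h * (\<epsilon> / ?d))"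
          proof (rule sum_norm_le)
            fix e :: "real \<times> 'v" assume e: "e \<in> Basis"
            have "\<bar>h \<bullet> e\<bar> \<le> norm h" using e by (rule Basis_le_norm)
            then show "norm ((h \<bullet> e) *\<^sub>R (D (picard m g n) x e - a e x)) \<le> norm h * (\<epsilon> / ?d)"
              using elim e x \<epsilon> unfolding norm_scaleR by (intro mult_mono) auto
          qed
          also have "\<dots> = \<epsilon> * norm h" by (simp add: field_simps)
          finally show "norm (D (picard m g n) x h - (\<Sum>e\<in>Basis. (h \<bullet> e) *\<^sub>R a e x)) \<le> \<epsilon> * norm h" .
        qed
      qed
    qed
    then obtain zz where zz: "\<And>x. x \<in> S \<Longrightarrow> (\<lambda>n. picard m g n x) \<longlonglongrightarrow> zz x"
        "\<And>x. x \<in> S \<Longrightarrow> (zz has_derivative (\<lambda>v. \<Sum>e\<in>Basis. (v \<bullet> e) *\<^sub>R a e x)) (at x within S)" by blast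
    have "zz x = z x" if "x \<in> S" for x using zz(1)[OF that] lim LIMSEQ_unique by blast
    then have "(z has_derivative (\<lambda>v. \<Sum>e\<in>Basis. (v \<bullet> e) *\<^sub>R a e p)) (at p within S)"
      by (intro has_derivative_transform[OF pS(1) _ zz(2)[OF pS(1)]]) simp
    then show ?thesis unfolding at_within_open[OF pS(1,2)] .
  qed
  from that[OF a this] show ?thesis .
qed

text \<open>
  Induction on \<open>k\<close>.  The derivatives of the fixed point are fixed points of a linear equation whose
  right-hand side involves the fixed point itself and one derivative of \<open>g\<close>: if \<open>g\<close> is of class \<open>k + 1\<close>,
  the induction hypothesis first makes the fixed point of class \<open>k\<close>, which makes the linear equation of
  class \<open>k\<close>, and then applies to its solution.  This needs the statement for all \<open>m\<close> and \<open>g\<close> at once.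
\<close>

lemma fixed_point_ck_on:
  fixes g :: "(real \<times> 'v::euclidean_space) \<times> 'z::euclidean_space \<Rightarrow> 'z"
  assumes "ck_on k UNIV g" and "\<And>p z z'. norm (g (p, z) - g (p, z')) \<le> L * norm (z - z')"
    and "0 \<le> L" "L < real m + 1"
    and "continuous_on UNIV z" "\<And>p. z p = ravg m (\<lambda>q. g (q, z q)) p"
  shows "ck_on k UNIV z"
  using assms
proof (induction k arbitrary: g m z)
  case 0
  from 0(5) show ?case by simp
next
  case (Suc k)
  note g = Suc.prems(1) and lip = Suc.prems(2) and L = Suc.prems(3,4) and z = Suc.prems(5,6)
  have zk: "ck_on k UNIV z" by (rule Suc.IH[OF ck_on_SucD[OF g] lip L z])
  have g1: "ck_on (Suc 0) UNIV g" using g by (rule ck_on_mono) simp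
  obtain a where a: "\<And>e. continuous_on UNIV (a e)"
    "\<And>e p. a e p = ravg (m + dilation_weight e) (\<lambda>q. D g (q, z q) (e, a e q)) p"
    and zd: "\<And>p. (z has_derivative (\<lambda>v. \<Sum>e\<in>Basis. (v \<bullet> e) *\<^sub>R a e p)) (at p)"
    by (rule fixed_point_C1[OF g1 lip L z]) blast
  have gd: "(g has_derivative D g q) (at q)" and gk: "ck_on k UNIV (\<lambda>q. D g q v)" for q v
    using ck_on_open_Suc[OF open_UNIV g] by auto
  have lin: "linear (D g q)" for q using gd has_derivative_linear by blast
  have "ck_on k UNIV (a e)" for e
  proof (rule Suc.IH[where g = "\<lambda>r. D g (fst r, z (fst r)) (e, snd r)" and m = "m + dilation_weight e"])
    have gr: "ck_on k UNIV (\<lambda>r. (fst r, z (fst r)))" for S :: "((real\<times>'v)\<times>'z) set"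
      by (intro ck_on_Pair ck_on_linear[OF bounded_linear_fst] ck_on_compose[OF zk] subset_UNIV)
    have ck: "ck_on k UNIV (\<lambda>r. D g (fst r, z (fst r)) (e, 0) + (\<Sum>b\<in>Basis. (snd r \<bullet> b) *\<^sub>R D g (fst r, z (fst r)) (0, b)))"
      by (intro ck_on_add ck_on_sum ck_on_bilinear[OF bounded_bilinear_scaleR] ck_on_compose[OF gk gr]
          ck_on_linear_compose[OF bounded_linear_inner_left] ck_on_linear[OF bounded_linear_snd] subset_UNIV)
    have eq: "D g q (e, y) = D g q (e, 0) + (\<Sum>b\<in>Basis. (y \<bullet> b) *\<^sub>R D g q (0, b))" for q y
    proof -
      have "linear (\<lambda>y. D g q (0, y))"
        using linear_compose[of "\<lambda>y. (0, y)" "D g q"] lin by (simp add: o_def linear_iff)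
      from linear_basis_expansion[OF this, of y]
      show ?thesis using linear_add[OF lin, of q "(e, 0)" "(0, y)"] by simp
    qed
    show "ck_on k UNIV (\<lambda>r. D g (fst r, z (fst r)) (e, snd r))"
      by (rule ck_on_cong[OF _ ck]) (rule eq[symmetric])
    show "norm (D g (fst (p, y), z (fst (p, y))) (e, snd (p, y)) - D g (fst (p, y'), z (fst (p, y'))) (e, snd (p, y'))) \<le> L * norm (y - y')" for p y y'
    proof -
      have "D g (p, z p) (e, y) - D g (p, z p) (e, y') = D g (p, z p) (0, y - y')"
        by (simp flip: linear_diff[OF lin])
      moreover have "norm (D g (p, z p) (0, y - y')) \<le> L * norm (0::real\<times>'v, y - y')"
        by (rule lipschitz_derivative_le[OF gd]) (use lip[of p "z p + t *\<^sub>R (y - y')" "z p" for t] in \<open>simp add: norm_Pair\<close>)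
      ultimately show ?thesis by (simp add: norm_Pair)
    qed
  next
    show "continuous_on UNIV (a e)" by (rule a(1))
    show "a e p = ravg (m + dilation_weight e) (\<lambda>q. D g (fst (q, a e q), z (fst (q, a e q))) (e, snd (q, a e q))) p" for p
      unfolding fst_conv snd_conv by (rule a(2))
  qed (use L in auto)
  then have "ck_on k UNIV (\<lambda>p. \<Sum>e\<in>Basis. (v \<bullet> e) *\<^sub>R a e p)" for v
    by (intro ck_on_sum ck_on_linear_compose[OF bounded_linear_scaleR_right])
  then show ?case unfolding ck_on.simps
    by (intro exI[of _ "\<lambda>p v. \<Sum>e\<in>Basis. (v \<bullet> e) *\<^sub>R a e p"] conjI ballI allI zd)
qed

theorem singular_ode_smooth_solution:
  fixes g :: "(real \<times> 'v::euclidean_space) \<times> 'z::euclidean_space \<Rightarrow> 'z"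
  assumes g: "csmooth g" and lip: "\<And>p z z'. norm (g (p, z) - g (p, z')) \<le> L * norm (z - z')"
    and L: "0 \<le> L" "L < real m + 1"
  obtains z where "csmooth z" "\<And>p. z p = ravg m (\<lambda>q. g (q, z q)) p"
proof -
  obtain z where z: "continuous_on UNIV z" "\<And>p. z p = ravg m (\<lambda>q. g (q, z q)) p"
    using ravg_fixed_point_exists[OF csmooth_continuous[OF g] lip L] by blast
  have "csmooth z" unfolding csmooth_def
  proof
    show "ck_on k UNIV z" for k
      by (rule fixed_point_ck_on[OF _ lip L z]) (use g in \<open>simp add: csmooth_def\<close>)
  qed
  from that[OF this z(2)] show ?thesis .
qed

text \<open>
  Integrate the derivative of \<open>s \<mapsto> s ^ (m + 1) k (s x, v)\<close> over \<open>[0, 1]\<close>.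
\<close>

lemma ravg_derivative_eq:
  fixes k :: "real \<times> 'v::euclidean_space \<Rightarrow> 'z::euclidean_space"
  assumes k: "csmooth k"
  shows "fst p *\<^sub>R D (ravg m k) p (1, 0) = k p - (real m + 1) *\<^sub>R ravg m k p"
proof -
  let ?p = "\<lambda>s. (s * fst p, snd p)"
  have D1: "D (ravg m k) p (1, 0) = integral {0..1} (\<lambda>s. s ^ m *\<^sub>R D k (?p s) (s * 1, 0))"
    using frechet_derivative_at[OF ravg_has_derivative[OF csmooth_deriv[OF k] csmooth_continuous[OF csmooth_D[OF k]], of m p]]
    by (auto dest!: fun_cong[of _ _ "(1, 0)"])
  have i1: "(\<lambda>s. s ^ m *\<^sub>R D k (?p s) (s * fst p, 0)) integrable_on {0..1}"
    using csmooth_continuous[of "\<lambda>s. s ^ m *\<^sub>R D k (?p s) (s * fst p, 0)" "{0..1}"]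
    by (intro integrable_continuous_real) (simp add: csm k)
  have D2: "fst p *\<^sub>R D (ravg m k) p (1, 0) = integral {0..1} (\<lambda>s. s ^ m *\<^sub>R D k (?p s) (s * fst p, 0))"
    unfolding D1 integral_cmul[symmetric]
    using linear_scale[OF csmooth_linear_D[OF k], of _ "fst p" "(_, 0)"]
    by (simp add: scaleR_left_commute[of "fst p"] mult.commute)
  have "((\<lambda>s. (real m + 1) *\<^sub>R (s ^ m *\<^sub>R k (?p s)) + s ^ m *\<^sub>R D k (?p s) (s * fst p, 0)) has_integral
      (1 ^ Suc m *\<^sub>R k (?p 1) - 0 ^ Suc m *\<^sub>R k (?p 0))) {0..1}"
  proof (rule fundamental_theorem_of_calculus)
    fix s :: real
    have "((\<lambda>s. k (?p s)) has_derivative (\<lambda>t. D k (?p s) (t * fst p, 0))) (at s within {0..1})"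
      by (rule has_derivative_compose[OF _ csmooth_deriv[OF k]]) (auto intro!: derivative_eq_intros)
    moreover have "((\<lambda>s. s ^ Suc m) has_derivative (\<lambda>t. t * (real (Suc m) * s ^ m))) (at s within {0..1})"
      by (rule has_derivative_eq_rhs[OF has_derivative_at_withinI[OF DERIV_pow[of "Suc m" s, unfolded has_field_derivative_def]]])
        (auto simp: fun_eq_iff mult_ac)
    ultimately have "((\<lambda>s. s ^ Suc m *\<^sub>R k (?p s)) has_derivative (\<lambda>t. s ^ Suc m *\<^sub>R D k (?p s) (t * fst p, 0)
        + (t * (real (Suc m) * s ^ m)) *\<^sub>R k (?p s))) (at s within {0..1})"
      by (rule has_derivative_scaleR[rotated])
    moreover have "s ^ Suc m *\<^sub>R D k (?p s) (t * fst p, 0) = t *\<^sub>R (s ^ m *\<^sub>R D k (?p s) (s * fst p, 0))" for t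
      using linear_scale[OF csmooth_linear_D[OF k], of _ t "(fst p, 0)"]
        linear_scale[OF csmooth_linear_D[OF k], of _ s "(fst p, 0)"] by (simp add: mult_ac)
    ultimately show "((\<lambda>s. s ^ Suc m *\<^sub>R k (?p s)) has_vector_derivative
        (real m + 1) *\<^sub>R (s ^ m *\<^sub>R k (?p s)) + s ^ m *\<^sub>R D k (?p s) (s * fst p, 0)) (at s within {0..1})"
      by (simp add: has_vector_derivative_def algebra_simps)
  qed auto
  then have "integral {0..1} (\<lambda>s. (real m + 1) *\<^sub>R (s ^ m *\<^sub>R k (?p s)) + s ^ m *\<^sub>R D k (?p s) (s * fst p, 0)) = k p"
    by (simp add: integral_unique)
  moreover have "integral {0..1} (\<lambda>s. (real m + 1) *\<^sub>R (s ^ m *\<^sub>R k (?p s)) + s ^ m *\<^sub>R D k (?p s) (s * fst p, 0))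
     = (real m + 1) *\<^sub>R ravg m k p + fst p *\<^sub>R D (ravg m k) p (1, 0)"
    unfolding D2 ravg_def
    by (subst integral_add[OF integrable_cmul[OF ravg_integrand_continuous[OF csmooth_continuous[OF k]]] i1])
      (simp only: integral_cmul)
  ultimately show ?thesis by (simp add: algebra_simps)
qed

text \<open>
  A pointwise contraction is the case of the singular equation in which nothing depends on \<open>x\<close>:
  at \<open>x = 0\<close> with \<open>m = 0\<close> the radial average is the identity.  Smooth dependence on parameters
  is therefore inherited from \<open>singular_ode_smooth_solution\<close>.
\<close>

lemma smooth_implicit_fixed_point:
  fixes h :: "'v::euclidean_space \<times> 'z::euclidean_space \<Rightarrow> 'z"
  assumes h: "csmooth h" and lip: "\<And>p z z'. norm (h (p, z) - h (p, z')) \<le> L * norm (z - z')"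
    and L: "0 \<le> L" "L < 1"
  obtains z where "csmooth z" "\<And>p. z p = h (p, z p)"
proof -
  have sm: "csmooth (\<lambda>r::(real\<times>'v)\<times>'z. h (snd (fst r), snd r))"
    by (intro csmooth_compose[OF h] csm)
  obtain z where z: "csmooth z" "\<And>p. z p = ravg 0 (\<lambda>q. h (snd q, z q)) p"
  proof (rule singular_ode_smooth_solution[OF sm _ L(1), of 0])
    show "norm (h (snd (fst (p, y)), snd (p, y)) - h (snd (fst (p, y')), snd (p, y'))) \<le> L * norm (y - y')"
      for p :: "real \<times> 'v" and y y' using lip by simp
    show "L < real 0 + 1" using L by simp
    fix z assume z: "csmooth z" "\<And>p. z p = ravg 0 (\<lambda>q. h (snd (fst (q, z q)), snd (q, z q))) p"
    show thesis if "\<And>z. csmooth z \<Longrightarrow> (\<And>p. z p = ravg 0 (\<lambda>q. h (snd q, z q)) p) \<Longrightarrow> thesis"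
      by (rule that[OF z(1)]) (rule z(2)[unfolded fst_conv snd_conv])
  qed
  have fixed: "z (0, v) = h (v, z (0, v))" for v
  proof -
    have "z (0, v) = ravg 0 (\<lambda>q. h (snd q, z q)) (0, v)" by (rule z(2))
    also have "\<dots> = h (v, z (0, v))" by (simp add: ravg_def)
    finally show ?thesis .
  qed
  have "csmooth (\<lambda>v. z (0, v))"
    by (intro csmooth_compose[OF z(1)] csm)
  from that[OF this fixed] show ?thesis .
qed

section \<open>Lipschitz bounds and smooth cutoffs\<close>

lemma ck_on_lipschitz:
  fixes f :: "'a::euclidean_space \<Rightarrow> 'b::real_normed_vector"
  assumes f: "ck_on (Suc 0) S f" and C: "compact C" "convex C" "C \<subseteq> S"
  obtains M where "0 \<le> M" "\<And>x y. x \<in> C \<Longrightarrow> y \<in> C \<Longrightarrow> norm (f x - f y) \<le> M * norm (x - y)"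
proof -
  obtain f' where f': "\<And>z. z \<in> C \<Longrightarrow> (f has_derivative f' z) (at z within C)" "\<And>v. continuous_on C (\<lambda>z. f' z v)"
    using ck_on_subset[OF f C(3)] by auto
  have "\<exists>B. \<forall>z\<in>C. norm (f' z b) \<le> B" for b
    using compact_imp_bounded[OF compact_continuous_image[OF f'(2)[of b] C(1)]] by (auto simp: bounded_iff)
  then obtain B where B: "\<And>b z. z \<in> C \<Longrightarrow> norm (f' z b) \<le> B b" by metis
  define M where "M = (\<Sum>b\<in>Basis. \<bar>B b\<bar>)"
  have on: "onorm (f' z) \<le> M" if z: "z \<in> C" for z
  proof (rule onorm_le)
    fix v
    have "f' z v = (\<Sum>b\<in>Basis. (v \<bullet> b) *\<^sub>R f' z b)"
      using has_derivative_linear[OF f'(1)[OF z]] by (rule linear_basis_expansion)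
    also have "norm \<dots> \<le> (\<Sum>b\<in>Basis. norm v * \<bar>B b\<bar>)"
    proof (rule sum_norm_le)
      fix b :: 'a assume "b \<in> Basis"
      have "norm (f' z b) \<le> \<bar>B b\<bar>" using B[OF z, of b] by linarith
      then show "norm ((v \<bullet> b) *\<^sub>R f' z b) \<le> norm v * \<bar>B b\<bar>"
        unfolding norm_scaleR using Basis_le_norm[OF \<open>b \<in> Basis\<close>, of v] by (intro mult_mono) auto
    qed
    finally show "norm (f' z v) \<le> M * norm v" by (simp add: M_def sum_distrib_left mult.commute)
  qed
  show ?thesis
  proof (rule that)
    show "0 \<le> M" by (simp add: M_def sum_nonneg)
    show "norm (f x - f y) \<le> M * norm (x - y)" if "x \<in> C" "y \<in> C" for x y
      using differentiable_bound[OF C(2) f'(1) on that] .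
  qed
qed

lemma ck_on_inverse:
  fixes f :: "'a::real_normed_vector \<Rightarrow> real"
  shows "ck_on k S f \<Longrightarrow> (\<And>z. z \<in> S \<Longrightarrow> f z \<noteq> 0) \<Longrightarrow> ck_on k S (\<lambda>z. inverse (f z))"
proof (induction k arbitrary: f)
  case 0
  then show ?case by (auto intro: continuous_intros)
next
  case (Suc k)
  then obtain f' where f': "\<And>z. z\<in>S \<Longrightarrow> (f has_derivative f' z) (at z within S)" "\<And>v. ck_on k S (\<lambda>z. f' z v)"
    by (metis ck_on.simps(2))
  have i: "ck_on k S (\<lambda>z. inverse (f z))" using Suc.IH ck_on_SucD[OF Suc.prems(1)] Suc.prems(2) by blast
  have "ck_on k S (\<lambda>z. (- 1) * (inverse (f z) * f' z v * inverse (f z)))" for v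
    by (intro ck_on_bilinear[OF bounded_bilinear_mult] i f' ck_on_const)
  then have "ck_on k S (\<lambda>z. - (inverse (f z) * f' z v * inverse (f z)))" for v by simp
  then show ?case unfolding ck_on.simps
    by (intro exI[of _ "\<lambda>z v. - (inverse (f z) * f' z v * inverse (f z))"] conjI ballI allI
        Deriv.has_derivative_inverse Suc.prems f')
qed

text \<open>
  For \<open>x > 0\<close> these are the functions \<open>p (1 / x) exp (- 1 / x)\<close>.  Polynomial factors are included
  because they make the family closed under differentiation.
\<close>

definition flat :: "real poly \<Rightarrow> real \<Rightarrow> real"
  where "flat p x = (if x > 0 then poly p (1 / x) * exp (- (1 / x)) else 0)"

lemma poly_times_exp_minus_tendsto_0: "((\<lambda>u::real. poly p u * exp (- u)) \<longlongrightarrow> 0) at_top"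
proof -
  have "((\<lambda>u. \<Sum>i\<le>degree p. coeff p i * (u ^ i / exp u)) \<longlongrightarrow> (\<Sum>i\<le>degree p. coeff p i * 0)) at_top"
    by (intro tendsto_intros tendsto_power_div_exp_0)
  moreover have "(\<lambda>u. \<Sum>i\<le>degree p. coeff p i * (u ^ i / exp u)) = (\<lambda>u. poly p u * exp (- u))"
    by (simp add: poly_altdef sum_distrib_right exp_minus divide_inverse mult.assoc)
  ultimately show ?thesis by simp
qed

lemma flat_has_derivative:
  "(flat p has_real_derivative flat ([:0, 0, 1:] * (p - pderiv p)) x) (at x)"
proof -
  consider "x > 0" | "x < 0" | "x = 0" by linarith
  then show ?thesis
  proof cases
    case 1
    have "((\<lambda>x. poly p (1 / x) * exp (- (1 / x))) has_real_derivative
        flat ([:0, 0, 1:] * (p - pderiv p)) x) (at x)"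
      using 1 by (auto intro!: derivative_eq_intros DERIV_chain'[OF _ poly_DERIV] simp: flat_def field_simps power2_eq_square)
    moreover have "\<forall>\<^sub>F y in nhds x. flat p y = poly p (1 / y) * exp (- (1 / y))"
      using eventually_nhds_in_open[of "{0<..}" x] 1 by (auto elim!: eventually_mono simp: flat_def)
    ultimately show ?thesis by (subst DERIV_cong_ev[OF refl _ refl])
  next
    case 2
    have "\<forall>\<^sub>F y in nhds x. flat p y = 0"
      using eventually_nhds_in_open[of "{..<0}" x] 2 by (auto elim!: eventually_mono simp: flat_def)
    then show ?thesis using 2 by (subst DERIV_cong_ev[OF refl _ refl]) (auto simp: flat_def)
  next
    case 3
    have "((\<lambda>y. flat p y / y) \<longlongrightarrow> 0) (at 0)"
    proof (rule filterlim_split_at)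
      show "((\<lambda>y. flat p y / y) \<longlongrightarrow> 0) (at_left 0)"
        by (rule tendsto_eventually) (auto simp: eventually_at_filter flat_def)
      have "((\<lambda>u. flat p (inverse u) / inverse u) \<longlongrightarrow> 0) at_top"
        using poly_times_exp_minus_tendsto_0[of "[:0, 1:] * p"]
        by (rule Lim_transform_eventually)
          (rule eventually_mono[OF eventually_gt_at_top[of 0]], simp add: flat_def field_simps)
      then show "((\<lambda>y. flat p y / y) \<longlongrightarrow> 0) (at_right 0)"
        by (simp add: filterlim_at_right_to_top)
    qed
    then show ?thesis using 3 by (simp add: has_field_derivative_iff flat_def)
  qed
qed

lemma csmooth_flat: "csmooth (flat p)"
proof (rule csmooth_coinduct[where P = "\<lambda>f. \<exists>p. f = flat p"])
  fix f assume "\<exists>p. f = flat p"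
  then obtain p where f: "f = flat p" ..
  let ?q = "[:0, 0, 1:] * (p - pderiv p)"
  have "(\<lambda>z. flat ?q z * v) = flat (smult v ?q)" for v by (auto simp: flat_def)
  then show "\<exists>f'. (\<forall>z. (f has_derivative f' z) (at z)) \<and> (\<forall>v. \<exists>p. (\<lambda>z. f' z v) = flat p)"
    using flat_has_derivative[of p] unfolding f has_field_derivative_def
    by (intro exI[of _ "\<lambda>z v. flat ?q z * v"]) blast
qed auto

definition smooth_step :: "real \<Rightarrow> real"
  where "smooth_step t = flat 1 t * inverse (flat 1 t + flat 1 (1 - t))"

lemma flat_1: "t > 0 \<Longrightarrow> flat 1 t > 0" "t \<le> 0 \<Longrightarrow> flat 1 t = 0"
  by (auto simp: flat_def)

lemma flat_1_sum_pos: "flat 1 t + flat 1 (1 - t) > 0"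
  using flat_1[of t] flat_1[of "1 - t"] by (cases "t > 0"; cases "1 - t > 0") auto

lemma csmooth_smooth_step: "csmooth smooth_step"
proof -
  have s: "csmooth (\<lambda>t. flat 1 t + flat 1 (1 - t))"
    by (intro csm csmooth_compose[OF csmooth_flat])
  have "csmooth (\<lambda>t. inverse (flat 1 t + flat 1 (1 - t)))"
    unfolding csmooth_def
  proof
    fix k show "ck_on k UNIV (\<lambda>t. inverse (flat 1 t + flat 1 (1 - t)))"
      using s flat_1_sum_pos by (intro ck_on_inverse) (auto simp: csmooth_def less_imp_neq[THEN not_sym])
  qed
  then show ?thesis unfolding smooth_step_def[abs_def] by (intro csm csmooth_flat)
qed

lemma smooth_step_bounds: "0 \<le> smooth_step t" "smooth_step t \<le> 1"
  using flat_1_sum_pos[of t] flat_1[of t] flat_1[of "1 - t"]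
  by (cases "t > 0"; cases "1 - t > 0"; simp add: smooth_step_def divide_simps flip: divide_inverse)+

lemma smooth_step_eq: "t \<ge> 1 \<Longrightarrow> smooth_step t = 1" "t \<le> 0 \<Longrightarrow> smooth_step t = 0"
  using flat_1[of t] flat_1[of "1 - t"] by (auto simp: smooth_step_def)

text \<open>
  The identity near the origin, truncated to a bounded smooth map.  Substituting it for an argument of a
  function leaves the function unchanged on a large ball, but bounds all data that a contraction needs.
\<close>

definition cutoff :: "real \<Rightarrow> 'a::real_inner \<Rightarrow> 'a"
  where "cutoff r v = smooth_step (2 - (v \<bullet> v) / r\<^sup>2) *\<^sub>R v"

lemma csmooth_cutoff: "csmooth f \<Longrightarrow> csmooth (\<lambda>z. cutoff r (f z))"
  unfolding cutoff_def divide_inverse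
  by (intro csm csmooth_compose[OF csmooth_smooth_step])

lemma cutoff_id: "r > 0 \<Longrightarrow> norm v \<le> r \<Longrightarrow> cutoff r v = v"
proof -
  assume r: "r > 0" "norm v \<le> r"
  then have "(norm v)\<^sup>2 \<le> r\<^sup>2" by (intro power_mono) auto
  then have "smooth_step (2 - (v \<bullet> v) / r\<^sup>2) = 1" using r
    by (intro smooth_step_eq) (simp add: power2_norm_eq_inner)
  then show ?thesis by (simp add: cutoff_def)
qed

lemma cutoff_0: "r > 0 \<Longrightarrow> norm v \<ge> 2 * r \<Longrightarrow> cutoff r v = 0"
proof -
  assume r: "r > 0" "norm v \<ge> 2 * r"
  then have "(2 * r)\<^sup>2 \<le> (norm v)\<^sup>2" by (intro power_mono) auto
  then have "4 * r\<^sup>2 \<le> v \<bullet> v" by (simp add: power2_norm_eq_inner power_mult_distrib)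
  then have "2 * r\<^sup>2 \<le> v \<bullet> v" using zero_le_power2[of r] by linarith
  then have "smooth_step (2 - (v \<bullet> v) / r\<^sup>2) = 0" using r
    by (intro smooth_step_eq) (simp add: field_simps)
  then show ?thesis by (simp add: cutoff_def)
qed

lemma norm_cutoff: "r > 0 \<Longrightarrow> norm (cutoff r v) \<le> 2 * r"
proof (cases "norm v \<ge> 2 * r")
  case False
  have "norm (cutoff r v) \<le> 1 * norm v"
    unfolding cutoff_def norm_scaleR using smooth_step_bounds[of "2 - (v \<bullet> v) / r\<^sup>2"]
    by (intro mult_right_mono) auto
  then show ?thesis using False by simp
qed (simp add: cutoff_0)

text \<open>
  The difference vanishes at \<open>x = 0\<close>, hence it is \<open>x\<close> times a smooth function \<open>K\<close>, and \<open>K\<close> is Lipschitz on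
  compact sets.  Values of \<open>z\<close> outside the ball of radius \<open>2 r\<close> are moved to that ball by the
  nearest-point map, which is 1-Lipschitz and changes nothing since the cutoff vanishes out there.
\<close>

lemma small_lipschitz_after_cut:
  fixes G :: "(real \<times> 'p::euclidean_space) \<times> 'z::euclidean_space \<Rightarrow> 'w::euclidean_space"
  assumes G: "csmooth G" and r: "r > 0" and \<delta>: "\<delta> > 0"
  obtains \<epsilon> where "\<epsilon> > 0" "\<And>x p z z'. \<bar>x\<bar> \<le> \<epsilon> \<Longrightarrow> norm p \<le> R \<Longrightarrow>
    norm ((G ((x, p), cutoff r z) - G ((0, p), cutoff r z)) - (G ((x, p), cutoff r z') - G ((0, p), cutoff r z')))
      \<le> \<delta> * norm (z - z')"
proof -
  define H where "H q = G ((fst q, fst (snd q)), cutoff r (snd (snd q))) - G ((0, fst (snd q)), cutoff r (snd (snd q)))"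
    for q :: "real \<times> 'p \<times> 'z"
  have Hs: "csmooth H" unfolding H_def by (intro csm csmooth_compose[OF G] csmooth_cutoff)
  have H0: "H (0, q) = 0" for q by (simp add: H_def)
  obtain K where K: "csmooth K" "\<And>x q. H (x, q) = x *\<^sub>R K (x, q)"
    by (rule hadamard_quotient[OF Hs H0]) blast
  obtain M where M: "0 \<le> M" "\<And>u v. u \<in> cball 0 1 \<times> cball 0 R \<times> cball 0 (2 * r) \<Longrightarrow>
      v \<in> cball 0 1 \<times> cball 0 R \<times> cball 0 (2 * r) \<Longrightarrow> norm (K u - K v) \<le> M * norm (u - v)"
    by (rule ck_on_lipschitz[of UNIV K "cball 0 1 \<times> cball 0 R \<times> cball 0 (2 * r)"])
      (use K(1) in \<open>auto simp: csmooth_def compact_Times convex_Times simp del: ck_on.simps\<close>)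
  define \<pi> where "\<pi> = closest_point (cball (0::'z) (2 * r))"
  have \<pi>: "\<pi> z \<in> cball 0 (2 * r)" for z
    unfolding \<pi>_def using r by (intro closest_point_in_set) auto
  have \<pi>lip: "norm (\<pi> z - \<pi> z') \<le> norm (z - z')" for z z'
    using closest_point_lipschitz[of "cball (0::'z) (2 * r)" z z'] r by (simp add: \<pi>_def dist_norm)
  have H\<pi>: "H (x, p, \<pi> z) = H (x, p, z)" for x p z
  proof (cases "norm z \<le> 2 * r")
    case True
    then show ?thesis by (simp add: \<pi>_def closest_point_self)
  next
    case False
    have "\<pi> z \<notin> interior (cball 0 (2 * r))"
    proof -
      have "interior (cball (0::'z) (2 * r)) \<noteq> {}" using r by (simp add: interior_cball)
      then have "rel_interior (cball (0::'z) (2 * r)) = interior (cball 0 (2 * r))" "affine hull (cball (0::'z) (2 * r)) = UNIV"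
        by (auto simp: rel_interior_nonempty_interior affine_hull_nonempty_interior)
      then show ?thesis
        using closest_point_in_rel_interior[of "cball (0::'z) (2 * r)" z] False r
        by (auto simp: \<pi>_def interior_cball)
    qed
    then have "cutoff r (\<pi> z) = 0" using \<pi>[of z] r by (intro cutoff_0) (auto simp: interior_cball)
    then show ?thesis using cutoff_0[OF r, of z] False by (simp add: H_def)
  qed
  define \<epsilon> where "\<epsilon> = min 1 (\<delta> / (M + 1))"
  show ?thesis
  proof (rule that)
    show "\<epsilon> > 0" using \<delta> M(1) by (simp add: \<epsilon>_def)
    fix x :: real and p :: 'p and z z' :: 'z assume x: "\<bar>x\<bar> \<le> \<epsilon>" and p: "norm p \<le> R"
    have "norm (H (x, p, z) - H (x, p, z')) = norm (x *\<^sub>R (K (x, p, \<pi> z) - K (x, p, \<pi> z')))"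
      by (subst (1 2) H\<pi>[symmetric]) (simp add: K(2) scaleR_diff_right)
    also have "\<dots> = \<bar>x\<bar> * norm (K (x, p, \<pi> z) - K (x, p, \<pi> z'))" by simp
    also have "\<dots> \<le> \<epsilon> * (M * norm ((x, p, \<pi> z) - (x, p, \<pi> z')))"
      using x p \<pi> by (intro mult_mono M(2)) (auto simp: \<epsilon>_def)
    also have "\<dots> = (\<epsilon> * M) * norm (\<pi> z - \<pi> z')" by (simp add: norm_Pair)
    also have "\<dots> \<le> \<delta> * norm (z - z')"
    proof (intro mult_mono \<pi>lip)
      have "\<epsilon> * M \<le> (\<delta> / (M + 1)) * M" using M(1) by (intro mult_right_mono) (auto simp: \<epsilon>_def)
      also have "\<dots> \<le> \<delta>" using M(1) \<delta> by (simp add: field_simps)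
      finally show "\<epsilon> * M \<le> \<delta>" .
    qed (use \<delta> in auto)
    finally show "norm ((G ((x, p), cutoff r z) - G ((0, p), cutoff r z)) - (G ((x, p), cutoff r z') - G ((0, p), cutoff r z')))
      \<le> \<delta> * norm (z - z')" by (simp add: H_def)
  qed
qed

section \<open>A maximum principle for singular transport equations\<close>

text \<open>
  A maximum principle for \<open>x \<partial>\<^sub>x d = a d + b \<cdot> \<partial>\<^sub>y d\<close>.  The growth bound \<open>|d| \<le> C x\<close> rules out the solutions
  \<open>x powr a\<close> of the homogeneous equation, since \<open>a \<le> \<alpha> < 1\<close>.  Because \<open>|b| \<le> M x\<close>, a paraboloid
  \<open>\<phi> \<ge> 0\<close> that shrinks fast enough as \<open>x\<close> grows is a domain of dependence.  At a positive interior maximum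
  of \<open>d \<phi> x powr - \<beta>\<close> with \<open>\<alpha> < \<beta> < 1\<close> the gradient vanishes, and pairing it with
  the vector field \<open>(x, - b)\<close> contradicts the equation.
\<close>

lemma transport_nonpositive:
  fixes d :: "real \<times> 'v::euclidean_space \<Rightarrow> real"
  assumes r: "r > 0" and M: "M \<ge> 0" and \<alpha>: "\<alpha> < 1"
    and der: "\<And>x y. 0 < x \<Longrightarrow> x < r \<Longrightarrow> norm (y - y0) < r \<Longrightarrow> (d has_derivative d' (x, y)) (at (x, y))"
    and eq: "\<And>x y. 0 < x \<Longrightarrow> x < r \<Longrightarrow> norm (y - y0) < r \<Longrightarrow>
       \<exists>a b. a \<le> \<alpha> \<and> norm b \<le> M * x \<and> x * d' (x, y) (1, 0) = a * d (x, y) + d' (x, y) (0, b)"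
    and bd: "\<And>x y. 0 \<le> x \<Longrightarrow> x < r \<Longrightarrow> norm (y - y0) < r \<Longrightarrow> \<bar>d (x, y)\<bar> \<le> C * x"
  obtains \<epsilon> where "\<epsilon> > 0" "\<And>x y. 0 \<le> x \<Longrightarrow> x < \<epsilon> \<Longrightarrow> norm (y - y0) < \<epsilon> \<Longrightarrow> d (x, y) \<le> 0"
proof -
  define \<rho> where "\<rho> = r / 2"
  \<comment> \<open>The part \<open>2 M \<rho>\<close> outweighs the change of \<open>|y - y0|\<^sup>2\<close> along the vector field, and the part \<open>\<rho>\<close>
    confines \<open>x\<close> to \<open>[0, \<rho>]\<close>.\<close>
  define \<kappa> where "\<kappa> = 2 * M * \<rho> + \<rho>"
  define \<beta> where "\<beta> = (1 + max \<alpha> 0) / 2"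
  have \<beta>: "\<alpha> < \<beta>" "0 < \<beta>" "\<beta> < 1" using \<alpha> by (auto simp: \<beta>_def max_def)
  have \<rho>: "0 < \<rho>" "\<rho> < r" and \<kappa>: "\<kappa> \<ge> \<rho>" "\<kappa> > 0" using r M by (auto simp: \<rho>_def \<kappa>_def intro!: add_nonneg_pos)
  define \<phi> where "\<phi> z = \<rho>\<^sup>2 - (norm (snd z - y0))\<^sup>2 - \<kappa> * fst z" for z :: "real \<times> 'v"
  define K where "K = {z. 0 \<le> fst z \<and> 0 \<le> \<phi> z}"
  have Kb: "fst z \<le> \<rho>" "norm (snd z - y0) \<le> \<rho>" if "z \<in> K" for z
  proof -
    have z: "0 \<le> fst z" "(norm (snd z - y0))\<^sup>2 + \<kappa> * fst z \<le> \<rho>\<^sup>2" using that by (auto simp: K_def \<phi>_def)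
    have "0 \<le> \<kappa> * fst z" using z \<kappa> by simp
    then have "(norm (snd z - y0))\<^sup>2 \<le> \<rho>\<^sup>2" using z(2) by linarith
    then show "norm (snd z - y0) \<le> \<rho>" by (rule power2_le_imp_le) (use \<rho> in simp)
    have "\<rho> * fst z \<le> \<kappa> * fst z" using \<kappa> z by (intro mult_right_mono) auto
    then have "\<rho> * fst z \<le> \<rho> * \<rho>" using z(2) zero_le_power2[of "norm (snd z - y0)"] unfolding power2_eq_square[of \<rho>] by linarith
    then show "fst z \<le> \<rho>" using \<rho> by simp
  qed
  have \<phi>c: "continuous_on S \<phi>" for S unfolding \<phi>_def by (intro continuous_intros)
  have "closed K" unfolding K_def
    by (intro closed_Collect_conj closed_Collect_le continuous_intros \<phi>c)
  moreover have "K \<subseteq> cball 0 \<rho> \<times> cball y0 \<rho>"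
    using Kb by (auto simp: K_def dist_norm norm_minus_commute) (metis fst_conv, metis snd_conv)?
  ultimately have Kc: "compact K"
    by (metis bounded_Times bounded_cball bounded_subset compact_eq_bounded_closed)
  define H where "H z = (if fst z \<le> 0 then 0 else d z * \<phi> z * fst z powr - \<beta>)" for z
  have Hpos: "H z = d z * \<phi> z * fst z powr - \<beta>" if "fst z > 0" for z using that by (simp add: H_def)
  have Hd: "(H has_derivative (\<lambda>v. d z * \<phi> z * (fst v * (- \<beta>) * fst z powr (- \<beta> - 1))
       + (d z * (- 2 * ((snd z - y0) \<bullet> snd v) - \<kappa> * fst v) + d' z v * \<phi> z) * fst z powr - \<beta>)) (at z)"
    if z: "0 < fst z" "fst z < r" "norm (snd z - y0) < r" for z
  proof -
    have 1: "(d has_derivative d' z) (at z)" using der[of "fst z" "snd z"] z by simp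
    have 2: "(\<phi> has_derivative (\<lambda>v. - 2 * ((snd z - y0) \<bullet> snd v) - \<kappa> * fst v)) (at z)"
      unfolding \<phi>_def power2_norm_eq_inner
      by (auto intro!: derivative_eq_intros simp: inner_commute algebra_simps)
    have "((\<lambda>t. t powr - \<beta>) has_derivative (\<lambda>t. t * (- \<beta> * fst z powr (- \<beta> - 1)))) (at (fst z))"
      by (rule has_derivative_eq_rhs[OF has_real_derivative_powr[OF z(1), of "- \<beta>", unfolded has_field_derivative_def]])
        (auto simp: fun_eq_iff)
    from has_derivative_compose[OF has_derivative_fst[OF has_derivative_ident] this]
    have 3: "((\<lambda>z. fst z powr - \<beta>) has_derivative (\<lambda>v. fst v * (- \<beta> * fst z powr (- \<beta> - 1)))) (at z)" .
    have "((\<lambda>z. d z * \<phi> z * fst z powr - \<beta>) has_derivative (\<lambda>v. d z * \<phi> z * (fst v * (- \<beta>) * fst z powr (- \<beta> - 1))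
       + (d z * (- 2 * ((snd z - y0) \<bullet> snd v) - \<kappa> * fst v) + d' z v * \<phi> z) * fst z powr - \<beta>)) (at z)"
      using has_derivative_mult[OF has_derivative_mult[OF 1 2] 3] by (simp add: mult.assoc)
    moreover have "open {z::real\<times>'v. 0 < fst z}" by (intro open_Collect_less continuous_intros)
    ultimately show ?thesis
      by (rule has_derivative_transform_within_open) (use z Hpos in auto)
  qed
  have "continuous_on K H"
    unfolding continuous_on_def
  proof
    fix z assume z: "z \<in> K"
    show "(H \<longlongrightarrow> H z) (at z within K)"
    proof (cases "fst z > 0")
      case True
      then have "(H has_derivative (\<lambda>v. d z * \<phi> z * (fst v * (- \<beta>) * fst z powr (- \<beta> - 1))
       + (d z * (- 2 * ((snd z - y0) \<bullet> snd v) - \<kappa> * fst v) + d' z v * \<phi> z) * fst z powr - \<beta>)) (at z)"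
        using Kb[OF z] \<rho> by (intro Hd) auto
      then have "continuous (at z) H" by (rule has_derivative_continuous)
      then show ?thesis by (simp add: continuous_at Lim_at_imp_Lim_at_within)
    next
      case False
      then have z0: "fst z = 0" using z by (simp add: K_def)
      have "((\<lambda>w. \<bar>C\<bar> * \<rho>\<^sup>2 * (fst w powr (1 - \<beta>))) \<longlongrightarrow> \<bar>C\<bar> * \<rho>\<^sup>2 * (0 powr (1 - \<beta>))) (at z within K)"
      proof (intro tendsto_mult tendsto_const tendsto_powr')
        have "(fst \<longlongrightarrow> fst z) (at z within K)" by (intro tendsto_intros)
        then show "(fst \<longlongrightarrow> 0) (at z within K)" using z0 by simp
        show "(0::real) \<noteq> 0 \<or> 0 < 1 - \<beta> \<and> (\<forall>\<^sub>F x in at z within K. 0 \<le> fst x)"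
          using \<beta> by (auto simp: eventually_at_filter K_def)
      qed
      then have lim: "((\<lambda>w. \<bar>C\<bar> * \<rho>\<^sup>2 * (fst w powr (1 - \<beta>))) \<longlongrightarrow> 0) (at z within K)" by simp
      have "norm (H w) \<le> \<bar>C\<bar> * \<rho>\<^sup>2 * (fst w powr (1 - \<beta>))" if w: "w \<in> K" for w
      proof (cases "fst w > 0")
        case True
        have "0 \<le> \<kappa> * fst w" using True \<kappa> by simp
        then have \<phi>w: "0 \<le> \<phi> w" "\<phi> w \<le> \<rho>\<^sup>2"
          using w zero_le_power2[of "norm (snd w - y0)"] unfolding K_def \<phi>_def by (simp, linarith)
        have "\<bar>d w\<bar> \<le> C * fst w" using bd[of "fst w" "snd w"] Kb[OF w] True \<rho> by auto
        also have "\<dots> \<le> \<bar>C\<bar> * fst w" using True by (intro mult_right_mono) auto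
        finally have "\<bar>d w\<bar> * \<phi> w * fst w powr - \<beta> \<le> (\<bar>C\<bar> * fst w) * \<rho>\<^sup>2 * fst w powr - \<beta>"
          using \<phi>w True by (intro mult_right_mono mult_mono) auto
        also have "\<dots> = \<bar>C\<bar> * \<rho>\<^sup>2 * (fst w powr 1 * fst w powr - \<beta>)" using True by (simp add: mult_ac)
        also have "fst w powr 1 * fst w powr - \<beta> = fst w powr (1 - \<beta>)" by (simp only: powr_add[symmetric]) simp
        finally show ?thesis using True \<phi>w by (simp add: Hpos abs_mult)
      qed (simp add: H_def)
      then have "\<forall>\<^sub>F w in at z within K. norm (H w) \<le> \<bar>C\<bar> * \<rho>\<^sup>2 * (fst w powr (1 - \<beta>))"
        by (auto simp: eventually_at_filter)
      from Lim_null_comparison[OF this lim] have "(H \<longlongrightarrow> 0) (at z within K)" .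
      moreover have "H z = 0" using z0 by (simp add: H_def)
      ultimately show ?thesis by simp
    qed
  qed
  moreover have K0: "(0, y0) \<in> K" by (simp add: K_def \<phi>_def)
  ultimately obtain z where z: "z \<in> K" "\<And>w. w \<in> K \<Longrightarrow> H w \<le> H z"
    using continuous_attains_sup[OF Kc] by blast
  have "H z \<le> 0"
  proof (rule ccontr)
    assume "\<not> H z \<le> 0"
    then have pos: "H z > 0" by simp
    then have x: "fst z > 0" by (auto simp: H_def split: if_splits)
    let ?P = "fst z powr - \<beta>"
    have P: "?P > 0" using x by simp
    have "0 \<le> \<phi> z" using z(1) by (simp add: K_def)
    moreover have "d z * \<phi> z * ?P > 0" using pos Hpos[OF x] by simp
    ultimately have \<phi>: "\<phi> z > 0" and dz: "d z > 0" using P by (auto simp: zero_less_mult_iff)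
    have zr: "fst z < r" "norm (snd z - y0) < r" using Kb[OF z(1)] \<rho> by auto
    define T where "T = {z. 0 < fst z \<and> 0 < \<phi> z}"
    have "open T" unfolding T_def by (intro open_Collect_conj open_Collect_less continuous_intros \<phi>c)
    moreover have "z \<in> T" "T \<subseteq> K" using x \<phi> by (auto simp: T_def K_def)
    ultimately have zero: "(\<lambda>v. d z * \<phi> z * (fst v * (- \<beta>) * fst z powr (- \<beta> - 1))
       + (d z * (- 2 * ((snd z - y0) \<bullet> snd v) - \<kappa> * fst v) + d' z v * \<phi> z) * ?P) = (\<lambda>v. 0)"
      using z(2) by (intro differential_zero_maxmin[OF _ _ Hd[OF x zr]]) auto
    obtain a b where ab: "a \<le> \<alpha>" "norm b \<le> M * fst z" "fst z * d' z (1, 0) = a * d z + d' z (0, b)"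
      using eq[OF x zr] by auto
    have lin: "linear (d' z)" using has_derivative_linear[OF der[OF x zr]] by simp
    have "d' z (fst z, - b) = d' z (fst z *\<^sub>R (1, 0) - (0, b))" by simp
    also have "\<dots> = fst z * d' z (1, 0) - d' z (0, b)" by (simp only: linear_diff[OF lin] linear_scale[OF lin] real_scaleR_def)
    finally have d1: "d' z (fst z, - b) = a * d z" using ab by simp
    have "fst z * fst z powr (- \<beta> - 1) = fst z powr 1 * fst z powr (- \<beta> - 1)" using x by simp
    also have "\<dots> = ?P" by (simp only: powr_add[symmetric]) simp
    finally have p1: "fst z * fst z powr (- \<beta> - 1) = ?P" .
    have "d z * \<phi> z * (- \<beta>) * (fst z * fst z powr (- \<beta> - 1))
       + (d z * (2 * ((snd z - y0) \<bullet> b) - \<kappa> * fst z) + a * d z * \<phi> z) * ?P = 0"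
      using fun_cong[OF zero, of "(fst z, - b)"] by (simp add: d1 mult_ac)
    then have "(d z * ?P) * ((a - \<beta>) * \<phi> z + (2 * ((snd z - y0) \<bullet> b) - \<kappa> * fst z)) = 0"
      unfolding p1 by (simp add: algebra_simps)
    then have "(a - \<beta>) * \<phi> z + (2 * ((snd z - y0) \<bullet> b) - \<kappa> * fst z) = 0" using dz P by simp
    moreover have "(a - \<beta>) * \<phi> z < 0" using ab(1) \<beta> \<phi> by (simp add: mult_neg_pos)
    moreover have "(snd z - y0) \<bullet> b \<le> \<rho> * (M * fst z)"
      using Cauchy_Schwarz_ineq2[of "snd z - y0" b] mult_mono[OF Kb(2)[OF z(1)] ab(2)] \<rho> by auto
    moreover have "2 * (\<rho> * (M * fst z)) \<le> \<kappa> * fst z"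
      using x \<rho> by (simp add: \<kappa>_def algebra_simps)
    ultimately show False by linarith
  qed
  then have dK: "d w \<le> 0" if "0 < fst w" "0 < \<phi> w" for w
  proof -
    have "H w \<le> 0" using z(2)[of w] \<open>H z \<le> 0\<close> that by (auto simp: K_def)
    then have "d w * (\<phi> w * fst w powr - \<beta>) \<le> 0" using Hpos[OF that(1)] by (simp add: mult_ac)
    moreover have "0 < \<phi> w * fst w powr - \<beta>" using that by simp
    ultimately show ?thesis by (meson mult_pos_pos not_le)
  qed
  define \<epsilon> where "\<epsilon> = min 1 (\<rho>\<^sup>2 / (2 * (1 + \<kappa>)))"
  show ?thesis
  proof (rule that)
    show \<epsilon>: "\<epsilon> > 0" using \<rho> \<kappa> by (simp add: \<epsilon>_def)
    fix x y assume xy: "0 \<le> x" "x < \<epsilon>" "norm (y - y0) < \<epsilon>"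
    have "(norm (y - y0))\<^sup>2 + \<kappa> * x \<le> \<epsilon> * \<epsilon> + \<kappa> * \<epsilon>"
      unfolding power2_eq_square using xy \<kappa> by (intro add_mono mult_mono) auto
    also have "\<dots> \<le> 1 * \<epsilon> + \<kappa> * \<epsilon>" using \<epsilon> by (intro add_right_mono mult_right_mono) (auto simp: \<epsilon>_def)
    also have "\<dots> = (1 + \<kappa>) * \<epsilon>" by (simp add: algebra_simps)
    also have "\<dots> \<le> (1 + \<kappa>) * (\<rho>\<^sup>2 / (2 * (1 + \<kappa>)))" using \<kappa> by (intro mult_left_mono) (auto simp: \<epsilon>_def)
    also have "\<dots> = \<rho>\<^sup>2 / 2" using \<kappa> by (simp add: field_simps)
    also have "\<dots> < \<rho>\<^sup>2" using \<rho> by simp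
    finally have \<phi>: "\<phi> (x, y) > 0" by (simp add: \<phi>_def)
    show "d (x, y) \<le> 0"
    proof (cases "x > 0")
      case True
      then show ?thesis using dK[of "(x, y)"] \<phi> by simp
    next
      case False
      then have "(x, y) \<in> K" "x = 0" using \<phi> xy by (auto simp: K_def)
      then show ?thesis using bd[of x y] Kb[of "(x, y)"] \<rho> r by auto
    qed
  qed
qed

lemma transport_unique:
  fixes d :: "real \<times> 'v::euclidean_space \<Rightarrow> real"
  assumes r: "r > 0" and M: "M \<ge> 0" and \<alpha>: "\<alpha> < 1"
    and der: "\<And>x y. 0 < x \<Longrightarrow> x < r \<Longrightarrow> norm (y - y0) < r \<Longrightarrow> (d has_derivative d' (x, y)) (at (x, y))"
    and eq: "\<And>x y. 0 < x \<Longrightarrow> x < r \<Longrightarrow> norm (y - y0) < r \<Longrightarrow>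
       \<exists>a b. a \<le> \<alpha> \<and> norm b \<le> M * x \<and> x * d' (x, y) (1, 0) = a * d (x, y) + d' (x, y) (0, b)"
    and bd: "\<And>x y. 0 \<le> x \<Longrightarrow> x < r \<Longrightarrow> norm (y - y0) < r \<Longrightarrow> \<bar>d (x, y)\<bar> \<le> C * x"
  obtains \<epsilon> where "\<epsilon> > 0" "\<And>x y. 0 \<le> x \<Longrightarrow> x < \<epsilon> \<Longrightarrow> norm (y - y0) < \<epsilon> \<Longrightarrow> d (x, y) = 0"
proof -
  obtain e1 where e1: "e1 > 0" "\<And>x y. 0 \<le> x \<Longrightarrow> x < e1 \<Longrightarrow> norm (y - y0) < e1 \<Longrightarrow> d (x, y) \<le> 0"
    using transport_nonpositive[OF r M \<alpha> der eq bd] by blast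
  have der': "((\<lambda>z. - d z) has_derivative (\<lambda>v. - d' (x, y) v)) (at (x, y))"
    if "0 < x" "x < r" "norm (y - y0) < r" for x y
    by (intro has_derivative_minus der that)
  have eq': "\<exists>a b. a \<le> \<alpha> \<and> norm b \<le> M * x \<and> x * - d' (x, y) (1, 0) = a * - d (x, y) + - d' (x, y) (0, b)"
    if h: "0 < x" "x < r" "norm (y - y0) < r" for x y
  proof -
    obtain a b where "a \<le> \<alpha>" "norm b \<le> M * x" "x * d' (x, y) (1, 0) = a * d (x, y) + d' (x, y) (0, b)"
      using eq[OF h] by blast
    then show ?thesis by (intro exI[of _ a] exI[of _ b]) simp
  qed
  have bd': "\<bar>- d (x, y)\<bar> \<le> C * x" if "0 \<le> x" "x < r" "norm (y - y0) < r" for x y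
    using bd[OF that] by simp
  obtain e2 where e2: "e2 > 0" "\<And>x y. 0 \<le> x \<Longrightarrow> x < e2 \<Longrightarrow> norm (y - y0) < e2 \<Longrightarrow> - d (x, y) \<le> 0"
    using transport_nonpositive[where d = "\<lambda>z. - d z" and d' = "\<lambda>z v. - d' z v", OF r M \<alpha> der' eq' bd'] by blast
  show ?thesis
    by (rule that[of "min e1 e2"]) (use e1 e2 in \<open>auto intro!: antisym\<close>)
qed

section \<open>Singular systems starting at a family of equilibria\<close>

lemma compact_norm_bound:
  fixes f :: "'a::topological_space \<Rightarrow> 'b::real_normed_vector"
  assumes "compact K" "continuous_on K f"
  obtains C where "0 \<le> C" "\<And>x. x \<in> K \<Longrightarrow> norm (f x) \<le> C"
proof -
  obtain C where C: "\<And>y. y \<in> f ` K \<Longrightarrow> norm y \<le> C"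
    using compact_imp_bounded[OF compact_continuous_image[OF assms(2,1)]] unfolding bounded_iff by blast
  show ?thesis by (rule that[of "\<bar>C\<bar>"]) (use C in fastforce)+
qed

lemma ravg_at_0: "ravg m k (0, v) = (1 / (real m + 1)) *\<^sub>R k (0, v)"
  for k :: "real \<times> 'v::euclidean_space \<Rightarrow> 'z::euclidean_space"
proof -
  have "((\<lambda>s::real. s ^ m *\<^sub>R k (0, v)) has_integral (1 / (real m + 1)) *\<^sub>R k (0, v)) {0..1}"
    by (rule has_integral_scaleR_left[OF power_has_integral_01])
  then show ?thesis by (simp add: ravg_def integral_unique)
qed

text \<open>
  The system \<open>x \<partial>\<^sub>x X = f (x, X)\<close> degenerates at the curve of equilibria \<open>e\<close>.  With \<open>X = e + x z\<close> the function
  \<open>f (x, e + x z)\<close> vanishes at \<open>x = 0\<close>, so it equals \<open>x G\<close> with \<open>G\<close> smooth, and \<open>x \<partial>\<^sub>x z = - z + G\<close>.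
  At \<open>x = 0\<close> the map \<open>G\<close> is affine in \<open>z\<close> with linear part the linearisation of \<open>f\<close>, so the
  hypothesis \<open>spec\<close>, which says quantitatively that all eigenvalues lie below 1, makes
  \<open>m z + G\<close> Lipschitz with a constant below \<open>m + 1\<close>.  The remainder \<open>G (x, .) - G (0, .)\<close> is made
  small by cutoffs, which are invisible on \<open>N\<close>.
\<close>

theorem singular_system_solution:
  fixes f :: "real \<times> 's::euclidean_space \<Rightarrow> 's" and e :: "'v::euclidean_space \<Rightarrow> 's"
  assumes f: "csmooth f" and e: "csmooth e" and f0: "\<And>\<eta>. f (0, e \<eta>) = 0"
    and R: "R > 0" and c: "c > 0" "c \<le> 1"
    and spec: "\<And>\<eta> a. norm \<eta> \<le> 2 * R \<Longrightarrow>
       norm (real m *\<^sub>R a + D f (0, e \<eta>) (0, a)) \<le> (real m + 1 - c) * norm a"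
  obtains X N where "csmooth X" "open N" "{0} \<times> ball 0 R \<subseteq> N" "\<And>\<eta>. X (0, \<eta>) = e \<eta>"
    "\<And>p. p \<in> N \<Longrightarrow> fst p *\<^sub>R D X p (1, 0) = f (fst p, X p)"
proof -
  define h where "h q = f (fst q, e (fst (snd q)) + fst q *\<^sub>R snd (snd q))" for q :: "real \<times> 'v \<times> 's"
  have hs: "csmooth h" unfolding h_def by (intro csmooth_compose[OF f] csmooth_compose[OF e] csm)
  have h0: "h (0, q) = 0" for q by (simp add: h_def f0)
  obtain K where K: "csmooth K" "\<And>x q. h (x, q) = x *\<^sub>R K (x, q)" "\<And>q. K (0, q) = D h (0, q) (1, 0)"
    by (rule hadamard_quotient[OF hs h0]) blast
  have flin: "linear (D f q)" for q by (rule csmooth_linear_D[OF f])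
  have K0: "K (0, \<eta>, z) = D f (0, e \<eta>) (1, 0) + D f (0, e \<eta>) (0, z)" for \<eta> z
  proof -
    have "((\<lambda>q. e (fst (snd q))) has_derivative (\<lambda>v. D e \<eta> (fst (snd v)))) (at (0::real, \<eta>, z))"
      using csmooth_deriv[OF e] by (intro has_derivative_compose[where g = e and f = "\<lambda>q. fst (snd q)"])
        (auto intro!: derivative_eq_intros)
    then have "((\<lambda>q. (fst q, e (fst (snd q)) + fst q *\<^sub>R snd (snd q))) has_derivative
       (\<lambda>v. (fst v, D e \<eta> (fst (snd v)) + fst v *\<^sub>R z))) (at (0, \<eta>, z))"
      by (auto intro!: derivative_eq_intros)
    from has_derivative_compose[OF this csmooth_deriv[OF f]]
    have "(h has_derivative (\<lambda>v. D f (0, e \<eta>) (fst v, D e \<eta> (fst (snd v)) + fst v *\<^sub>R z))) (at (0, \<eta>, z))"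
      by (simp add: h_def[abs_def])
    from frechet_derivative_at[OF this]
    have "D h (0, \<eta>, z) (1, 0) = D f (0, e \<eta>) (1, z)"
      by (auto dest!: fun_cong[of _ _ "(1, 0)"] simp: linear_0[OF csmooth_linear_D[OF e]])
    then show ?thesis using linear_add[OF flin, of "(0, e \<eta>)" "(1, 0)" "(0, z)"] by (simp add: K(3))
  qed
  define G where "G q = K (fst (fst q), snd (fst q), snd q)" for q :: "(real \<times> 'v) \<times> 's"
  have Gs: "csmooth G" unfolding G_def by (intro csmooth_compose[OF K(1)] csm)
  have "continuous_on (cball 0 (2 * R)) (\<lambda>\<eta>. D f (0, e \<eta>) (1, 0))"
    by (intro csmooth_continuous csm f e csmooth_compose[OF e])
  then obtain C0 where C0_nonneg: "0 \<le> C0" and C0': "\<And>\<eta>. \<eta> \<in> cball 0 (2 * R) \<Longrightarrow> norm (D f (0, e \<eta>) (1, 0)) \<le> C0"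
    using compact_norm_bound[OF compact_cball] by blast
  have C0: "norm (D f (0, e \<eta>) (1, 0)) \<le> C0" if "norm \<eta> \<le> 2 * R" for \<eta> using C0' that by simp
  \<comment> \<open>\<open>C0 / c\<close> bounds \<open>z\<close> on the slice \<open>x = 0\<close>, so a cutoff of \<open>z\<close> at radius \<open>\<rho>\<close> is inactive near it.\<close>
  define \<rho> where "\<rho> = C0 / c + 1"
  have \<rho>: "\<rho> > 0" using C0_nonneg c by (simp add: \<rho>_def add_nonneg_pos)
  obtain \<epsilon> where \<epsilon>: "\<epsilon> > 0" "\<And>x p z z'. \<bar>x\<bar> \<le> \<epsilon> \<Longrightarrow> norm p \<le> 2 * R \<Longrightarrow>
    norm ((G ((x, p), cutoff \<rho> z) - G ((0, p), cutoff \<rho> z)) - (G ((x, p), cutoff \<rho> z') - G ((0, p), cutoff \<rho> z')))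
      \<le> c / 2 * norm (z - z')"
    by (rule small_lipschitz_after_cut[OF Gs \<rho>, of "c / 2" "2 * R"]) (use c in auto)
  \<comment> \<open>A cutoff of radius \<open>r\<close> has values of norm up to \<open>2 r\<close>.\<close>
  define x' where "x' p = cutoff (\<epsilon> / 2) (fst p)" for p :: "real \<times> 'v"
  define \<eta>' where "\<eta>' p = cutoff R (snd p)" for p :: "real \<times> 'v"
  have x': "\<bar>x' p\<bar> \<le> \<epsilon>" for p using norm_cutoff[of "\<epsilon>/2" "fst p"] \<epsilon> by (simp add: x'_def)
  have \<eta>': "norm (\<eta>' p) \<le> 2 * R" for p using norm_cutoff[OF R, of "snd p"] by (simp add: \<eta>'_def)
  define g where "g q = real m *\<^sub>R snd q + G ((0, \<eta>' (fst q)), snd q) +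
      (G ((x' (fst q), \<eta>' (fst q)), cutoff \<rho> (snd q)) - G ((0, \<eta>' (fst q)), cutoff \<rho> (snd q)))" for q :: "(real \<times> 'v) \<times> 's"
  have gs: "csmooth g"
    unfolding g_def x'_def \<eta>'_def by (intro csm csmooth_compose[OF Gs] csmooth_cutoff)
  define L where "L = real m + 1 - c / 2"
  have L: "0 \<le> L" "L < real m + 1" using c by (auto simp: L_def)
  have lip: "norm (g (p, z) - g (p, z')) \<le> L * norm (z - z')" for p z z'
  proof -
    let ?H = "\<lambda>z. G ((x' p, \<eta>' p), cutoff \<rho> z) - G ((0, \<eta>' p), cutoff \<rho> z)"
    have "g (p, z) - g (p, z') = (real m *\<^sub>R (z - z') + D f (0, e (\<eta>' p)) (0, z - z')) + (?H z - ?H z')"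
      using linear_diff[OF flin, of "(0, e (\<eta>' p))" "(0, z)" "(0, z')"]
      by (simp add: g_def G_def[of "((0, _), _)"] K0 algebra_simps)
    also have "norm \<dots> \<le> (real m + 1 - c) * norm (z - z') + c / 2 * norm (z - z')"
      by (intro order_trans[OF norm_triangle_ineq] add_mono spec \<epsilon>(2) x' \<eta>')
    also have "\<dots> = L * norm (z - z')" by (simp add: L_def algebra_simps)
    finally show ?thesis .
  qed
  obtain z where z: "csmooth z" "\<And>p. z p = ravg m (\<lambda>q. g (q, z q)) p"
    using singular_ode_smooth_solution[OF gs lip L] by blast
  define N where "N = {p. \<bar>fst p\<bar> < \<epsilon> / 2 \<and> norm (snd p) < R \<and> norm (z p) < \<rho>}"
  define X where "X p = e (snd p) + fst p *\<^sub>R z p" for p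
  show ?thesis
  proof (rule that)
    show "csmooth X" unfolding X_def by (intro csm csmooth_compose[OF e] z)
    show "open N" unfolding N_def
      by (intro open_Collect_conj open_Collect_less continuous_intros csmooth_continuous z)
    show "{0} \<times> ball 0 R \<subseteq> N"
    proof clarify
      fix \<eta> :: 'v assume "\<eta> \<in> ball 0 R"
      then have \<eta>: "norm \<eta> < R" by simp
      let ?z = "z (0, \<eta>)"
      have e1: "\<eta>' (0, \<eta>) = \<eta>" "x' (0, \<eta>) = 0" using \<eta> R \<epsilon> by (auto simp: \<eta>'_def x'_def cutoff_id)
      have "?z = (1 / (real m + 1)) *\<^sub>R g ((0, \<eta>), ?z)" by (subst z(2)) (rule ravg_at_0)
      then have "(real m + 1) *\<^sub>R ?z = (real m + 1) *\<^sub>R ((1 / (real m + 1)) *\<^sub>R g ((0, \<eta>), ?z))" by (rule arg_cong)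
      also have "\<dots> = g ((0, \<eta>), ?z)" by simp
      also have "\<dots> = (real m *\<^sub>R ?z + D f (0, e \<eta>) (0, ?z)) + D f (0, e \<eta>) (1, 0)"
        by (simp add: g_def e1 G_def[of "((0, _), _)"] K0)
      finally have eq: "(real m + 1) *\<^sub>R ?z = (real m *\<^sub>R ?z + D f (0, e \<eta>) (0, ?z)) + D f (0, e \<eta>) (1, 0)" .
      have "norm ((real m + 1) *\<^sub>R ?z) \<le> (real m + 1 - c) * norm ?z + C0"
        unfolding eq using \<eta> R by (intro order_trans[OF norm_triangle_ineq] add_mono spec C0) auto
      moreover have "norm ((real m + 1) *\<^sub>R ?z) = (real m + 1) * norm ?z" by simp
      moreover have "(real m + 1 - c) * norm ?z = (real m + 1) * norm ?z - c * norm ?z" by (simp only: left_diff_distrib)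
      ultimately have "c * norm ?z \<le> C0" by linarith
      then have "norm ?z \<le> C0 / c" using c by (simp add: field_simps)
      then show "(0, \<eta>) \<in> N" using \<eta> \<epsilon> by (simp add: N_def \<rho>_def)
    qed
    show "X (0, \<eta>) = e \<eta>" for \<eta> by (simp add: X_def)
    fix p assume p: "p \<in> N"
    have gz: "csmooth (\<lambda>q. g (q, z q))" by (intro csmooth_compose[OF gs] csm z)
    have "z = ravg m (\<lambda>q. g (q, z q))" by (rule ext) (rule z(2))
    then have "D z p (1, 0) = D (ravg m (\<lambda>q. g (q, z q))) p (1, 0)" by (rule arg_cong)
    then have "fst p *\<^sub>R D z p (1, 0) = g (p, z p) - (real m + 1) *\<^sub>R z p"
      using ravg_derivative_eq[OF gz, of p] z(2)[of p, symmetric] by (simp only:)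
    moreover have "g (p, z p) = real m *\<^sub>R z p + G (p, z p)"
      using p R \<rho> \<epsilon>(1) by (simp add: N_def g_def x'_def \<eta>'_def cutoff_id less_imp_le)
    ultimately have dz: "fst p *\<^sub>R D z p (1, 0) = G (p, z p) - z p" by (simp add: algebra_simps)
    have "((\<lambda>p. e (snd p)) has_derivative (\<lambda>v. D e (snd p) (snd v))) (at p)"
      by (rule has_derivative_compose[OF _ csmooth_deriv[OF e]]) (auto intro!: derivative_eq_intros)
    then have "(X has_derivative (\<lambda>v. D e (snd p) (snd v) + (fst p *\<^sub>R D z p v + fst v *\<^sub>R z p))) (at p)"
      unfolding X_def using csmooth_deriv[OF z(1), of p] by (auto intro!: derivative_eq_intros)
    from frechet_derivative_at[OF this]
    have "D X p (1, 0) = fst p *\<^sub>R D z p (1, 0) + z p"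
      by (auto dest!: fun_cong[of _ _ "(1, 0)"] simp: linear_0[OF csmooth_linear_D[OF e]])
    then have "D X p (1, 0) = G (p, z p)" using dz by simp
    then have "fst p *\<^sub>R D X p (1, 0) = h (fst p, snd p, z p)" by (simp add: K(2) G_def)
    then show "fst p *\<^sub>R D X p (1, 0) = f (fst p, X p)" by (simp add: h_def X_def)
  qed
qed

section \<open>The characteristic system\<close>

text \<open>
  The vector that represents a linear functional.
\<close>

definition gradv :: "('v::euclidean_space \<Rightarrow> real) \<Rightarrow> 'v"
  where "gradv l = (\<Sum>b\<in>Basis. l b *\<^sub>R b)"

lemma gradv_inner: "linear l \<Longrightarrow> gradv l \<bullet> v = l v"
  using linear_basis_expansion[of l v] by (simp add: gradv_def inner_commute[of _ v] inner_sum_right mult.commute)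

lemma gradv_eq: "(\<And>v. l v = g \<bullet> v) \<Longrightarrow> gradv l = g"
  by (simp add: gradv_def euclidean_representation)

lemma csmooth_gradv[csm]:
  "(\<And>v. csmooth (\<lambda>z. l z v)) \<Longrightarrow> csmooth (\<lambda>z. gradv (l z))"
  unfolding gradv_def by (intro csm)

text \<open>
  The partial derivatives \<open>F\<^sub>\<omega>\<close>, \<open>F\<^sub>y\<close> and \<open>F\<^sub>q\<close>, the last two as gradients.
\<close>

definition dw :: "(real \<times> 'v::euclidean_space \<times> real \<times> 'v \<Rightarrow> real) \<Rightarrow> real \<times> 'v \<times> real \<times> 'v \<Rightarrow> real"
  where "dw F p = D F p (0, 0, 1, 0)"
definition dy :: "(real \<times> 'v::euclidean_space \<times> real \<times> 'v \<Rightarrow> real) \<Rightarrow> real \<times> 'v \<times> real \<times> 'v \<Rightarrow> 'v"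
  where "dy F p = gradv (\<lambda>v. D F p (0, v, 0, 0))"
definition dq :: "(real \<times> 'v::euclidean_space \<times> real \<times> 'v \<Rightarrow> real) \<Rightarrow> real \<times> 'v \<times> real \<times> 'v \<Rightarrow> 'v"
  where "dq F p = gradv (\<lambda>v. D F p (0, 0, 0, v))"

lemma linear_slots:
  assumes "linear (l :: real \<times> 'v::real_vector \<times> real \<times> 'v \<Rightarrow> 'w::real_vector)"
  shows "linear (\<lambda>v. l (0, v, 0, 0))" "linear (\<lambda>v. l (0, 0, 0, v))"
    "l (\<xi>, a, b, c) = \<xi> *\<^sub>R l (1, 0, 0, 0) + l (0, a, 0, 0) + b *\<^sub>R l (0, 0, 1, 0) + l (0, 0, 0, c)"
proof -
  show "linear (\<lambda>v. l (0, v, 0, 0))" "linear (\<lambda>v. l (0, 0, 0, v))"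
    using assms by (auto simp: linear_iff simp flip: linear_add[OF assms] linear_scale[OF assms])
  have "l (\<xi>, a, b, c) = l (\<xi> *\<^sub>R (1, 0, 0, 0) + (0, a, 0, 0) + b *\<^sub>R (0, 0, 1, 0) + (0, 0, 0, c))" by simp
  then show "l (\<xi>, a, b, c) = \<xi> *\<^sub>R l (1, 0, 0, 0) + l (0, a, 0, 0) + b *\<^sub>R l (0, 0, 1, 0) + l (0, 0, 0, c)"
    by (simp only: linear_add[OF assms] linear_scale[OF assms])
qed

lemma csmooth_partials:
  assumes F: "csmooth F"
  shows "csmooth (dw F)" "csmooth (dy F)" "csmooth (dq F)"
  unfolding dw_def[abs_def] dy_def[abs_def] dq_def[abs_def] by (intro csm F)+

lemma D_eq_partials:
  assumes F: "csmooth F"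
  shows "D F p (0, a, b, c) = dy F p \<bullet> a + dw F p * b + dq F p \<bullet> c"
proof -
  note lin = csmooth_linear_D[OF F, of p]
  have "dy F p \<bullet> a = D F p (0, a, 0, 0)" "dq F p \<bullet> c = D F p (0, 0, 0, c)"
    unfolding dy_def dq_def by (rule gradv_inner[OF linear_slots(1)[OF lin]], rule gradv_inner[OF linear_slots(2)[OF lin]])
  then show ?thesis unfolding linear_slots(3)[OF lin, of 0 a b c] by (simp add: dw_def)
qed

lemma D_zero_along_zeros:
  assumes g: "csmooth g" and 0: "\<And>y. g (0, y, 0, 0) = 0"
  shows "D g (0, y, 0, 0) (0, v, 0, 0) = 0"
proof -
  have "((\<lambda>y. g (0, y, 0, 0)) has_derivative (\<lambda>v. D g (0, y, 0, 0) (0, v, 0, 0))) (at y)"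
    by (rule has_derivative_compose[OF _ csmooth_deriv[OF g]]) (auto intro!: derivative_eq_intros simp: zero_prod_def)
  then have "((\<lambda>y. 0) has_derivative (\<lambda>v. D g (0, y, 0, 0) (0, v, 0, 0))) (at y)" using 0 by simp
  then have "(\<lambda>v. D g (0, y, 0, 0) (0, v, 0, 0)) = (\<lambda>v. 0)"
    using has_derivative_const has_derivative_unique by blast
  then show ?thesis by metis
qed

lemma norm_diagonal_le:
  fixes a :: "'a::real_normed_vector" and c :: "'b::real_normed_vector" and b :: real
  assumes "\<bar>\<alpha>\<bar> \<le> k" "\<bar>\<beta>\<bar> \<le> k" "\<bar>\<gamma>\<bar> \<le> k"
  shows "norm (\<alpha> *\<^sub>R a, \<beta> * b, \<gamma> *\<^sub>R c) \<le> k * norm (a, b, c)"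
proof -
  have k: "0 \<le> k" using assms(1) by linarith
  have sq: "(\<bar>t\<bar> * norm x)\<^sup>2 \<le> k\<^sup>2 * (norm x)\<^sup>2" if "\<bar>t\<bar> \<le> k" for t and x :: "'c::real_normed_vector"
    using that unfolding power_mult_distrib by (intro mult_right_mono power_mono) auto
  have "(norm (\<alpha> *\<^sub>R a, \<beta> * b, \<gamma> *\<^sub>R c))\<^sup>2 \<le> (k * norm (a, b, c))\<^sup>2"
    using sq[OF assms(1), of a] sq[OF assms(2), of b] sq[OF assms(3), of c]
    by (simp add: norm_Pair power_mult_distrib abs_mult distrib_left)
  then show ?thesis using k by (simp add: power2_le_iff_abs_le)
qed

text \<open>
  The characteristic equations \<open>x Y' = - F\<^sub>q\<close>, \<open>x W' = F - Q \<cdot> F\<^sub>q\<close>, \<open>x Q' = F\<^sub>y + F\<^sub>\<omega> Q\<close> start at the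
  equilibria \<open>(\<eta>, 0, 0)\<close>.  Since \<open>F\<close> and \<open>F\<^sub>q\<close> vanish on \<open>{(0, y, 0, 0)}\<close>, so do \<open>F\<^sub>y\<close>, \<open>F\<^sub>y\<^sub>q\<close> and \<open>F\<^sub>y\<^sub>y\<close>, and the
  linearisation is triangular with respect to \<open>W\<close>, \<open>Q\<close>, \<open>Y\<close>, with diagonal \<open>F\<^sub>\<omega>\<close>, \<open>F\<^sub>\<omega>\<close>, \<open>0\<close>.  Scaling \<open>Y\<close> by
  \<open>\<Lambda>\<^sup>2\<close> and \<open>Q\<close> by \<open>\<Lambda>\<close> divides the off-diagonal entries by \<open>\<Lambda>\<close> at least, so for large \<open>\<Lambda>\<close> only the
  diagonal, which is below 1, matters.
\<close>

lemma characteristic_system_solution: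
  fixes F :: "real \<times> 'v::euclidean_space \<times> real \<times> 'v \<Rightarrow> real"
  assumes F: "csmooth F" and F0: "\<And>y. F (0, y, 0, 0) = 0" and Fq0: "\<And>y. dq F (0, y, 0, 0) = 0"
    and Fw: "\<And>y. dw F (0, y, 0, 0) < 1" and R: "R > 0"
  obtains Y :: "real \<times> 'v \<Rightarrow> 'v" and W Q N where "csmooth Y" "csmooth W" "csmooth Q" "open N" "{0} \<times> ball 0 R \<subseteq> N"
    "\<And>\<eta>. Y (0, \<eta>) = \<eta>" "\<And>\<eta>. W (0, \<eta>) = 0" "\<And>\<eta>. Q (0, \<eta>) = 0"
    "\<And>p. p \<in> N \<Longrightarrow> fst p *\<^sub>R D Y p (1, 0) = - dq F (fst p, Y p, W p, Q p)"
    "\<And>p. p \<in> N \<Longrightarrow> fst p * D W p (1, 0) = F (fst p, Y p, W p, Q p) - Q p \<bullet> dq F (fst p, Y p, W p, Q p)"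
    "\<And>p. p \<in> N \<Longrightarrow> fst p *\<^sub>R D Q p (1, 0) = dy F (fst p, Y p, W p, Q p) + dw F (fst p, Y p, W p, Q p) *\<^sub>R Q p"
proof -
  note part = csmooth_partials[OF F]
  have Fy0: "dy F (0, y, 0, 0) = 0" for y
    by (simp add: dy_def gradv_def D_zero_along_zeros[OF F F0])
  have DF0: "D F (0, y, 0, 0) (0, a, b, c) = dw F (0, y, 0, 0) * b" for y a b c
    by (simp add: D_eq_partials[OF F] Fy0 Fq0)
  have Dq0: "D (dq F) (0, y, 0, 0) (0, a, b, c) = b *\<^sub>R D (dq F) (0, y, 0, 0) (0, 0, 1, 0) + D (dq F) (0, y, 0, 0) (0, 0, 0, c)" for y a b c
    using linear_slots(3)[OF csmooth_linear_D[OF part(3)], of "(0, y, 0, 0)" 0 a b c] D_zero_along_zeros[OF part(3) Fq0] by simp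
  \<comment> \<open>Mixed derivatives commute, and \<open>F\<^sub>q\<close> vanishes along the slice.\<close>
  have Dyq: "D (dy F) (0, y, 0, 0) (0, 0, 0, c) = 0" for y c
  proof (rule euclidean_eqI)
    fix b :: 'v assume b: "b \<in> Basis"
    have lin: "linear (\<lambda>v. D F p (0, v, 0, 0))" "linear (\<lambda>v. D F p (0, 0, 0, v))" for p
      by (rule linear_slots(1)[OF csmooth_linear_D[OF F]], rule linear_slots(2)[OF csmooth_linear_D[OF F]])
    have "D (dy F) (0, y, 0, 0) (0, 0, 0, c) \<bullet> b = D (\<lambda>p. dy F p \<bullet> b) (0, y, 0, 0) (0, 0, 0, c)"
      by (rule D_linear_compose[OF bounded_linear_inner_left part(2), symmetric])
    also have "(\<lambda>p. dy F p \<bullet> b) = (\<lambda>p. D F p (0, b, 0, 0))"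
      unfolding dy_def by (rule ext) (rule gradv_inner[OF lin(1)])
    also have "D (\<lambda>p. D F p (0, b, 0, 0)) (0, y, 0, 0) (0, 0, 0, c) = D (\<lambda>p. D F p (0, 0, 0, c)) (0, y, 0, 0) (0, b, 0, 0)"
      by (rule symmetric_second_derivative[OF F])
    also have "\<dots> = 0"
    proof (rule D_zero_along_zeros[OF csmooth_D[OF F]])
      fix y
      have "D F (0, y, 0, 0) (0, 0, 0, c) = dq F (0, y, 0, 0) \<bullet> c" unfolding dq_def by (rule gradv_inner[OF lin(2), symmetric])
      then show "D F (0, y, 0, 0) (0, 0, 0, c) = 0" using Fq0 by simp
    qed
    finally show "D (dy F) (0, y, 0, 0) (0, 0, 0, c) \<bullet> b = 0 \<bullet> b" by simp
  qed
  have Dy0: "D (dy F) (0, y, 0, 0) (0, a, b, c) = b *\<^sub>R D (dy F) (0, y, 0, 0) (0, 0, 1, 0)" for y a b c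
    using linear_slots(3)[OF csmooth_linear_D[OF part(2)], of "(0, y, 0, 0)" 0 a b c] D_zero_along_zeros[OF part(2) Fy0] Dyq by simp
  let ?B = "cball (0::'v) (2 * R)"
  have cB: "compact ?B" by simp
  have sl: "csmooth (\<lambda>y::'v. (0::real, y, 0::real, 0::'v))" by (intro csm)
  have "continuous_on ?B (\<lambda>y. dw F (0, y, 0, 0))" by (intro csmooth_continuous csmooth_compose[OF part(1) sl])
  then obtain B0 where B0: "0 \<le> B0" "\<And>y. y \<in> ?B \<Longrightarrow> norm (dw F (0, y, 0, 0)) \<le> B0"
    using compact_norm_bound[OF cB] by blast
  have "continuous_on ?B (\<lambda>y. dw F (0, y, 0, 0))" by (intro csmooth_continuous csmooth_compose[OF part(1) sl])
  moreover have "?B \<noteq> {}" using R by simp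
  ultimately obtain y1 where y1: "\<And>y. y \<in> ?B \<Longrightarrow> dw F (0, y, 0, 0) \<le> dw F (0, y1, 0, 0)"
    using continuous_attains_sup[OF cB, of "\<lambda>y. dw F (0, y, 0, 0)"] by blast
  \<comment> \<open>Half the distance from 1 to the diagonal of the linearisation, whose entry \<open>0\<close> accounts for the
    minimum with 1.\<close>
  define c where "c = min (1 - dw F (0, y1, 0, 0)) 1 / 2"
  have c: "c > 0" "c \<le> 1" "2 * c \<le> 1" using Fw[of y1] by (auto simp: c_def)
  have cw: "dw F (0, y, 0, 0) \<le> 1 - 2 * c" if "y \<in> ?B" for y using y1[OF that] by (simp add: c_def min_def)
  have "continuous_on ?B (\<lambda>y. D (dq F) (0, y, 0, 0) (0, 0, 1, 0))" by (intro csmooth_continuous csm part)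
  then obtain B1 where B1: "0 \<le> B1" "\<And>y. y \<in> ?B \<Longrightarrow> norm (D (dq F) (0, y, 0, 0) (0, 0, 1, 0)) \<le> B1"
    using compact_norm_bound[OF cB] by blast
  have "continuous_on ?B (\<lambda>y. D (dy F) (0, y, 0, 0) (0, 0, 1, 0))" by (intro csmooth_continuous csm part)
  then obtain B2 where B2: "0 \<le> B2" "\<And>y. y \<in> ?B \<Longrightarrow> norm (D (dy F) (0, y, 0, 0) (0, 0, 1, 0)) \<le> B2"
    using compact_norm_bound[OF cB] by blast
  have "continuous_on ?B (\<lambda>y. \<Sum>b\<in>Basis. norm (D (dq F) (0, y, 0, 0) (0, 0, 0, b)))"
    by (intro continuous_intros csmooth_continuous csm part)
  then obtain B3 where B3: "0 \<le> B3" "\<And>y. y \<in> ?B \<Longrightarrow> norm (\<Sum>b\<in>Basis. norm (D (dq F) (0, y, 0, 0) (0, 0, 0, b::'v))) \<le> B3"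
    using compact_norm_bound[OF cB] by blast
  have B3': "norm (D (dq F) (0, y, 0, 0) (0, 0, 0, v)) \<le> B3 * norm v" if "y \<in> ?B" for y v
  proof -
    have "D (dq F) (0, y, 0, 0) (0, 0, 0, v) = (\<Sum>b\<in>Basis. (v \<bullet> b) *\<^sub>R D (dq F) (0, y, 0, 0) (0, 0, 0, b))"
      by (rule linear_basis_expansion[OF linear_slots(2)[OF csmooth_linear_D[OF part(3)]]])
    also have "norm \<dots> \<le> (\<Sum>b\<in>Basis. norm v * norm (D (dq F) (0, y, 0, 0) (0, 0, 0, b)))"
      by (rule sum_norm_le) (auto intro!: mult_right_mono Basis_le_norm)
    also have "\<dots> = norm v * (\<Sum>b\<in>Basis. norm (D (dq F) (0, y, 0, 0) (0, 0, 0, b)))" by (simp add: sum_distrib_left)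
    also have "\<dots> \<le> norm v * B3" using B3(2)[OF that] by (intro mult_left_mono) auto
    finally show ?thesis by (simp add: mult.commute)
  qed
  define C where "C = B1 + B2 + B3"
  have C: "0 \<le> C" using B1 B2 B3 by (simp add: C_def)
  \<comment> \<open>The scaled off-diagonal terms have norm at most \<open>C / \<Lambda>\<close>.\<close>
  define \<Lambda> where "\<Lambda> = max 1 (C / c)"
  have \<Lambda>: "\<Lambda> \<ge> 1" "C / \<Lambda> \<le> c"
    using c C by (auto simp: \<Lambda>_def max_def field_simps)
  \<comment> \<open>Then \<open>m + F\<^sub>\<omega>\<close> is nonnegative, so that \<open>m + 1 - 2 c\<close> bounds its absolute value.\<close>
  obtain m :: nat where m: "B0 \<le> real m" using real_arch_simple by blast
  define pt where "pt p = (fst p, \<Lambda>\<^sup>2 *\<^sub>R fst (snd p), fst (snd (snd p)), \<Lambda> *\<^sub>R snd (snd (snd p)))" for p :: "real \<times> 'v \<times> real \<times> 'v"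
  have ptl: "bounded_linear pt" unfolding pt_def
    by (intro bounded_linear_intros)
  have pts: "csmooth pt" by (rule csmooth_linear[OF ptl])
  define f1 where "f1 p = (- (1 / \<Lambda>\<^sup>2)) *\<^sub>R dq F (pt p)" for p
  define f2 where "f2 p = F (pt p) - snd (snd (snd (pt p))) \<bullet> dq F (pt p)" for p
  define f3 where "f3 p = (1 / \<Lambda>) *\<^sub>R (dy F (pt p) + dw F (pt p) *\<^sub>R snd (snd (snd (pt p))))" for p
  have qs: "csmooth (\<lambda>p. snd (snd (snd (pt p))))" by (intro csm pts)
  have comps: "csmooth (\<lambda>p. dq F (pt p))" "csmooth (\<lambda>p. F (pt p))" "csmooth (\<lambda>p. dy F (pt p))" "csmooth (\<lambda>p. dw F (pt p))"
    using part F pts by (auto intro: csmooth_compose)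
  have fs: "csmooth f1" "csmooth f2" "csmooth f3"
    unfolding f1_def f2_def f3_def by (intro csm comps qs)+
  define f where "f p = (f1 p, f2 p, f3 p)" for p
  have fsm: "csmooth f" unfolding f_def by (intro csm fs)
  define e where "e \<eta> = ((1 / \<Lambda>\<^sup>2) *\<^sub>R \<eta>, 0::real, 0::'v)" for \<eta> :: 'v
  have es: "csmooth e" unfolding e_def by (intro csm)
  have pte: "pt (0, e \<eta>) = (0, \<eta>, 0, 0)" for \<eta> using \<Lambda> by (simp add: pt_def e_def)
  have f0: "f (0, e \<eta>) = 0" for \<eta>
    by (simp add: f_def f1_def f2_def f3_def pte F0 Fq0 Fy0 zero_prod_def)
  have dcomp: "D (\<lambda>p. k (pt p)) (0, e \<eta>) (0, Z, U, P) = D k (0, \<eta>, 0, 0) (0, \<Lambda>\<^sup>2 *\<^sub>R Z, U, \<Lambda> *\<^sub>R P)"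
    if "csmooth k" for k :: "real \<times> 'v \<times> real \<times> 'v \<Rightarrow> 'w::real_normed_vector" and \<eta> Z U P
    using D_compose[OF that pts, of "(0, e \<eta>)" "(0, Z, U, P)"] unfolding pte D_linear[OF ptl] by (simp add: pt_def)
  have dqs: "D (\<lambda>p. snd (snd (snd (pt p)))) (0, e \<eta>) (0, Z, U, P) = \<Lambda> *\<^sub>R P" for \<eta> Z U P
  proof -
    have "bounded_linear (\<lambda>p. snd (snd (snd (pt p))))"
      by (intro bounded_linear_compose[OF bounded_linear_snd] ptl)
    from D_linear[OF this] show ?thesis by (simp add: pt_def)
  qed
  have Df1: "D f1 (0, e \<eta>) (0, Z, U, P) = (- (1 / \<Lambda>\<^sup>2)) *\<^sub>R (U *\<^sub>R D (dq F) (0, \<eta>, 0, 0) (0, 0, 1, 0) + D (dq F) (0, \<eta>, 0, 0) (0, 0, 0, \<Lambda> *\<^sub>R P))" for \<eta> Z U P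
    unfolding f1_def by (subst D_linear_compose[OF bounded_linear_scaleR_right comps(1)]) (simp only: dcomp[OF part(3)] Dq0[of \<eta> "\<Lambda>\<^sup>2 *\<^sub>R Z" U "\<Lambda> *\<^sub>R P"])
  have Df2: "D f2 (0, e \<eta>) (0, Z, U, P) = dw F (0, \<eta>, 0, 0) * U" for \<eta> Z U P
    unfolding f2_def
    by (subst D_diff[OF comps(2) csmooth_inner[OF qs comps(1)]], subst D_bilinear[OF bounded_bilinear_inner qs comps(1)])
      (simp add: dcomp[OF F] DF0 dqs pte Fq0)
  have Df3: "D f3 (0, e \<eta>) (0, Z, U, P) = (1 / \<Lambda>) *\<^sub>R (U *\<^sub>R D (dy F) (0, \<eta>, 0, 0) (0, 0, 1, 0)) + dw F (0, \<eta>, 0, 0) *\<^sub>R P" for \<eta> Z U P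
    unfolding f3_def
    by (subst D_linear_compose[OF bounded_linear_scaleR_right csmooth_add[OF comps(3) csmooth_scaleR[OF comps(4) qs]]],
        subst D_add[OF comps(3) csmooth_scaleR[OF comps(4) qs]], subst D_bilinear[OF bounded_bilinear_scaleR comps(4) qs])
      (use \<Lambda> in \<open>simp add: dcomp[OF part(2)] Dy0[of \<eta> "\<Lambda>\<^sup>2 *\<^sub>R Z" U "\<Lambda> *\<^sub>R P"] dqs pte scaleR_add_right\<close>)
  have spec: "norm (real m *\<^sub>R s + D f (0, e \<eta>) (0, s)) \<le> (real m + 1 - c) * norm s" if \<eta>: "norm \<eta> \<le> 2 * R" for \<eta> s
  proof -
    obtain Z U P where s: "s = (Z, U, P)" by (metis prod_cases3)
    have \<eta>B: "\<eta> \<in> ?B" using \<eta> by simp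
    let ?l = "dw F (0, \<eta>, 0, 0)"
    have ns: "norm Z \<le> norm s" "\<bar>U\<bar> \<le> norm s" "norm P \<le> norm s"
    proof -
      have "norm (U, P) \<le> norm s" unfolding s by (rule norm_snd_le)
      moreover have "norm U \<le> norm (U, P)" "norm P \<le> norm (U, P)" by (rule norm_fst_le, rule norm_snd_le)
      moreover show "norm Z \<le> norm s" unfolding s by (rule norm_fst_le)
      ultimately show "\<bar>U\<bar> \<le> norm s" "norm P \<le> norm s" by auto
    qed
    have "D f (0, e \<eta>) (0, s) = (D f1 (0, e \<eta>) (0, s), D f2 (0, e \<eta>) (0, s), D f3 (0, e \<eta>) (0, s))"
      unfolding f_def by (simp add: D_Pair fs csmooth_Pair)
    then have eq: "real m *\<^sub>R s + D f (0, e \<eta>) (0, s) =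
       (real m *\<^sub>R Z, (real m + ?l) * U, (real m + ?l) *\<^sub>R P) + (D f1 (0, e \<eta>) (0, s), 0, (1 / \<Lambda>) *\<^sub>R (U *\<^sub>R D (dy F) (0, \<eta>, 0, 0) (0, 0, 1, 0)))"
      unfolding s by (simp add: Df2 Df3 algebra_simps)
    have "norm (real m *\<^sub>R Z, (real m + ?l) * U, (real m + ?l) *\<^sub>R P) \<le> (real m + 1 - 2 * c) * norm s"
      unfolding s using B0(2)[OF \<eta>B] m c cw[OF \<eta>B] by (intro norm_diagonal_le) auto
    moreover have "norm (D f1 (0, e \<eta>) (0, s), 0::real, (1 / \<Lambda>) *\<^sub>R (U *\<^sub>R D (dy F) (0, \<eta>, 0, 0) (0, 0, 1, 0))) \<le> c * norm s"
    proof -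
      have "norm (U *\<^sub>R D (dq F) (0, \<eta>, 0, 0) (0, 0, 1, 0) + D (dq F) (0, \<eta>, 0, 0) (0, 0, 0, \<Lambda> *\<^sub>R P)) \<le> norm s * B1 + B3 * (\<Lambda> * norm s)"
      proof (intro order_trans[OF norm_triangle_ineq] add_mono)
        show "norm (U *\<^sub>R D (dq F) (0, \<eta>, 0, 0) (0, 0, 1, 0)) \<le> norm s * B1"
          unfolding norm_scaleR using ns B1(2)[OF \<eta>B] by (intro mult_mono) auto
        have "norm (\<Lambda> *\<^sub>R P) \<le> \<Lambda> * norm s" using \<Lambda> ns by (simp add: mult_left_mono)
        then show "norm (D (dq F) (0, \<eta>, 0, 0) (0, 0, 0, \<Lambda> *\<^sub>R P)) \<le> B3 * (\<Lambda> * norm s)"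
          using B3'[OF \<eta>B, of "\<Lambda> *\<^sub>R P"] mult_left_mono[OF _ B3(1)] by (meson order_trans)
      qed
      then have "norm (D f1 (0, e \<eta>) (0, s)) \<le> (1 / \<Lambda>\<^sup>2) * (norm s * B1 + B3 * (\<Lambda> * norm s))"
        unfolding s Df1 by (simp add: divide_right_mono)
      also have "\<dots> = (norm s * (B1 / \<Lambda> + B3)) / \<Lambda>" using \<Lambda> by (simp add: field_simps power2_eq_square)
      also have "\<dots> \<le> (norm s * (B1 + B3)) / \<Lambda>"
        using \<Lambda> B1 by (intro divide_right_mono mult_left_mono add_right_mono) (auto simp: divide_le_eq mult_le_cancel_left1)
      finally have n1: "norm (D f1 (0, e \<eta>) (0, s)) \<le> (norm s * (B1 + B3)) / \<Lambda>" .
      have "norm (U *\<^sub>R D (dy F) (0, \<eta>, 0, 0) (0, 0, 1, 0)) \<le> norm s * B2"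
        unfolding norm_scaleR using ns B2(2)[OF \<eta>B] by (intro mult_mono) auto
      then have n3: "norm ((1 / \<Lambda>) *\<^sub>R (U *\<^sub>R D (dy F) (0, \<eta>, 0, 0) (0, 0, 1, 0))) \<le> (norm s * B2) / \<Lambda>"
        using \<Lambda> by (simp add: divide_right_mono)
      have "norm (D f1 (0, e \<eta>) (0, s), 0::real, (1 / \<Lambda>) *\<^sub>R (U *\<^sub>R D (dy F) (0, \<eta>, 0, 0) (0, 0, 1, 0)))
        \<le> norm (D f1 (0, e \<eta>) (0, s)) + norm (0::real, (1 / \<Lambda>) *\<^sub>R (U *\<^sub>R D (dy F) (0, \<eta>, 0, 0) (0, 0, 1, 0)))"
        by (rule norm_Pair_le)
      also have "norm (0::real, (1 / \<Lambda>) *\<^sub>R (U *\<^sub>R D (dy F) (0, \<eta>, 0, 0) (0, 0, 1, 0))) = norm ((1 / \<Lambda>) *\<^sub>R (U *\<^sub>R D (dy F) (0, \<eta>, 0, 0) (0, 0, 1, 0)))"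
        by (simp add: norm_Pair)
      also have "norm (D f1 (0, e \<eta>) (0, s)) + norm ((1 / \<Lambda>) *\<^sub>R (U *\<^sub>R D (dy F) (0, \<eta>, 0, 0) (0, 0, 1, 0)))
        \<le> (norm s * (B1 + B3)) / \<Lambda> + (norm s * B2) / \<Lambda>" by (rule add_mono[OF n1 n3])
      also have "\<dots> = (C / \<Lambda>) * norm s" by (simp add: C_def add_divide_distrib distrib_left distrib_right mult.commute)
      also have "\<dots> \<le> c * norm s" using \<Lambda> by (intro mult_right_mono) auto
      finally show ?thesis .
    qed
    ultimately have "norm (real m *\<^sub>R s + D f (0, e \<eta>) (0, s)) \<le> (real m + 1 - 2 * c) * norm s + c * norm s"
      unfolding eq by (intro order_trans[OF norm_triangle_ineq] add_mono)
    then show ?thesis by (simp add: algebra_simps)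
  qed
  obtain X N where X: "csmooth X" "open N" "{0} \<times> ball 0 R \<subseteq> N" "\<And>\<eta>. X (0, \<eta>) = e \<eta>"
    "\<And>p. p \<in> N \<Longrightarrow> fst p *\<^sub>R D X p (1, 0) = f (fst p, X p)"
    using singular_system_solution[OF fsm es f0 R c(1,2) spec] by metis
  define Y where "Y p = \<Lambda>\<^sup>2 *\<^sub>R fst (X p)" for p
  define W where "W p = fst (snd (X p))" for p
  define Q where "Q p = \<Lambda> *\<^sub>R snd (snd (X p))" for p
  have YWQ: "csmooth Y" "csmooth W" "csmooth Q" unfolding Y_def W_def Q_def by (intro csm X)+
  have P: "pt (fst p, X p) = (fst p, Y p, W p, Q p)" for p by (simp add: pt_def Y_def W_def Q_def)
  have DY: "D Y p v = \<Lambda>\<^sup>2 *\<^sub>R fst (D X p v)" for p v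
    unfolding Y_def using bounded_linear_compose[OF bounded_linear_scaleR_right bounded_linear_fst] by (rule D_linear_compose[OF _ X(1)])
  have DW: "D W p v = fst (snd (D X p v))" for p v
    unfolding W_def using bounded_linear_compose[OF bounded_linear_fst bounded_linear_snd] by (rule D_linear_compose[OF _ X(1)])
  have DQ: "D Q p v = \<Lambda> *\<^sub>R snd (snd (D X p v))" for p v
    unfolding Q_def using bounded_linear_compose[OF bounded_linear_scaleR_right bounded_linear_compose[OF bounded_linear_snd bounded_linear_snd]]
    by (rule D_linear_compose[OF _ X(1)])
  have e1: "fst p *\<^sub>R fst (D X p (1, 0)) = f1 (fst p, X p)" if "p \<in> N" for p
    using arg_cong[OF X(5)[OF that], of fst] by (simp add: f_def)
  have e2: "fst p * fst (snd (D X p (1, 0))) = f2 (fst p, X p)" if "p \<in> N" for p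
    using arg_cong[OF X(5)[OF that], of "\<lambda>s. fst (snd s)"] by (simp add: f_def)
  have e3: "fst p *\<^sub>R snd (snd (D X p (1, 0))) = f3 (fst p, X p)" if "p \<in> N" for p
    using arg_cong[OF X(5)[OF that], of "\<lambda>s. snd (snd s)"] by (simp add: f_def)
  show ?thesis
  proof (rule that[OF YWQ X(2,3)])
    show "Y (0, \<eta>) = \<eta>" "W (0, \<eta>) = 0" "Q (0, \<eta>) = 0" for \<eta>
      using \<Lambda> by (simp_all add: Y_def W_def Q_def X(4) e_def)
    fix p assume p: "p \<in> N"
    have "fst p *\<^sub>R D Y p (1, 0) = \<Lambda>\<^sup>2 *\<^sub>R (fst p *\<^sub>R fst (D X p (1, 0)))" by (simp add: DY scaleR_left_commute mult.commute)
    then show "fst p *\<^sub>R D Y p (1, 0) = - dq F (fst p, Y p, W p, Q p)"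
      unfolding e1[OF p] f1_def P using \<Lambda> by simp
    show "fst p * D W p (1, 0) = F (fst p, Y p, W p, Q p) - Q p \<bullet> dq F (fst p, Y p, W p, Q p)"
      unfolding DW e2[OF p] f2_def P by simp
    have "fst p *\<^sub>R D Q p (1, 0) = \<Lambda> *\<^sub>R (fst p *\<^sub>R snd (snd (D X p (1, 0))))" by (simp add: DQ scaleR_left_commute mult.commute)
    then show "fst p *\<^sub>R D Q p (1, 0) = dy F (fst p, Y p, W p, Q p) + dw F (fst p, Y p, W p, Q p) *\<^sub>R Q p"
      unfolding e3[OF p] f3_def P using \<Lambda> by simp
  qed
qed

section \<open>From characteristics to solutions\<close>

lemma D_zero_on_open:
  assumes "open N" "p \<in> N" "csmooth \<phi>" and z: "\<And>q. q \<in> N \<Longrightarrow> \<phi> q = 0"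
  shows "D \<phi> p v = 0"
proof -
  have "((\<lambda>q. 0) has_derivative D \<phi> p) (at p)"
    by (rule has_derivative_transform_within_open[OF csmooth_deriv[OF assms(3)] assms(1,2)]) (use z in auto)
  then have "D \<phi> p = (\<lambda>v. 0)" using has_derivative_const has_derivative_unique by blast
  then show ?thesis by simp
qed

lemma D_zero_on_slice:
  fixes g :: "real \<times> 'v::real_normed_vector \<Rightarrow> 'w::real_normed_vector"
  assumes g: "csmooth g" and 0: "\<And>y. g (0, y) = 0"
  shows "D g (0, y) (0, v) = 0"
proof -
  have "((\<lambda>y. g (0, y)) has_derivative (\<lambda>v. D g (0, y) (0, v))) (at y)"
    by (rule has_derivative_compose[OF _ csmooth_deriv[OF g]]) (auto intro!: derivative_eq_intros)
  then have "((\<lambda>y. 0) has_derivative (\<lambda>v. D g (0, y) (0, v))) (at y)" using 0 by simp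
  then have "(\<lambda>v. D g (0, y) (0, v)) = (\<lambda>v. 0)"
    using has_derivative_const has_derivative_unique by blast
  then show ?thesis by metis
qed

text \<open>
  Differentiating the characteristic equations in the initial point shows that the defect
  \<open>d = \<partial>\<^sub>\<eta> W - Q \<cdot> \<partial>\<^sub>\<eta> Y\<close> satisfies \<open>x \<partial>\<^sub>x d = F\<^sub>\<omega> d\<close>, and it vanishes at \<open>x = 0\<close>.  This is a transport equation
  without transport, so \<open>d = 0\<close> by the uniqueness lemma.
\<close>

lemma characteristic_strip:
  fixes F :: "real \<times> 'v::euclidean_space \<times> real \<times> 'v \<Rightarrow> real" and Y Q :: "real \<times> 'v \<Rightarrow> 'v" and W :: "real \<times> 'v \<Rightarrow> real"
  assumes F: "csmooth F" and Y: "csmooth Y" and W: "csmooth W" and Q: "csmooth Q" and N: "open N"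
    and W0: "\<And>\<eta>. W (0, \<eta>) = 0" and Q0: "\<And>\<eta>. Q (0, \<eta>) = 0"
    and EY: "\<And>p. p \<in> N \<Longrightarrow> fst p *\<^sub>R D Y p (1, 0) = - dq F (fst p, Y p, W p, Q p)"
    and EW: "\<And>p. p \<in> N \<Longrightarrow> fst p * D W p (1, 0) = F (fst p, Y p, W p, Q p) - Q p \<bullet> dq F (fst p, Y p, W p, Q p)"
    and EQ: "\<And>p. p \<in> N \<Longrightarrow> fst p *\<^sub>R D Q p (1, 0) = dy F (fst p, Y p, W p, Q p) + dw F (fst p, Y p, W p, Q p) *\<^sub>R Q p"
    and \<eta>0: "(0, \<eta>0) \<in> N" and Fw: "dw F (0, Y (0, \<eta>0), 0, 0) < 1"
  obtains \<delta> where "\<delta> > 0" "\<And>x \<eta> v. 0 \<le> x \<Longrightarrow> x < \<delta> \<Longrightarrow> norm (\<eta> - \<eta>0) < \<delta> \<Longrightarrow>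
     D W (x, \<eta>) (0, v) = Q (x, \<eta>) \<bullet> D Y (x, \<eta>) (0, v)"
proof -
  define P where "P p = (fst p, Y p, W p, Q p)" for p
  have Ps: "csmooth P" unfolding P_def by (intro csm Y W Q)
  note part = csmooth_partials[OF F]
  have qP: "csmooth (\<lambda>p. dq F (P p))" "csmooth (\<lambda>p. F (P p))" "csmooth (\<lambda>p. dw F (P p))"
    using part F Ps by (auto intro: csmooth_compose)
  define d where "d v p = D W p (0, v) - Q p \<bullet> D Y p (0, v)" for v p
  have ds: "csmooth (d v)" for v unfolding d_def by (intro csm csmooth_D W Q Y)
  have eq: "fst p * D (d v) p (1, 0) = dw F (P p) * d v p" if p: "p \<in> N" for p v
  proof -
    have DP: "D P p (0, v) = (0, D Y p (0, v), D W p (0, v), D Q p (0, v))"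
      unfolding P_def using D_linear[OF bounded_linear_fst, of p "(0, v)"]
      by (simp add: D_Pair csm Y W Q)
    let ?x = "fst p"
    \<comment> \<open>The equations for \<open>Y\<close> and \<open>W\<close>, differentiated along \<open>(0, v)\<close>; mixed derivatives are exchanged.\<close>
    have "D (\<lambda>p. fst p *\<^sub>R D Y p (1, 0) + dq F (P p)) p (0, v) = 0"
      by (rule D_zero_on_open[OF N p]) (use EY in \<open>auto simp: P_def intro!: csm csmooth_D Y qP[unfolded P_def]\<close>)
    then have 1: "?x *\<^sub>R D (\<lambda>p. D Y p (0, v)) p (1, 0) = - D (\<lambda>p. dq F (P p)) p (0, v)"
      using symmetric_second_derivative[OF Y, of "(1, 0)" p "(0, v)"] D_linear[OF bounded_linear_fst, of p "(0, v)"]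
      by (simp add: D_add D_bilinear[OF bounded_bilinear_scaleR] csm csmooth_D Y qP eq_neg_iff_add_eq_0)
    have "D (\<lambda>p. fst p * D W p (1, 0) - (F (P p) - Q p \<bullet> dq F (P p))) p (0, v) = 0"
      by (rule D_zero_on_open[OF N p]) (use EW in \<open>auto simp: P_def intro!: csm csmooth_D W Q qP[unfolded P_def]\<close>)
    then have 2: "?x * D (\<lambda>p. D W p (0, v)) p (1, 0) =
        D (\<lambda>p. F (P p)) p (0, v) - (Q p \<bullet> D (\<lambda>p. dq F (P p)) p (0, v) + D Q p (0, v) \<bullet> dq F (P p))"
      using symmetric_second_derivative[OF W, of "(1, 0)" p "(0, v)"] D_linear[OF bounded_linear_fst, of p "(0, v)"]
      by (simp add: D_diff D_bilinear[OF bounded_bilinear_mult] D_bilinear[OF bounded_bilinear_inner] csm csmooth_D W Q qP)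
    have 3: "D (\<lambda>p. F (P p)) p (0, v) = dy F (P p) \<bullet> D Y p (0, v) + dw F (P p) * D W p (0, v) + dq F (P p) \<bullet> D Q p (0, v)"
      by (simp only: D_compose[OF F Ps] DP D_eq_partials[OF F])
    have dd: "D (d v) p (1, 0) = D (\<lambda>p. D W p (0, v)) p (1, 0) -
        (Q p \<bullet> D (\<lambda>p. D Y p (0, v)) p (1, 0) + D Q p (1, 0) \<bullet> D Y p (0, v))"
      unfolding d_def by (simp add: D_diff D_bilinear[OF bounded_bilinear_inner] csm csmooth_D W Q Y)
    have "?x * D (d v) p (1, 0) = ?x * D (\<lambda>p. D W p (0, v)) p (1, 0) -
        (Q p \<bullet> (?x *\<^sub>R D (\<lambda>p. D Y p (0, v)) p (1, 0)) + (?x *\<^sub>R D Q p (1, 0)) \<bullet> D Y p (0, v))"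
      unfolding dd by (simp add: right_diff_distrib distrib_left)
    also have "\<dots> = dw F (P p) * d v p"
      unfolding 1 2 3 EQ[OF p, folded P_def]
      by (simp add: d_def inner_add_left inner_commute algebra_simps)
    finally show ?thesis .
  qed
  define \<alpha> where "\<alpha> = (1 + dw F (P (0, \<eta>0))) / 2"
  have P0: "P (0, \<eta>0) = (0, Y (0, \<eta>0), 0, 0)" by (simp add: P_def W0 Q0)
  have \<alpha>: "\<alpha> < 1" "dw F (P (0, \<eta>0)) < \<alpha>" using Fw by (auto simp: \<alpha>_def P0)
  have "open (N \<inter> {p. dw F (P p) < \<alpha>})"
    by (intro open_Int N open_Collect_less csmooth_continuous qP continuous_on_const)
  moreover have "(0, \<eta>0) \<in> N \<inter> {p. dw F (P p) < \<alpha>}" using \<eta>0 \<alpha> by simp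
  ultimately obtain \<rho> where \<rho>: "\<rho> > 0" "ball (0, \<eta>0) \<rho> \<subseteq> N \<inter> {p. dw F (P p) < \<alpha>}"
    by (meson open_contains_ball)
  define r where "r = \<rho> / 2"
  have r: "r > 0" using \<rho> by (simp add: r_def)
  have near: "(x, \<eta>) \<in> N" "dw F (P (x, \<eta>)) < \<alpha>" if "0 \<le> x" "x < r" "norm (\<eta> - \<eta>0) < r" for x \<eta>
  proof -
    have "dist (0, \<eta>0) (x, \<eta>) = norm (x, \<eta> - \<eta>0)" by (simp add: dist_norm norm_Pair norm_minus_commute)
    also have "\<dots> \<le> \<bar>x\<bar> + norm (\<eta> - \<eta>0)" using norm_Pair_le[of x "\<eta> - \<eta>0"] by simp
    also have "\<dots> < \<rho>" using that by (simp add: r_def)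
    finally have "(x, \<eta>) \<in> ball (0, \<eta>0) \<rho>" by simp
    then show "(x, \<eta>) \<in> N" "dw F (P (x, \<eta>)) < \<alpha>" using \<rho>(2) by blast+
  qed
  have "\<exists>\<epsilon>>0. \<forall>x \<eta>. 0 \<le> x \<longrightarrow> x < \<epsilon> \<longrightarrow> norm (\<eta> - \<eta>0) < \<epsilon> \<longrightarrow> d b (x, \<eta>) = 0" for b
  proof -
    have d0: "d b (0, \<eta>) = 0" for \<eta>
      using D_zero_on_slice[OF W W0] by (simp add: d_def Q0)
    have "compact (cball (0::real) r \<times> cball \<eta>0 r)" "convex (cball (0::real) r \<times> cball \<eta>0 r)"
      by (rule compact_Times[OF compact_cball compact_cball], rule convex_Times[OF convex_cball convex_cball])
    moreover have "ck_on (Suc 0) UNIV (d b)" using ds[of b] unfolding csmooth_def by blast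
    ultimately obtain M where M: "0 \<le> M" "\<And>p q. p \<in> cball 0 r \<times> cball \<eta>0 r \<Longrightarrow> q \<in> cball 0 r \<times> cball \<eta>0 r \<Longrightarrow>
        norm (d b p - d b q) \<le> M * norm (p - q)"
      using ck_on_lipschitz[of UNIV "d b" "cball 0 r \<times> cball \<eta>0 r"] by blast
    have bd: "\<bar>d b (x, \<eta>)\<bar> \<le> M * x" if "0 \<le> x" "x < r" "norm (\<eta> - \<eta>0) < r" for x \<eta>
      using M(2)[of "(x, \<eta>)" "(0, \<eta>)"] that d0[of \<eta>] r by (simp add: dist_norm norm_minus_commute norm_Pair)
    have eq': "\<exists>a c. a \<le> \<alpha> \<and> norm c \<le> 0 * x \<and> x * D (d b) (x, \<eta>) (1, 0) = a * d b (x, \<eta>) + D (d b) (x, \<eta>) (0, c)"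
      if h: "0 < x" "x < r" "norm (\<eta> - \<eta>0) < r" for x \<eta>
    proof (intro exI conjI)
      show "dw F (P (x, \<eta>)) \<le> \<alpha>" using near(2)[of x \<eta>] h by simp
      show "norm (0::'v) \<le> 0 * x" by simp
      show "x * D (d b) (x, \<eta>) (1, 0) = dw F (P (x, \<eta>)) * d b (x, \<eta>) + D (d b) (x, \<eta>) (0, 0)"
        using eq[OF near(1)[of x \<eta>]] h linear_0[OF csmooth_linear_D[OF ds[of b]]] by (simp add: zero_prod_def)
    qed
    have der: "(d b has_derivative D (d b) (x, \<eta>)) (at (x, \<eta>))" for x \<eta> by (rule csmooth_deriv[OF ds])
    show ?thesis
    proof (rule transport_unique[where d = "d b" and d' = "D (d b)" and ?y0.0 = \<eta>0 and C = M, OF r order_refl \<alpha>(1)])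
    qed (use der eq' bd in blast)+
  qed
  then obtain \<epsilon> where \<epsilon>: "\<And>b. \<epsilon> b > 0" "\<And>b x \<eta>. 0 \<le> x \<Longrightarrow> x < \<epsilon> b \<Longrightarrow> norm (\<eta> - \<eta>0) < \<epsilon> b \<Longrightarrow> d b (x, \<eta>) = 0"
    by metis
  define \<delta> where "\<delta> = Min (\<epsilon> ` Basis)"
  have \<delta>: "\<delta> > 0" "\<And>b. b \<in> Basis \<Longrightarrow> \<delta> \<le> \<epsilon> b" using \<epsilon>(1) by (auto simp: \<delta>_def)
  show ?thesis
  proof (rule that[OF \<delta>(1)])
    fix x \<eta> v assume h: "0 \<le> x" "x < \<delta>" "norm (\<eta> - \<eta>0) < \<delta>"
    let ?l = "\<lambda>v. D W (x, \<eta>) (0, v) - Q (x, \<eta>) \<bullet> D Y (x, \<eta>) (0, v)"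
    have "linear (\<lambda>v. (0::real, v::'v))" by (auto simp: linear_iff)
    then have "linear (\<lambda>v. D W (x, \<eta>) (0, v))" "linear (\<lambda>v. D Y (x, \<eta>) (0, v))"
      using linear_compose[OF _ csmooth_linear_D[OF W], of "Pair 0" "(x, \<eta>)"]
        linear_compose[OF _ csmooth_linear_D[OF Y], of "Pair 0" "(x, \<eta>)"] by (auto simp: o_def)
    then have "linear ?l"
      by (auto simp: linear_iff inner_add_right algebra_simps)
    then have "?l v = (\<Sum>b\<in>Basis. (v \<bullet> b) *\<^sub>R ?l b)" by (rule linear_basis_expansion)
    also have "\<dots> = 0"
    proof (intro sum.neutral ballI)
      fix b :: 'v assume "b \<in> Basis"
      then have "d b (x, \<eta>) = 0" using \<epsilon>(2)[of x b \<eta>] \<delta>(2)[of b] h by auto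
      then show "(v \<bullet> b) *\<^sub>R ?l b = 0" by (simp add: d_def)
    qed
    finally show "D W (x, \<eta>) (0, v) = Q (x, \<eta>) \<bullet> D Y (x, \<eta>) (0, v)" by simp
  qed
qed

text \<open>
  Solving \<open>Y (x, \<zeta>) = y\<close> for \<open>\<zeta>\<close> is the fixed point problem \<open>\<zeta> = y - (Y (x, \<zeta>) - Y (0, \<zeta>))\<close>, a contraction
  for small \<open>x\<close>.
\<close>

lemma smooth_inverse_near_slice:
  fixes Y :: "real \<times> 'v::euclidean_space \<Rightarrow> 'v"
  assumes Y: "csmooth Y" and Y0: "\<And>\<eta>. Y (0, \<eta>) = \<eta>" and R: "R > 0"
  obtains \<zeta> \<epsilon> where "csmooth \<zeta>" "\<epsilon> > 0" "\<And>y. norm y < R \<Longrightarrow> \<zeta> (0, y) = y"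
    "\<And>x y. \<bar>x\<bar> < \<epsilon> \<Longrightarrow> norm (\<zeta> (x, y)) < R \<Longrightarrow> Y (x, \<zeta> (x, y)) = y"
proof -
  \<comment> \<open>The second real coordinate is a dummy: \<open>Y\<close> has no parameters besides \<open>x\<close>.\<close>
  define G where "G q = Y (fst (fst q), snd q)" for q :: "(real \<times> real) \<times> 'v"
  have Gs: "csmooth G" unfolding G_def by (intro csmooth_compose[OF Y] csm)
  have half: "(1/2::real) > 0" by simp
  obtain \<epsilon> where \<epsilon>: "\<epsilon> > 0" "\<And>x p z z'. \<bar>x\<bar> \<le> \<epsilon> \<Longrightarrow> norm p \<le> 0 \<Longrightarrow>
    norm ((G ((x, p), cutoff R z) - G ((0, p), cutoff R z)) - (G ((x, p), cutoff R z') - G ((0, p), cutoff R z'))) \<le> 1/2 * norm (z - z')"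
    using small_lipschitz_after_cut[OF Gs R half, of 0] by metis
  define h where "h q = snd (fst q) - (Y (cutoff (\<epsilon> / 2) (fst (fst q)), cutoff R (snd q)) - Y (0, cutoff R (snd q)))"
    for q :: "(real \<times> 'v) \<times> 'v"
  have hs: "csmooth h" unfolding h_def by (intro csm csmooth_compose[OF Y] csmooth_cutoff)
  have lip: "norm (h (p, z) - h (p, z')) \<le> 1/2 * norm (z - z')" for p z z'
  proof -
    have "\<bar>cutoff (\<epsilon> / 2) (fst p)\<bar> \<le> \<epsilon>" using norm_cutoff[of "\<epsilon> / 2" "fst p"] \<epsilon>(1) by simp
    from \<epsilon>(2)[OF this, of 0 z' z]
    have "norm ((G ((cutoff (\<epsilon> / 2) (fst p), 0), cutoff R z') - G ((0, 0), cutoff R z')) -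
        (G ((cutoff (\<epsilon> / 2) (fst p), 0), cutoff R z) - G ((0, 0), cutoff R z))) \<le> 1/2 * norm (z' - z)" by simp
    moreover have "h (p, z) - h (p, z') = (G ((cutoff (\<epsilon> / 2) (fst p), 0), cutoff R z') - G ((0, 0), cutoff R z')) -
        (G ((cutoff (\<epsilon> / 2) (fst p), 0), cutoff R z) - G ((0, 0), cutoff R z))"
      by (simp add: h_def G_def)
    ultimately show ?thesis by (metis norm_minus_commute)
  qed
  have hb: "(0::real) \<le> 1/2" "(1/2::real) < 1" by simp_all
  have "\<exists>\<zeta>. csmooth \<zeta> \<and> (\<forall>p. \<zeta> p = h (p, \<zeta> p))"
    by (rule smooth_implicit_fixed_point[OF hs lip hb]) blast
  then obtain \<zeta> where \<zeta>: "csmooth \<zeta>" "\<And>p. \<zeta> p = h (p, \<zeta> p)" by blast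
  have half_pos: "\<epsilon> / 2 > 0" using \<epsilon> by simp
  show ?thesis
  proof (rule that[OF \<zeta>(1) half_pos])
    fix y :: 'v assume "norm y < R"
    have "\<zeta> (0, y) = h ((0, y), \<zeta> (0, y))" by (rule \<zeta>(2))
    also have "\<dots> = y" using \<epsilon>(1) by (simp add: h_def cutoff_id)
    finally show "\<zeta> (0, y) = y" .
  next
    fix x y assume x: "\<bar>x\<bar> < \<epsilon> / 2" and n: "norm (\<zeta> (x, y)) < R"
    have "\<zeta> (x, y) = h ((x, y), \<zeta> (x, y))" by (rule \<zeta>(2))
    also have "\<dots> = y - (Y (x, \<zeta> (x, y)) - \<zeta> (x, y))"
      using x n R half_pos by (simp add: h_def cutoff_id Y0)
    finally show "Y (x, \<zeta> (x, y)) = y" by (simp add: algebra_simps)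
  qed
qed

text \<open>
  Push \<open>W\<close> forward along the characteristics: \<open>u (x, y) = W (x, \<zeta> (x, y))\<close>, with \<open>\<zeta>\<close> the inverse of \<open>Y\<close>.
  The strip condition turns \<open>Q\<close> into the \<open>y\<close>-gradient of \<open>u\<close>, and then the characteristic equations
  for \<open>Y\<close> and \<open>W\<close> combine to the differential equation for \<open>u\<close>.
\<close>

theorem solution_on_ball:
  fixes F :: "real \<times> 'v::euclidean_space \<times> real \<times> 'v \<Rightarrow> real"
  assumes F: "csmooth F" and F0: "\<And>y. F (0, y, 0, 0) = 0" and Fq0: "\<And>y. dq F (0, y, 0, 0) = 0"
    and Fw: "\<And>y. dw F (0, y, 0, 0) < 1" and R: "R > 0"
  obtains u :: "real \<times> 'v \<Rightarrow> real" and N where "csmooth u" "open N" "{0} \<times> ball 0 R \<subseteq> N"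
    "\<And>y. norm y < R \<Longrightarrow> u (0, y) = 0"
    "\<And>x y. (x, y) \<in> N \<Longrightarrow> 0 \<le> x \<Longrightarrow> x * D u (x, y) (1, 0) = F (x, y, u (x, y), gradv (\<lambda>v. D u (x, y) (0, v)))"
proof -
  obtain Y :: "real \<times> 'v \<Rightarrow> 'v" and W Q N where ch: "csmooth Y" "csmooth W" "csmooth Q" "open N" "{0} \<times> ball 0 R \<subseteq> N"
    "\<And>\<eta>. Y (0, \<eta>) = \<eta>" "\<And>\<eta>. W (0, \<eta>) = 0" "\<And>\<eta>. Q (0, \<eta>) = 0"
    and EY: "\<And>p. p \<in> N \<Longrightarrow> fst p *\<^sub>R D Y p (1, 0) = - dq F (fst p, Y p, W p, Q p)"
    and EW: "\<And>p. p \<in> N \<Longrightarrow> fst p * D W p (1, 0) = F (fst p, Y p, W p, Q p) - Q p \<bullet> dq F (fst p, Y p, W p, Q p)"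
    and EQ: "\<And>p. p \<in> N \<Longrightarrow> fst p *\<^sub>R D Q p (1, 0) = dy F (fst p, Y p, W p, Q p) + dw F (fst p, Y p, W p, Q p) *\<^sub>R Q p"
    using characteristic_system_solution[OF F F0 Fq0 Fw R] by metis
  obtain \<zeta> \<epsilon> where \<zeta>: "csmooth \<zeta>" "\<epsilon> > 0" "\<And>y. norm y < R \<Longrightarrow> \<zeta> (0, y) = y"
    "\<And>x y. \<bar>x\<bar> < \<epsilon> \<Longrightarrow> norm (\<zeta> (x, y)) < R \<Longrightarrow> Y (x, \<zeta> (x, y)) = y"
    using smooth_inverse_near_slice[OF ch(1,6) R] by metis
  define strip where "strip p \<longleftrightarrow> (\<forall>v. D W p (0, v) = Q p \<bullet> D Y p (0, v))" for p
  \<comment> \<open>The strip condition holds near each point of the slice, but only where \<open>x \<ge> 0\<close>.\<close>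
  define \<Omega> where "\<Omega> = \<Union>{T. open T \<and> T \<subseteq> N \<and> (\<forall>p\<in>T. 0 \<le> fst p \<longrightarrow> strip p)}"
  have \<Omega>: "open \<Omega>" "\<Omega> \<subseteq> N" "\<And>p. p \<in> \<Omega> \<Longrightarrow> 0 \<le> fst p \<Longrightarrow> strip p" unfolding \<Omega>_def by auto
  have \<Omega>0: "(0, \<eta>0) \<in> \<Omega>" if "norm \<eta>0 < R" for \<eta>0
  proof -
    have inN: "(0, \<eta>0) \<in> N" using ch(5) that by auto
    have "dw F (0, Y (0, \<eta>0), 0, 0) < 1" using Fw by simp
    then obtain \<delta> where \<delta>: "\<delta> > 0" "\<And>x \<eta> v. 0 \<le> x \<Longrightarrow> x < \<delta> \<Longrightarrow> norm (\<eta> - \<eta>0) < \<delta> \<Longrightarrow>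
       D W (x, \<eta>) (0, v) = Q (x, \<eta>) \<bullet> D Y (x, \<eta>) (0, v)"
      using characteristic_strip[OF F ch(1-4,7,8) EY EW EQ inN] by metis
    let ?T = "N \<inter> ({..<\<delta>} \<times> ball \<eta>0 \<delta>)"
    have "open ?T" "?T \<subseteq> N" by (auto intro!: open_Int ch(4) open_Times)
    moreover have "strip p" if "p \<in> ?T" "0 \<le> fst p" for p
      using \<delta>(2)[of "fst p" "snd p"] that by (auto simp: strip_def dist_norm norm_minus_commute)
    moreover have "(0, \<eta>0) \<in> ?T" using inN \<delta>(1) by simp
    ultimately show ?thesis unfolding \<Omega>_def by blast
  qed
  define s where "s p = (fst p, \<zeta> p)" for p
  have ss: "csmooth s" unfolding s_def by (intro csm \<zeta>)
  define M where "M = {p. \<bar>fst p\<bar> < \<epsilon> \<and> norm (\<zeta> p) < R}"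
  have Mo: "open M" unfolding M_def
    by (intro open_Collect_conj open_Collect_less continuous_intros csmooth_continuous \<zeta>)
  define N' where "N' = M \<inter> s -` \<Omega>"
  define u where "u p = W (s p)" for p
  show ?thesis
  proof (rule that)
    show "csmooth u" unfolding u_def by (rule csmooth_compose[OF ch(2) ss])
    show "open N'" unfolding N'_def
      using Mo continuous_open_vimage[OF \<Omega>(1), of s] csmooth_continuous[OF ss] continuous_on_eq_continuous_at[OF open_UNIV]
      by (intro open_Int) auto
    show "{0} \<times> ball 0 R \<subseteq> N'"
      using \<zeta>(2,3) \<Omega>0 by (auto simp: N'_def M_def s_def)
    show "u (0, y) = 0" if "norm y < R" for y using \<zeta>(3)[OF that] ch(7) by (simp add: u_def s_def)
    fix x y assume p: "(x, y) \<in> N'" and x: "0 \<le> x"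
    let ?p = "(x, y)" let ?s = "s (x, y)"
    have sN: "?s \<in> N" and st: "strip ?s" using p \<Omega> x by (auto simp: N'_def s_def)
    have Ys: "Y ?s = y" using p \<zeta>(4)[of x y] by (simp add: N'_def M_def s_def)
    have DYs: "D Y ?s (D s ?p v) = snd v" for v
    proof -
      have "D (\<lambda>p. Y (s p) - snd p) ?p v = 0"
        by (rule D_zero_on_open[OF Mo]) (use p \<zeta>(4) in \<open>auto simp: N'_def M_def s_def intro!: csm csmooth_compose[OF ch(1)] ss[unfolded s_def]\<close>)
      then show ?thesis
        using D_linear[OF bounded_linear_snd, of ?p v]
        by (simp add: D_diff D_compose[OF ch(1) ss] csmooth_compose[OF ch(1) ss] csm)
    qed
    have Ds: "D s ?p v = fst v *\<^sub>R (1, 0) + (0, D \<zeta> ?p v)" for v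
      unfolding s_def using D_linear[OF bounded_linear_fst, of ?p v] by (simp add: D_Pair csm \<zeta>)
    have linW: "linear (D W ?s)" and linY: "linear (D Y ?s)" by (rule csmooth_linear_D[OF ch(2)], rule csmooth_linear_D[OF ch(1)])
    have Du: "D u ?p v = fst v * D W ?s (1, 0) + Q ?s \<bullet> (snd v - fst v *\<^sub>R D Y ?s (1, 0))" for v
    proof -
      have "D u ?p v = D W ?s (D s ?p v)" unfolding u_def by (rule D_compose[OF ch(2) ss])
      also have "\<dots> = fst v *\<^sub>R D W ?s (1, 0) + D W ?s (0, D \<zeta> ?p v)"
        unfolding Ds by (simp only: linear_add[OF linW] linear_scale[OF linW])
      also have "D W ?s (0, D \<zeta> ?p v) = Q ?s \<bullet> D Y ?s (0, D \<zeta> ?p v)" using st by (simp add: strip_def)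
      also have "D Y ?s (0, D \<zeta> ?p v) = snd v - fst v *\<^sub>R D Y ?s (1, 0)"
        using DYs[of v] unfolding Ds linear_add[OF linY] linear_scale[OF linY] by (simp add: algebra_simps)
      finally show ?thesis by simp
    qed
    have grad: "gradv (\<lambda>v. D u ?p (0, v)) = Q ?s"
      by (rule gradv_eq) (simp add: Du)
    have fs: "fst ?s = x" by (simp add: s_def)
    have "x * D u ?p (1, 0) = fst ?s * D W ?s (1, 0) - Q ?s \<bullet> (fst ?s *\<^sub>R D Y ?s (1, 0))"
      by (simp add: Du fs inner_diff_right algebra_simps)
    also have "\<dots> = F (fst ?s, Y ?s, W ?s, Q ?s)"
      unfolding EW[OF sN] EY[OF sN] by simp
    finally show "x * D u (x, y) (1, 0) = F (x, y, u (x, y), gradv (\<lambda>v. D u (x, y) (0, v)))"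
      unfolding grad fs Ys by (simp add: u_def)
  qed
qed

section \<open>Smoothness and uniqueness on a half-space\<close>

definition hspace :: "(real \<times> 'v::euclidean_space) set"
  where "hspace = {0..} \<times> UNIV"

lemma at_within_open_subset_hspace:
  assumes "open T" "z \<in> T" shows "at z within (hspace \<inter> T) = at z within hspace"
  by (rule at_within_nhd[of z T]) (use assms in auto)

lemma hspace_derivative_unique:
  fixes f :: "real \<times> 'v::euclidean_space \<Rightarrow> 'w::real_normed_vector"
  assumes z: "z \<in> hspace" and 1: "(f has_derivative f1) (at z within hspace)" and 2: "(f has_derivative f2) (at z within hspace)"
  shows "f1 = f2"
proof (rule frechet_derivative_unique_within[OF 1 2])
  fix i :: "real \<times> 'v" and e :: real assume i: "i \<in> Basis" and e: "e > 0"
  have "z + (e/2) *\<^sub>R i \<in> hspace"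
    using i z e by (auto simp: Basis_prod_def hspace_def)
  then show "\<exists>d. 0 < \<bar>d\<bar> \<and> \<bar>d\<bar> < e \<and> z + d *\<^sub>R i \<in> hspace" using e by (intro exI[of _ "e/2"]) auto
qed

text \<open>
  Near each point the function coincides on the half-space with a function that is smooth on the whole
  space.  This is what gluing produces; it implies smoothness up to the boundary because derivatives
  within the half-space are unique.
\<close>

definition locally_csmooth :: "(real \<times> 'v::euclidean_space) set \<Rightarrow> (real \<times> 'v \<Rightarrow> 'w::real_normed_vector) \<Rightarrow> bool"
  where "locally_csmooth T \<omega> \<longleftrightarrow> (\<forall>z\<in>hspace \<inter> T. \<exists>N u. open N \<and> z \<in> N \<and> csmooth u \<and> (\<forall>w\<in>hspace \<inter> N. \<omega> w = u w))"

lemma local_piece_derivative: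
  assumes "open N" "z \<in> hspace \<inter> N" "csmooth u" "\<And>w. w \<in> hspace \<inter> N \<Longrightarrow> \<omega> w = u w"
  shows "(\<omega> has_derivative D u z) (at z within hspace)"
proof -
  have "(u has_derivative D u z) (at z within hspace \<inter> N)"
    using csmooth_deriv[OF assms(3)] by (rule has_derivative_at_withinI)
  then have "(\<omega> has_derivative D u z) (at z within hspace \<inter> N)"
    by (rule has_derivative_transform[OF assms(2), rotated]) (use assms(4) in simp)
  then show ?thesis using at_within_open_subset_hspace[OF assms(1), of z] assms(2) by auto
qed

lemma locally_csmooth_ck_on:
  fixes \<omega> :: "real \<times> 'v::euclidean_space \<Rightarrow> 'w::real_normed_vector"
  assumes T: "open T"
  shows "locally_csmooth T \<omega> \<Longrightarrow> ck_on k (hspace \<inter> T) \<omega>"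
proof (induction k arbitrary: \<omega>)
  case 0
  have "continuous (at z within hspace \<inter> T) \<omega>" if z: "z \<in> hspace \<inter> T" for z
  proof -
    obtain N u where N: "open N" "z \<in> N" "csmooth u" "\<forall>w\<in>hspace \<inter> N. \<omega> w = u w"
      using 0 z unfolding locally_csmooth_def by blast
    have "(\<omega> has_derivative D u z) (at z within hspace)"
      by (rule local_piece_derivative[OF N(1) _ N(3)]) (use N z in auto)
    then have "continuous (at z within hspace) \<omega>" by (rule has_derivative_continuous)
    then show ?thesis using at_within_open_subset_hspace[OF T, of z] z by simp
  qed
  then show ?case by (simp add: continuous_on_eq_continuous_within)
next
  case (Suc k)
  have "\<exists>u. csmooth u \<and> (\<exists>N. open N \<and> z \<in> N \<and> (\<forall>w\<in>hspace \<inter> N. \<omega> w = u w))" if "z \<in> hspace \<inter> T" for z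
    using Suc.prems that unfolding locally_csmooth_def by blast
  then obtain u where u: "\<And>z. z \<in> hspace \<inter> T \<Longrightarrow> csmooth (u z)"
      "\<And>z. z \<in> hspace \<inter> T \<Longrightarrow> \<exists>N. open N \<and> z \<in> N \<and> (\<forall>w\<in>hspace \<inter> N. \<omega> w = u z w)"
    by metis
  have d: "(\<omega> has_derivative D (u z) z) (at z within hspace)" if z: "z \<in> hspace \<inter> T" for z
    using u(2)[OF z] local_piece_derivative[OF _ _ u(1)[OF z], of _ z \<omega>] z by blast
  have "locally_csmooth T (\<lambda>z. D (u z) z v)" for v
    unfolding locally_csmooth_def
  proof
    fix z assume z: "z \<in> hspace \<inter> T"
    obtain N where N: "open N" "z \<in> N" "\<forall>w\<in>hspace \<inter> N. \<omega> w = u z w" using u(2)[OF z] by blast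
    have "D (u w) w v = D (u z) w v" if w: "w \<in> hspace \<inter> (N \<inter> T)" for w
    proof -
      have "(\<omega> has_derivative D (u z) w) (at w within hspace)"
        by (rule local_piece_derivative[OF N(1) _ u(1)[OF z]]) (use N w in auto)
      then have "D (u w) w = D (u z) w"
        using hspace_derivative_unique[OF _ d[of w]] w by blast
      then show ?thesis by simp
    qed
    then show "\<exists>N ua. open N \<and> z \<in> N \<and> csmooth ua \<and> (\<forall>w\<in>hspace \<inter> N. D (u w) w v = ua w)"
      using N z T csmooth_D[OF u(1)[OF z]] by (intro exI[of _ "N \<inter> T"] exI[of _ "\<lambda>w. D (u z) w v"]) auto
  qed
  then have "ck_on k (hspace \<inter> T) (\<lambda>z. D (u z) z v)" for v by (rule Suc.IH)
  moreover have "(\<omega> has_derivative D (u z) z) (at z within hspace \<inter> T)" if z: "z \<in> hspace \<inter> T" for z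
    using d[OF z] at_within_open_subset_hspace[OF T, of z] z by simp
  ultimately show ?case unfolding ck_on.simps
    by (intro exI[of _ "\<lambda>z. D (u z) z"] conjI ballI allI)
qed

lemma csmooth_mean_value:
  fixes F :: "'a::real_normed_vector \<Rightarrow> real"
  assumes F: "csmooth F"
  obtains t where "0 \<le> t" "t \<le> 1" "F (p + v) - F p = D F (p + t *\<^sub>R v) v"
proof -
  have "\<exists>t\<in>{0..1}. F (p + 1 *\<^sub>R v) - F (p + 0 *\<^sub>R v) = D F (p + t *\<^sub>R v) ((1 - 0) *\<^sub>R v)"
  proof (rule mvt_very_simple)
    fix t :: real
    show "((\<lambda>t. F (p + t *\<^sub>R v)) has_derivative (\<lambda>s. D F (p + t *\<^sub>R v) (s *\<^sub>R v))) (at t within {0..1})"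
      by (rule has_derivative_compose[OF _ csmooth_deriv[OF F]]) (auto intro!: derivative_eq_intros)
  qed simp
  then show ?thesis using that by auto
qed

text \<open>
  Both functions are Lipschitz on the compact box and vanish on its face \<open>x = 0\<close>.
\<close>

lemma solution_linear_bounds:
  fixes \<omega> :: "real \<times> 'v::euclidean_space \<Rightarrow> real"
  assumes r: "r > 0" and S: "S = {0..r} \<times> cball y0 r"
    and der: "\<And>z. z \<in> S \<Longrightarrow> (\<omega> has_derivative f' z) (at z within S)"
    and c1: "\<And>v. ck_on (Suc 0) S (\<lambda>z. f' z v)"
    and zero: "\<And>y. y \<in> cball y0 r \<Longrightarrow> \<omega> (0, y) = 0"
  obtains M where "0 \<le> M"
    "\<And>x y. 0 \<le> x \<Longrightarrow> x \<le> r \<Longrightarrow> norm (y - y0) < r \<Longrightarrow> \<bar>\<omega> (x, y)\<bar> \<le> M * x"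
    "\<And>x y. 0 \<le> x \<Longrightarrow> x \<le> r \<Longrightarrow> norm (y - y0) < r \<Longrightarrow> norm (gradv (\<lambda>v. f' (x, y) (0, v))) \<le> M * x"
proof -
  have comp: "compact S" and conv: "convex S"
    unfolding S by (rule compact_Times[OF compact_Icc compact_cball], rule convex_Times[OF convex_closed_interval convex_cball])
  have "ck_on (Suc 0) S \<omega>"
    unfolding ck_on.simps using der c1[THEN ck_on_SucD] by (auto intro!: exI[of _ f'])
  then obtain M1 where M1: "0 \<le> M1" "\<And>p q. p \<in> S \<Longrightarrow> q \<in> S \<Longrightarrow> norm (\<omega> p - \<omega> q) \<le> M1 * norm (p - q)"
    using ck_on_lipschitz[OF _ comp conv order_refl] by blast
  have "\<exists>M\<ge>0. \<forall>p\<in>S. \<forall>q\<in>S. norm (f' p (0, b) - f' q (0, b)) \<le> M * norm (p - q)" for b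
    by (rule ck_on_lipschitz[OF c1[of "(0, b)"] comp conv order_refl]) blast
  then obtain L where L: "\<And>b. 0 \<le> L b" "\<And>b p q. p \<in> S \<Longrightarrow> q \<in> S \<Longrightarrow> norm (f' p (0, b) - f' q (0, b)) \<le> L b * norm (p - q)"
    by metis
  have f0: "f' (0, y) (0, v) = 0" if y: "norm (y - y0) < r" for y v
  proof -
    have yS: "(0, y) \<in> S" using y r by (simp add: S dist_norm norm_minus_commute)
    have "((\<lambda>y. \<omega> (0, y)) has_derivative (\<lambda>v. f' (0, y) (0, v))) (at y within ball y0 r)"
    proof (rule has_derivative_in_compose2[where t = S and g = \<omega> and g' = f' and f = "Pair 0" and f' = "Pair 0"])
      show "Pair 0 ` ball y0 r \<subseteq> S" using r by (auto simp: S)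
      show "y \<in> ball y0 r" using y by (simp add: dist_norm norm_minus_commute)
      show "(Pair 0 has_derivative Pair 0) (at y within ball y0 r)"
        by (auto intro!: derivative_eq_intros)
    qed (rule der)
    moreover have "y \<in> ball y0 r" using y by (simp add: dist_norm norm_minus_commute)
    ultimately have "((\<lambda>y. \<omega> (0, y)) has_derivative (\<lambda>v. f' (0, y) (0, v))) (at y)"
      by (simp add: at_within_open[OF _ open_ball])
    then have "((\<lambda>y. 0) has_derivative (\<lambda>v. f' (0, y) (0, v))) (at y)"
      by (rule has_derivative_transform_within_open[OF _ open_ball \<open>y \<in> ball y0 r\<close>]) (use zero in auto)
    then have "(\<lambda>v. f' (0, y) (0, v)) = (\<lambda>v. 0)" using has_derivative_const has_derivative_unique by blast
    then show ?thesis by metis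
  qed
  define M where "M = M1 + (\<Sum>b\<in>Basis. L b)"
  have M2: "0 \<le> (\<Sum>b\<in>Basis. L b)" using L(1) by (intro sum_nonneg) auto
  show ?thesis
  proof (rule that)
    show "0 \<le> M" using M1(1) M2 by (simp add: M_def)
    fix x y assume h: "0 \<le> x" "x \<le> r" "norm (y - y0) < r"
    have pS: "(x, y) \<in> S" "(0, y) \<in> S" and yb: "y \<in> cball y0 r" using h r by (auto simp: S dist_norm norm_minus_commute)
    have nx: "norm ((x, y) - (0, y)) = x" using h by (simp add: norm_Pair)
    have "\<bar>\<omega> (x, y)\<bar> \<le> M1 * x" using M1(2)[OF pS] zero[OF yb] unfolding nx by simp
    also have "\<dots> \<le> M * x" using M2 h by (intro mult_right_mono) (auto simp: M_def)
    finally show "\<bar>\<omega> (x, y)\<bar> \<le> M * x" .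
    have "norm (gradv (\<lambda>v. f' (x, y) (0, v))) \<le> (\<Sum>b\<in>Basis. L b * x)"
      unfolding gradv_def
    proof (rule sum_norm_le)
      fix b :: 'v assume "b \<in> Basis"
      then show "norm (f' (x, y) (0, b) *\<^sub>R b) \<le> L b * x"
        using L(2)[OF pS, of b] f0[OF h(3), of b] unfolding nx by simp
    qed
    also have "\<dots> \<le> M * x" using M1(1) h by (simp add: M_def sum_distrib_right[symmetric] distrib_right)
    finally show "norm (gradv (\<lambda>v. f' (x, y) (0, v))) \<le> M * x" .
  qed
qed

text \<open>
  The difference \<open>d\<close> of two solutions satisfies a transport equation whose coefficients are
  \<open>F\<^sub>\<omega>\<close> and \<open>F\<^sub>q\<close> at an intermediate point of the mean value theorem.  That point is within \<open>O(x)\<close> of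
  \<open>(0, y, 0, 0)\<close>, where \<open>F\<^sub>\<omega> < 1\<close> and \<open>F\<^sub>q = 0\<close>; so the first coefficient stays below 1 and the second is
  \<open>O(x)\<close>, as \<open>transport_unique\<close> requires.  The two solutions are indexed by \<^typ>\<open>bool\<close> so
  that their common properties are stated once.
\<close>

lemma solutions_agree_near:
  fixes F :: "real \<times> 'v::euclidean_space \<times> real \<times> 'v \<Rightarrow> real" and \<omega> :: "bool \<Rightarrow> real \<times> 'v \<Rightarrow> real"
  assumes F: "csmooth F" and Fq0: "\<And>y. dq F (0, y, 0, 0) = 0" and Fw: "dw F (0, y0, 0, 0) < 1"
    and r: "r > 0" and S: "S = {0..r} \<times> cball y0 r"
    and der: "\<And>i z. z \<in> S \<Longrightarrow> (\<omega> i has_derivative f' i z) (at z within S)"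
    and c1: "\<And>i v. ck_on (Suc 0) S (\<lambda>z. f' i z v)"
    and zero: "\<And>i y. y \<in> cball y0 r \<Longrightarrow> \<omega> i (0, y) = 0"
    and pde: "\<And>i x y. 0 < x \<Longrightarrow> x < r \<Longrightarrow> norm (y - y0) < r \<Longrightarrow>
       x * f' i (x, y) (1, 0) = F (x, y, \<omega> i (x, y), gradv (\<lambda>v. f' i (x, y) (0, v)))"
  shows "\<exists>\<epsilon>>0. \<forall>x y. 0 \<le> x \<longrightarrow> x < \<epsilon> \<longrightarrow> norm (y - y0) < \<epsilon> \<longrightarrow> \<omega> True (x, y) = \<omega> False (x, y)"
proof -
  define g where "g i z = gradv (\<lambda>v. f' i z (0, v))" for i z
  have "\<exists>M\<ge>0. (\<forall>x y. 0 \<le> x \<longrightarrow> x \<le> r \<longrightarrow> norm (y - y0) < r \<longrightarrow> \<bar>\<omega> i (x, y)\<bar> \<le> M * x) \<and>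
      (\<forall>x y. 0 \<le> x \<longrightarrow> x \<le> r \<longrightarrow> norm (y - y0) < r \<longrightarrow> norm (g i (x, y)) \<le> M * x)" for i
    unfolding g_def by (rule solution_linear_bounds[OF r S der c1 zero]) blast+
  then obtain B where B: "\<And>i. 0 \<le> B i" "\<And>i x y. 0 \<le> x \<Longrightarrow> x \<le> r \<Longrightarrow> norm (y - y0) < r \<Longrightarrow> \<bar>\<omega> i (x, y)\<bar> \<le> B i * x"
      "\<And>i x y. 0 \<le> x \<Longrightarrow> x \<le> r \<Longrightarrow> norm (y - y0) < r \<Longrightarrow> norm (g i (x, y)) \<le> B i * x"
    by metis
  define M where "M = B True + B False"
  have M0: "0 \<le> M" using B(1) by (simp add: M_def)
  have BM: "B i * x \<le> M * x" if "0 \<le> x" for i x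
    using B(1) that by (intro mult_right_mono) (cases i; simp add: M_def)+
  have Mw: "\<bar>\<omega> i (x, y)\<bar> \<le> M * x" and Mg: "norm (g i (x, y)) \<le> M * x" if "0 \<le> x" "x \<le> r" "norm (y - y0) < r" for i x y
    using B(2,3)[OF that] BM[OF that(1)] by (meson order_trans)+
  note part = csmooth_partials[OF F]
  let ?K = "cball 0 r \<times> cball y0 r \<times> cball 0 (M * r) \<times> cball (0::'v) (M * r) :: (real \<times> 'v \<times> real \<times> 'v) set"
  have "compact ?K" "convex ?K"
    by (intro compact_Times compact_cball, intro convex_Times convex_cball)
  moreover have "ck_on (Suc 0) UNIV (dq F)" using part(3) unfolding csmooth_def by blast
  ultimately obtain L where L: "0 \<le> L" "\<And>p q. p \<in> ?K \<Longrightarrow> q \<in> ?K \<Longrightarrow> norm (dq F p - dq F q) \<le> L * norm (p - q)"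
    using ck_on_lipschitz[of UNIV "dq F" ?K] by blast
  define \<alpha> where "\<alpha> = (1 + dw F (0, y0, 0, 0)) / 2"
  have \<alpha>: "\<alpha> < 1" "dw F (0, y0, 0, 0) < \<alpha>" using Fw by (auto simp: \<alpha>_def)
  have "open {p. dw F p < \<alpha>}" by (intro open_Collect_less csmooth_continuous part continuous_on_const)
  then obtain \<rho> where \<rho>: "\<rho> > 0" "ball (0, y0, 0, 0) \<rho> \<subseteq> {p. dw F p < \<alpha>}"
    using \<alpha>(2) unfolding open_contains_ball by blast
  \<comment> \<open>On the box of size \<open>s\<close> the intermediate points \<open>c\<close> below stay in the ball where \<open>F\<^sub>\<omega> < \<alpha>\<close>.\<close>
  define s where "s = min r (\<rho> / (2 + 2 * M))"
  have s: "s > 0" "s \<le> r" "s * (2 + 2 * M) \<le> \<rho>"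
  proof -
    show "s > 0" "s \<le> r" using r \<rho> M0 by (auto simp: s_def)
    have "s * (2 + 2 * M) \<le> (\<rho> / (2 + 2 * M)) * (2 + 2 * M)"
      using M0 by (intro mult_right_mono) (auto simp: s_def)
    also have "\<dots> = \<rho>" using M0 by simp
    finally show "s * (2 + 2 * M) \<le> \<rho>" .
  qed
  define d where "d z = \<omega> True z - \<omega> False z" for z
  define d' where "d' z v = f' True z v - f' False z v" for z v
  have inner: "(x, y) \<in> S" "at (x, y) within S = at (x, y)" if h: "0 < x" "x < s" "norm (y - y0) < s" for x y
  proof -
    have "(x, y) \<in> {0<..<r} \<times> ball y0 r" using h s by (auto simp: dist_norm norm_minus_commute)
    moreover have "{0<..<r} \<times> ball y0 r \<subseteq> S" by (auto simp: S)
    moreover have "open ({0<..<r} \<times> ball y0 r)" by (intro open_Times open_greaterThanLessThan open_ball)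
    ultimately show "(x, y) \<in> S" "at (x, y) within S = at (x, y)"
      by (blast, metis at_within_interior interior_maximal subset_iff)
  qed
  have derd: "(d has_derivative d' (x, y)) (at (x, y))" if h: "0 < x" "x < s" "norm (y - y0) < s" for x y
    using has_derivative_diff[OF der[of "(x, y)" True] der[of "(x, y)" False]] inner[OF h]
    unfolding d_def[abs_def] d'_def by simp
  have linf: "linear (\<lambda>v. f' i (x, y) (0, v))" if h: "0 < x" "x < s" "norm (y - y0) < s" for i x y
  proof -
    have "linear (f' i (x, y))" by (rule has_derivative_linear[OF der[OF inner(1)[OF h]]])
    from linear_compose[OF _ this, of "Pair 0"] show ?thesis by (simp add: o_def linear_iff)
  qed
  have eq: "\<exists>a b. a \<le> \<alpha> \<and> norm b \<le> (L * (1 + 2 * M)) * x \<and> x * d' (x, y) (1, 0) = a * d (x, y) + d' (x, y) (0, b)"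
    if h: "0 < x" "x < s" "norm (y - y0) < s" for x y
  proof -
    have hr: "0 \<le> x" "x \<le> r" "x < r" "norm (y - y0) < r" using h s by auto
    let ?w = "\<lambda>i. \<omega> i (x, y)" and ?q = "\<lambda>i. g i (x, y)"
    obtain t where t: "0 \<le> t" "t \<le> 1" and Ft: "F ((x, y, ?w False, ?q False) + (0, 0, ?w True - ?w False, ?q True - ?q False)) - F (x, y, ?w False, ?q False)
       = D F ((x, y, ?w False, ?q False) + t *\<^sub>R (0, 0, ?w True - ?w False, ?q True - ?q False)) (0, 0, ?w True - ?w False, ?q True - ?q False)"
      using csmooth_mean_value[OF F] by metis
    define w where "w = ?w False + t * (?w True - ?w False)"
    define q where "q = ?q False + t *\<^sub>R (?q True - ?q False)"
    define c where "c = (x, y, w, q)"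
    have wq: "w = (1 - t) *\<^sub>R ?w False + t *\<^sub>R ?w True" "q = (1 - t) *\<^sub>R ?q False + t *\<^sub>R ?q True"
      by (simp_all add: w_def q_def algebra_simps)
    have "w \<in> cball 0 (M * x)"
      unfolding wq(1) using Mw[OF hr(1,2,4)] t by (intro convexD[OF convex_cball]) auto
    moreover have "q \<in> cball 0 (M * x)"
      unfolding wq(2) using Mg[OF hr(1,2,4)] t by (intro convexD[OF convex_cball]) auto
    ultimately have bw: "\<bar>w\<bar> \<le> M * x" and bq: "norm q \<le> M * x" by auto
    have MM: "M * x \<le> M * r" using hr M0 by (intro mult_left_mono) auto
    have tri: "norm (a, b, e, k) \<le> \<bar>a\<bar> + norm b + \<bar>e\<bar> + norm k" for a e :: real and b k :: 'v
      using norm_Pair_le[of a "(b, e, k)"] norm_Pair_le[of b "(e, k)"] norm_Pair_le[of e k] by simp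
    have "dist c (0, y0, 0, 0) \<le> \<bar>x\<bar> + norm (y - y0) + \<bar>w\<bar> + norm q"
      using tri[of x "y - y0" w q] by (simp add: c_def dist_norm)
    also have "\<dots> < s + s + M * s + M * s"
    proof -
      have "M * x \<le> M * s" using h M0 by (intro mult_left_mono) auto
      then show ?thesis using h bw bq by simp
    qed
    also have "\<dots> \<le> \<rho>" using s(3) by (simp add: algebra_simps)
    finally have "c \<in> ball (0, y0, 0, 0) \<rho>" by (simp add: dist_commute)
    then have a: "dw F c \<le> \<alpha>" using \<rho>(2) by auto
    have "c \<in> ?K" "(0, y, 0, 0) \<in> ?K"
      using hr bw bq MM M0 by (auto simp: c_def dist_norm norm_minus_commute)
    from L(2)[OF this] have "norm (dq F c) \<le> L * norm (c - (0, y, 0, 0))" by (simp add: Fq0)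
    also have "\<dots> \<le> L * (\<bar>x\<bar> + \<bar>w\<bar> + norm q)"
      using tri[of x 0 w q] L(1) by (intro mult_left_mono) (auto simp: c_def)
    also have "\<dots> \<le> L * (x + M * x + M * x)" using bw bq hr L(1) by (intro mult_left_mono add_mono) auto
    finally have b: "norm (dq F c) \<le> (L * (1 + 2 * M)) * x" by (simp add: algebra_simps)
    have "x * d' (x, y) (1, 0) = F (x, y, ?w True, ?q True) - F (x, y, ?w False, ?q False)"
      using pde[OF h(1) hr(3,4), of True] pde[OF h(1) hr(3,4), of False]
      by (simp add: d'_def right_diff_distrib g_def)
    also have "\<dots> = D F c (0, 0, ?w True - ?w False, ?q True - ?q False)"
      using Ft by (simp add: c_def w_def q_def)
    also have "\<dots> = dw F c * d (x, y) + dq F c \<bullet> (?q True - ?q False)"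
      by (simp add: D_eq_partials[OF F] d_def)
    also have "dq F c \<bullet> (?q True - ?q False) = d' (x, y) (0, dq F c)"
      using gradv_inner[OF linf[OF h], of True "dq F c"] gradv_inner[OF linf[OF h], of False "dq F c"]
      by (simp add: d'_def g_def inner_commute inner_diff_right)
    finally show ?thesis using a b by blast
  qed
  have bd: "\<bar>d (x, y)\<bar> \<le> (2 * M) * x" if h: "0 \<le> x" "x < s" "norm (y - y0) < s" for x y
    using Mw[of x y True] Mw[of x y False] h s by (simp add: d_def)
  have LM: "0 \<le> L * (1 + 2 * M)" using L(1) M0 by simp
  have "\<exists>\<epsilon>>0. \<forall>x y. 0 \<le> x \<longrightarrow> x < \<epsilon> \<longrightarrow> norm (y - y0) < \<epsilon> \<longrightarrow> d (x, y) = 0"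
  proof (rule transport_unique[where d = d and d' = d' and ?y0.0 = y0 and C = "2 * M", OF s(1) LM \<alpha>(1)])
  qed (use derd eq bd in blast)+
  then show ?thesis by (simp add: d_def)
qed

section \<open>Gluing solutions on balls\<close>

lemma box_in_open:
  fixes y :: "'v::euclidean_space"
  assumes T: "open T" "(0, y) \<in> T"
  obtains r :: real where "r > 0" "{0..r} \<times> cball y r \<subseteq> T"
proof -
  obtain e where e: "e > 0" "ball (0, y) e \<subseteq> T" using T open_contains_ball by blast
  have "{0..e/3} \<times> cball y (e/3) \<subseteq> T"
  proof clarify
    fix x :: real and y' assume "x \<in> {0..e/3}" "y' \<in> cball y (e/3)"
    then have h: "\<bar>x\<bar> \<le> e/3" "norm (y' - y) \<le> e/3" by (auto simp: dist_norm norm_minus_commute)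
    have "dist (x, y') (0, y) \<le> \<bar>x\<bar> + norm (y' - y)"
      using norm_Pair_le[of x "y' - y"] by (simp add: dist_norm)
    also have "\<dots> < e" using h e(1) by linarith
    finally show "(x, y') \<in> T" using e(2) by (auto simp: dist_commute)
  qed
  then show ?thesis using that[of "e/3"] e(1) by simp
qed

text \<open>
  The solutions \<open>u k\<close> on balls of radius \<open>k + 2\<close> agree with their successors near \<open>x = 0\<close> by uniqueness.  At
  \<open>(x, y)\<close> take the one with \<open>k = \<lfloor>norm y\<rfloor>\<close>; near a point where this index jumps by one, both candidates
  coincide.
\<close>

theorem half_space_existence:
  fixes F :: "real \<times> 'v::euclidean_space \<times> real \<times> 'v \<Rightarrow> real"
  assumes F: "csmooth F" and F0: "\<And>y. F (0, y, 0, 0) = 0" and Fq0: "\<And>y. dq F (0, y, 0, 0) = 0"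
    and Fw: "\<And>y. dw F (0, y, 0, 0) < 1"
  shows "\<exists>T u. open T \<and> {0} \<times> UNIV \<subseteq> T \<and> locally_csmooth T u \<and> (\<forall>y. u (0, y) = 0) \<and>
    (\<forall>z\<in>hspace \<inter> T. \<exists>u'. (u has_derivative u') (at z within hspace) \<and>
       fst z * u' (1, 0) = F (fst z, snd z, u z, gradv (\<lambda>v. u' (0, v))))"
proof -
  define sol where "sol k u N \<longleftrightarrow> csmooth u \<and> open N \<and> {0} \<times> ball 0 (real k + 2) \<subseteq> N \<and>
      (\<forall>y. norm y < real k + 2 \<longrightarrow> u (0, y) = 0) \<and>
      (\<forall>x y. (x, y) \<in> N \<longrightarrow> 0 \<le> x \<longrightarrow> x * D u (x, y) (1, 0) = F (x, y, u (x, y), gradv (\<lambda>v. D u (x, y) (0, v))))"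
    for k :: nat and u :: "real \<times> 'v \<Rightarrow> real" and N
  have "\<exists>u N. sol k u N" for k
  proof -
    have "0 < real k + 2" by simp
    from solution_on_ball[OF F F0 Fq0 Fw this] show ?thesis unfolding sol_def by metis
  qed
  then obtain u N where sol: "\<And>k. sol k (u k) (N k)" by metis
  have us: "csmooth (u k)" and No: "open (N k)" and N0: "{0} \<times> ball 0 (real k + 2) \<subseteq> N k"
    and u0: "\<And>y. norm y < real k + 2 \<Longrightarrow> u k (0, y) = 0"
    and pde: "\<And>x y. (x, y) \<in> N k \<Longrightarrow> 0 \<le> x \<Longrightarrow>
       x * D (u k) (x, y) (1, 0) = F (x, y, u k (x, y), gradv (\<lambda>v. D (u k) (x, y) (0, v)))" for k
    using sol[of k] unfolding sol_def by blast+
  define A where "A k = \<Union>{T. open T \<and> (\<forall>w\<in>hspace \<inter> T. u k w = u (Suc k) w)}" for k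
  have Ao: "open (A k)" and Aeq: "\<And>w. w \<in> hspace \<Longrightarrow> w \<in> A k \<Longrightarrow> u k w = u (Suc k) w" for k
    unfolding A_def by blast+
  have A0: "(0, y) \<in> A k" if y: "norm y < real k + 2" for k y
  proof -
    have "open (N k \<inter> N (Suc k) \<inter> (UNIV \<times> ball 0 (real k + 2)))"
      by (intro open_Int No open_Times open_UNIV open_ball)
    moreover have "(0, y) \<in> N k \<inter> N (Suc k) \<inter> (UNIV \<times> ball 0 (real k + 2))"
      using N0[of k] N0[of "Suc k"] y by auto
    ultimately obtain r where r: "r > 0" "{0..r} \<times> cball y r \<subseteq> N k \<inter> N (Suc k) \<inter> (UNIV \<times> ball 0 (real k + 2))"
      by (rule box_in_open)
    define \<omega> where "\<omega> i = (if i then u k else u (Suc k))" for i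
    have \<omega>s: "csmooth (\<omega> i)" for i using us by (simp add: \<omega>_def)
    have "\<exists>\<epsilon>>0. \<forall>x y'. 0 \<le> x \<longrightarrow> x < \<epsilon> \<longrightarrow> norm (y' - y) < \<epsilon> \<longrightarrow> \<omega> True (x, y') = \<omega> False (x, y')"
    proof (rule solutions_agree_near[where f' = "\<lambda>i. D (\<omega> i)", OF F Fq0 Fw r(1) refl])
      show "(\<omega> i has_derivative D (\<omega> i) z) (at z within {0..r} \<times> cball y r)" for i z
        using csmooth_deriv[OF \<omega>s] by (rule has_derivative_at_withinI)
      show "ck_on (Suc 0) ({0..r} \<times> cball y r) (\<lambda>z. D (\<omega> i) z v)" for i v
        using csmooth_D[OF \<omega>s] ck_on_subset unfolding csmooth_def by blast
      show "\<omega> i (0, y') = 0" if "y' \<in> cball y r" for i y'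
      proof -
        have "(0, y') \<in> {0..r} \<times> cball y r" using that r(1) by simp
        then have "(0, y') \<in> UNIV \<times> ball 0 (real k + 2)" using r(2) by blast
        then have "norm y' < real k + 2" by simp
        then show ?thesis using u0[of y' k] u0[of y' "Suc k"] by (simp add: \<omega>_def)
      qed
      fix i x y' assume h: "0 < x" "x < r" "norm (y' - y) < r"
      then have "(x, y') \<in> {0..r} \<times> cball y r" by (simp add: dist_norm norm_minus_commute)
      then have "(x, y') \<in> N k" "(x, y') \<in> N (Suc k)" using r(2) by blast+
      then show "x * D (\<omega> i) (x, y') (1, 0) = F (x, y', \<omega> i (x, y'), gradv (\<lambda>v. D (\<omega> i) (x, y') (0, v)))"
        using pde[of x y' k] pde[of x y' "Suc k"] h(1) by (cases i) (simp_all add: \<omega>_def)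
    qed
    then obtain \<epsilon> where \<epsilon>: "\<epsilon> > 0" "\<And>x y'. 0 \<le> x \<Longrightarrow> x < \<epsilon> \<Longrightarrow> norm (y' - y) < \<epsilon> \<Longrightarrow> u k (x, y') = u (Suc k) (x, y')"
      unfolding \<omega>_def by auto
    have "open ({..<\<epsilon>} \<times> ball y \<epsilon>)" by (intro open_Times open_lessThan open_ball)
    moreover have "\<forall>w\<in>hspace \<inter> ({..<\<epsilon>} \<times> ball y \<epsilon>). u k w = u (Suc k) w"
      using \<epsilon>(2) by (auto simp: hspace_def dist_norm norm_minus_commute)
    moreover have "(0, y) \<in> {..<\<epsilon>} \<times> ball y \<epsilon>" using \<epsilon>(1) by simp
    ultimately show ?thesis unfolding A_def by blast
  qed
  define \<omega> where "\<omega> z = u (nat \<lfloor>norm (snd z)\<rfloor>) z" for z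
  \<comment> \<open>Where both \<open>u (k - 1)\<close> and \<open>u k\<close> may be selected they agree; for \<open>k = 0\<close> the truncated \<open>k - 1\<close>
    is \<open>0\<close>, and \<open>A 0\<close> contains the part of the slice in question.\<close>
  define P where "P k = {z::real \<times> 'v. real k - 1 < norm (snd z) \<and> norm (snd z) < real k + 1} \<inter> N k \<inter> A (k - 1)" for k
  have Po: "open (P k)" for k
    unfolding P_def by (intro open_Int No Ao open_Collect_conj open_Collect_less continuous_intros)
  have \<omega>P: "\<omega> z = u k z" if z: "z \<in> hspace" "z \<in> P k" for z k
  proof -
    define j where "j = nat \<lfloor>norm (snd z)\<rfloor>"
    have "real j \<le> norm (snd z)" "norm (snd z) < real j + 1" by (auto simp: j_def)
    then have "real k < real j + 2" "real j < real k + 1" using z by (auto simp: P_def)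
    then have "k < j + 2" "j < k + 1" by linarith+
    then have "k = j \<or> k = Suc j" by linarith
    then show ?thesis using Aeq[of z j] z by (auto simp: \<omega>_def P_def simp flip: j_def)
  qed
  define T where "T = (\<Union>k. P k)"
  have "open T" unfolding T_def using Po by blast
  moreover have "{0} \<times> UNIV \<subseteq> T"
  proof clarify
    fix y :: 'v
    define j where "j = nat \<lfloor>norm y\<rfloor>"
    have j: "real j \<le> norm y" "norm y < real j + 1" by (auto simp: j_def)
    have "(0, y) \<in> N j" using N0[of j] j by auto
    moreover have "(0, y) \<in> A (j - 1)" using j by (intro A0) (cases j; simp)
    ultimately have "(0, y) \<in> P j" using j by (simp add: P_def)
    then show "(0, y) \<in> T" by (auto simp: T_def)
  qed
  moreover have "locally_csmooth T \<omega>"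
    unfolding locally_csmooth_def
  proof
    fix z assume "z \<in> hspace \<inter> T"
    then obtain k where "z \<in> P k" by (auto simp: T_def)
    then show "\<exists>N u. open N \<and> z \<in> N \<and> csmooth u \<and> (\<forall>w\<in>hspace \<inter> N. \<omega> w = u w)"
      using Po us \<omega>P by blast
  qed
  moreover have "\<omega> (0, y) = 0" for y
    unfolding \<omega>_def snd_conv by (rule u0) linarith
  moreover have "\<exists>u'. (\<omega> has_derivative u') (at z within hspace) \<and>
       fst z * u' (1, 0) = F (fst z, snd z, \<omega> z, gradv (\<lambda>v. u' (0, v)))" if z: "z \<in> hspace \<inter> T" for z
  proof -
    obtain k where k: "z \<in> P k" using z by (auto simp: T_def)
    have "(\<omega> has_derivative D (u k) z) (at z within hspace)"
      by (rule local_piece_derivative[OF Po _ us]) (use z k \<omega>P in auto)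
    moreover have "fst z * D (u k) z (1, 0) = F (fst z, snd z, \<omega> z, gradv (\<lambda>v. D (u k) z (0, v)))"
      using pde[of "fst z" "snd z" k] k z \<omega>P[of z k] by (auto simp: P_def hspace_def)
    ultimately show ?thesis by blast
  qed
  ultimately show ?thesis by blast
qed

section \<open>Coordinate subspaces and general initial values\<close>

lemma Ck_on_eq_ck_on: "Ck_on k S f \<longleftrightarrow> ck_on k S f"
  by (induction k arbitrary: f) auto

text \<open>
  Composition with this projection extends functions on \<^term>\<open>coord_space J\<close> to all of \<^typ>\<open>real^'m\<close>.
\<close>

definition proj :: "'m::finite set \<Rightarrow> real^'m \<Rightarrow> real^'m"
  where "proj J v = (\<chi> i. if i \<in> J then v $ i else 0)"

lemma bounded_linear_proj: "bounded_linear (proj J)"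
  unfolding linear_conv_bounded_linear[symmetric]
  by (auto simp: linear_iff proj_def vec_eq_iff)

lemma proj_in: "proj J v \<in> coord_space J"
  by (simp add: proj_def coord_space_def)

lemma proj_id: "v \<in> coord_space J \<Longrightarrow> proj J v = v"
  by (auto simp: proj_def coord_space_def vec_eq_iff)

lemma proj_proj: "proj J (proj J v) = proj J v"
  by (rule proj_id[OF proj_in])

lemma proj_inner: "proj J a \<bullet> b = a \<bullet> proj J b"
  by (auto simp: proj_def inner_vec_def intro!: sum.cong)

lemma grad_in: "grad J h y \<in> coord_space J"
  by (simp add: grad_def coord_space_def)

lemma proj_add_axis:
  "proj J (y + t *\<^sub>R axis i 1) = (if i \<in> J then proj J y + t *\<^sub>R axis i 1 else proj J y)"
  by (auto simp: proj_def vec_eq_iff axis_def)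

text \<open>
  The extension of \<open>h\<close> by the projection is constant in the directions outside \<open>J\<close>, so its full gradient
  has exactly the components of \<^const>\<open>grad\<close>, also at points \<open>y\<close> outside the subspace.
\<close>

lemma grad_eq_gradv:
  assumes h: "((\<lambda>v. h (proj J v)) has_derivative l) (at y)"
  shows "grad J h (proj J y) = gradv l"
proof -
  have lin: "linear l" by (rule has_derivative_linear[OF h])
  have comp: "gradv l $ i = l (axis i 1)" for i
    using gradv_inner[OF lin, of "axis i 1"] by (simp add: inner_axis)
  have d: "((\<lambda>t. h (proj J (y + t *\<^sub>R axis i 1))) has_real_derivative l (axis i 1)) (at 0)" for i
  proof -
    have "((\<lambda>t. h (proj J (y + t *\<^sub>R axis i 1))) has_derivative (\<lambda>t. l (t *\<^sub>R axis i 1))) (at 0)"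
      by (rule has_derivative_compose[of "\<lambda>t. y + t *\<^sub>R axis i 1" _ 0 UNIV "\<lambda>v. h (proj J v)" l])
        (use h in \<open>auto intro!: derivative_eq_intros\<close>)
    then show ?thesis
      by (rule has_derivative_imp_has_field_derivative) (simp add: linear_scale[OF lin])
  qed
  show ?thesis
  proof (subst vec_eq_iff, rule allI)
    fix i
    show "grad J h (proj J y) $ i = gradv l $ i"
    proof (cases "i \<in> J")
      case True
      then show ?thesis using DERIV_imp_deriv[OF d[of i]] by (simp add: grad_def comp proj_add_axis)
    next
      case False
      then have "((\<lambda>t. h (proj J y)) has_real_derivative l (axis i 1)) (at 0)"
        using d[of i] by (simp add: proj_add_axis)
      then have "l (axis i 1) = 0" using DERIV_unique DERIV_const by blast
      then show ?thesis using False by (simp add: grad_def comp)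
    qed
  qed
qed

text \<open>
  Two substitutions reduce the problem to the situation of the preceding sections.  Composing with the
  projection \<open>P\<close> removes the subspace, and writing \<open>\<omega> = \<omega>\<^sub>0 + u\<close> makes the initial value zero.
  They turn \<open>F\<close> into \<open>Fh (x, y, w, q) = F (x, P y, \<omega>\<^sub>0 (P y) + w, P (g y + q))\<close>, where \<open>g\<close> is the gradient of
  \<open>\<omega>\<^sub>0 \<circ> P\<close>.  Solutions are carried over in both directions.
\<close>

theorem theorem1p1:
  fixes n :: nat
    and J :: "'m::finite set"
    and F :: "real \<times> (real^'m) \<times> real \<times> (real^'m) \<Rightarrow> real"
    and \<omega>\<^sub>0 :: "real^'m \<Rightarrow> real"
  assumes "n \<ge> 1" and "card J = n - 1"
    and "smooth_on (UNIV \<times> coord_space J \<times> UNIV \<times> coord_space J) F"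
    and "smooth_on (coord_space J) \<omega>\<^sub>0"
    and "\<forall>y \<in> coord_space J. F (0, y, \<omega>\<^sub>0 y, grad J \<omega>\<^sub>0 y) = 0"
    and "\<forall>y \<in> coord_space J. grad J (\<lambda>q. F (0, y, \<omega>\<^sub>0 y, q)) (grad J \<omega>\<^sub>0 y) = 0"
    and "\<forall>y \<in> coord_space J. deriv (\<lambda>w. F (0, y, w, grad J \<omega>\<^sub>0 y)) (\<omega>\<^sub>0 y) < 1"
  shows "(\<exists>U \<omega>. boundary_nbhd J U \<and> smooth_solution J F \<omega>\<^sub>0 U \<omega>) \<and>
    (\<forall>U\<^sub>1 \<omega>\<^sub>1 U\<^sub>2 \<omega>\<^sub>2.
       boundary_nbhd J U\<^sub>1 \<and> smooth_solution J F \<omega>\<^sub>0 U\<^sub>1 \<omega>\<^sub>1 \<and>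
       boundary_nbhd J U\<^sub>2 \<and> smooth_solution J F \<omega>\<^sub>0 U\<^sub>2 \<omega>\<^sub>2 \<longrightarrow>
       (\<exists>V. boundary_nbhd J V \<and> V \<subseteq> U\<^sub>1 \<inter> U\<^sub>2 \<and> (\<forall>z \<in> V. \<omega>\<^sub>1 z = \<omega>\<^sub>2 z)))"
proof -
  note sF = assms(3) and sw = assms(4) and F0 = assms(5) and Fq0 = assms(6) and Fw = assms(7)
  define P where "P = proj J"
  have bP: "bounded_linear P" unfolding P_def by (rule bounded_linear_proj)
  have linP: "linear P" using bP by (rule bounded_linear.linear)
  have Ps: "csmooth (\<lambda>z. P (f z))" if "csmooth f" for f :: "'b::real_normed_vector \<Rightarrow> real^'m"
    by (rule csmooth_linear_compose[OF bP that])
  have Pin: "P v \<in> coord_space J" and Pid: "v \<in> coord_space J \<Longrightarrow> P v = v" for v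
    unfolding P_def by (rule proj_in, rule proj_id)
  define w0 where "w0 y = \<omega>\<^sub>0 (P y)" for y
  have w0s: "csmooth w0"
    unfolding csmooth_def w0_def
  proof
    fix k
    show "ck_on k UNIV (\<lambda>y. \<omega>\<^sub>0 (P y))"
      by (rule ck_on_compose[where T = "coord_space J"])
        (use sw Pin ck_on_linear[OF bP] in \<open>auto simp: smooth_on_def Ck_on_eq_ck_on\<close>)
  qed
  define g where "g y = gradv (D w0 y)" for y
  have gs: "csmooth g" unfolding g_def by (intro csm w0s csmooth_D)
  have gw: "grad J \<omega>\<^sub>0 (P y) = g y" for y
    unfolding P_def g_def by (rule grad_eq_gradv) (use csmooth_deriv[OF w0s] in \<open>simp add: w0_def[abs_def] P_def\<close>)
  have Pg: "P (g y) = g y" for y using grad_in[of J \<omega>\<^sub>0 "P y"] by (intro Pid) (simp add: gw)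
  define Fh where "Fh q = F (fst q, P (fst (snd q)), w0 (fst (snd q)) + fst (snd (snd q)), P (g (fst (snd q)) + snd (snd (snd q))))" for q
  have Fhs: "csmooth Fh"
  proof -
    have args: "csmooth (\<lambda>q::real \<times> (real^'m) \<times> real \<times> (real^'m). (fst q, P (fst (snd q)), w0 (fst (snd q)) + fst (snd (snd q)), P (g (fst (snd q)) + snd (snd (snd q)))))"
      by (intro csm Ps csmooth_compose[OF w0s] csmooth_compose[OF gs])
    have "ck_on k UNIV Fh" for k
    proof -
      have 1: "ck_on k (UNIV \<times> coord_space J \<times> UNIV \<times> coord_space J) F"
        using sF by (simp add: smooth_on_def Ck_on_eq_ck_on)
      have 2: "ck_on k UNIV (\<lambda>q::real \<times> (real^'m) \<times> real \<times> (real^'m). (fst q, P (fst (snd q)), w0 (fst (snd q)) + fst (snd (snd q)), P (g (fst (snd q)) + snd (snd (snd q)))))"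
        using args unfolding csmooth_def by blast
      show ?thesis unfolding Fh_def[abs_def] by (rule ck_on_compose[OF 1 2]) (use Pin in auto)
    qed
    then show ?thesis by (simp add: csmooth_def)
  qed
  have Fh: "Fh (x, y, w, q) = F (x, P y, w0 y + w, P (g y + q))" for x y w q by (simp add: Fh_def)
  have Fh0: "Fh (0, y, 0, 0) = 0" for y
    using F0[rule_format, OF Pin[of y]] by (simp add: Fh Pg gw w0_def)
  have Fhq0: "dq Fh (0, y, 0, 0) = 0" for y
  proof -
    have "((\<lambda>v. Fh (0, y, 0, v - g y)) has_derivative (\<lambda>v. D Fh (0, y, 0, g y - g y) (0, 0, 0, v))) (at (g y))"
      by (rule has_derivative_compose[OF _ csmooth_deriv[OF Fhs]]) (auto intro!: derivative_eq_intros)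
    then have "((\<lambda>v. F (0, P y, \<omega>\<^sub>0 (P y), proj J v)) has_derivative (\<lambda>v. D Fh (0, y, 0, 0) (0, 0, 0, v))) (at (g y))"
      by (simp add: Fh w0_def P_def)
    from grad_eq_gradv[OF this] have "grad J (\<lambda>q. F (0, P y, \<omega>\<^sub>0 (P y), q)) (P (g y)) = dq Fh (0, y, 0, 0)"
      by (simp add: P_def dq_def)
    then show ?thesis using Fq0[rule_format, OF Pin[of y]] by (simp add: Pg gw)
  qed
  have Fhw: "dw Fh (0, y, 0, 0) < 1" for y
  proof -
    have "((\<lambda>w. Fh (0, y, w - w0 y, 0)) has_derivative (\<lambda>w. D Fh (0, y, w0 y - w0 y, 0) (0, 0, w, 0))) (at (w0 y))"
      by (rule has_derivative_compose[OF _ csmooth_deriv[OF Fhs]]) (auto intro!: derivative_eq_intros)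
    moreover have "D Fh (0, y, 0, 0) (0, 0, w, 0) = dw Fh (0, y, 0, 0) * w" for w
      using D_eq_partials[OF Fhs, of "(0, y, 0, 0)" 0 w 0] by simp
    ultimately have "((\<lambda>w. F (0, P y, w, g y)) has_real_derivative dw Fh (0, y, 0, 0)) (at (\<omega>\<^sub>0 (P y)))"
      by (simp add: Fh Pg w0_def has_field_derivative_def)
    from DERIV_imp_deriv[OF this] show ?thesis using Fw[rule_format, OF Pin[of y]] by (simp add: gw)
  qed
  have nbot: "at x within {0::real..} \<noteq> bot" if "0 \<le> x" for x
  proof
    assume "at x within {0..} = bot"
    moreover have "at_right x \<le> at x within {0..}" using that by (intro at_le) auto
    ultimately have "at_right x = bot" by (metis le_bot)
    then show False using trivial_limit_at_right_real[of x] by blast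
  qed
  show ?thesis
  proof (intro conjI allI impI)
    obtain T u where T: "open T" "{0} \<times> UNIV \<subseteq> T" and us: "locally_csmooth T u" and u0: "\<And>y. u (0, y) = 0"
      and pde: "\<And>z. z \<in> hspace \<inter> T \<Longrightarrow> \<exists>u'. (u has_derivative u') (at z within hspace) \<and>
         fst z * u' (1, 0) = Fh (fst z, snd z, u z, gradv (\<lambda>v. u' (0, v)))"
      using half_space_existence[OF Fhs Fh0 Fhq0 Fhw] by blast
    define U where "U = half_space J \<inter> T"
    define \<omega> where "\<omega> z = w0 (snd z) + u z" for z
    have sub: "U \<subseteq> hspace \<inter> T" by (auto simp: U_def half_space_def hspace_def)
    have "boundary_nbhd J U"
      using T by (auto simp: boundary_nbhd_def U_def half_space_def openin_open)
    moreover have "smooth_solution J F \<omega>\<^sub>0 U \<omega>"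
      unfolding smooth_solution_def
    proof (intro conjI ballI)
      show "smooth_on U \<omega>"
        unfolding smooth_on_def Ck_on_eq_ck_on
      proof
        fix k
        have "ck_on k U u" by (rule ck_on_subset[OF locally_csmooth_ck_on[OF T(1) us] sub])
        moreover have "ck_on k U (\<lambda>z. w0 (snd z))"
          using csmooth_compose[OF w0s, of snd] csmooth_snd[OF csmooth_id] ck_on_subset[of k UNIV _ U]
          unfolding csmooth_def by blast
        ultimately show "ck_on k U \<omega>" unfolding \<omega>_def by (intro ck_on_add)
      qed
      show "\<omega> (0, y) = \<omega>\<^sub>0 y" if "y \<in> coord_space J" for y
        using Pid[OF that] u0 by (simp add: \<omega>_def w0_def)
      fix z assume z: "z \<in> U"
      obtain x y where xy: "z = (x, y)" by (cases z)
      have x: "0 \<le> x" and y: "P y = y" using z Pid by (auto simp: xy U_def half_space_def)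
      obtain u' where u': "(u has_derivative u') (at (x, y) within hspace)"
        "x * u' (1, 0) = Fh (x, y, u (x, y), gradv (\<lambda>v. u' (0, v)))"
        using pde[of z] z sub by (auto simp: xy)
      have linu: "linear u'" by (rule has_derivative_linear[OF u'(1)])
      have "((\<lambda>s. u (s, y)) has_derivative (\<lambda>t. u' (t, 0))) (at x within {0..})"
      proof (rule has_derivative_in_compose[of "\<lambda>s. (s, y)" _ _ _ u u'])
        show "((\<lambda>s. (s, y)) has_derivative (\<lambda>t. (t, 0))) (at x within {0..})" by (auto intro!: derivative_eq_intros)
        show "(u has_derivative u') (at (x, y) within (\<lambda>s. (s, y)) ` {0..})"
          by (rule has_derivative_subset[OF u'(1)]) (auto simp: hspace_def)
      qed
      moreover have "(\<lambda>t. u' (t, 0)) = (\<lambda>t. t *\<^sub>R u' (1, 0))"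
        using linear_scale[OF linu, of _ "(1, 0)", symmetric] by simp
      ultimately have "((\<lambda>s. u (s, y)) has_vector_derivative u' (1, 0)) (at x within {0..})"
        unfolding has_vector_derivative_def by (simp only:)
      then have "((\<lambda>s. \<omega> (s, y)) has_vector_derivative u' (1, 0)) (at x within {0..})"
        unfolding \<omega>_def by (auto intro!: derivative_eq_intros)
      then have vd: "vector_derivative (\<lambda>s. \<omega> (s, y)) (at x within {0..}) = u' (1, 0)"
        by (rule vector_derivative_within[OF nbot[OF x]])
      have "((\<lambda>v. u (x, P v)) has_derivative (\<lambda>v. u' (0, P v))) (at y)"
      proof (rule has_derivative_in_compose[of "\<lambda>v. (x, P v)" _ _ UNIV u u'])
        show "((\<lambda>v. (x, P v)) has_derivative (\<lambda>v. (0, P v))) (at y)"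
          by (intro has_derivative_Pair has_derivative_const bounded_linear_imp_has_derivative bP)
        show "(u has_derivative u') (at (x, P y) within range (\<lambda>v. (x, P v)))"
          unfolding y by (rule has_derivative_subset[OF u'(1)]) (use x in \<open>auto simp: hspace_def\<close>)
      qed
      then have "((\<lambda>v. w0 v + u (x, P v)) has_derivative (\<lambda>v. D w0 y v + u' (0, P v))) (at y)"
        by (intro has_derivative_add csmooth_deriv w0s)
      moreover have "w0 v = w0 (P v)" for v by (simp add: w0_def P_def proj_proj)
      ultimately have "((\<lambda>v. \<omega> (x, proj J v)) has_derivative (\<lambda>v. D w0 y v + u' (0, P v))) (at y)"
        by (simp add: \<omega>_def P_def)
      from grad_eq_gradv[OF this] have "grad J (\<lambda>y'. \<omega> (x, y')) y = gradv (\<lambda>v. D w0 y v + u' (0, P v))"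
        using y by (simp add: P_def)
      also have "\<dots> = g y + P (gradv (\<lambda>v. u' (0, v)))"
      proof (rule gradv_eq)
        fix v
        have "linear (\<lambda>v. u' (0, v))"
          using linear_compose[OF _ linu, of "Pair 0"] by (simp add: o_def linear_iff)
        then show "D w0 y v + u' (0, P v) = (g y + P (gradv (\<lambda>v. u' (0, v)))) \<bullet> v"
          using gradv_inner[of "\<lambda>v. u' (0, v)" "P v"] gradv_inner[OF csmooth_linear_D[OF w0s], of y v]
          by (simp add: inner_add_left g_def P_def proj_inner)
      qed
      finally have gr: "grad J (\<lambda>y'. \<omega> (x, y')) y = g y + P (gradv (\<lambda>v. u' (0, v)))" .
      have "x * u' (1, 0) = F (x, y, \<omega> (x, y), g y + P (gradv (\<lambda>v. u' (0, v))))"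
        unfolding u'(2) by (simp add: Fh y \<omega>_def linear_add[OF linP] Pg)
      then show "case z of (x, y) \<Rightarrow> x * vector_derivative (\<lambda>s. \<omega> (s, y)) (at x within {0..})
         = F (x, y, \<omega> (x, y), grad J (\<lambda>y'. \<omega> (x, y')) y)"
        by (simp add: xy vd gr)
    qed
    ultimately show "\<exists>U \<omega>. boundary_nbhd J U \<and> smooth_solution J F \<omega>\<^sub>0 U \<omega>" by blast
  next
    fix U\<^sub>1 U\<^sub>2 :: "(real \<times> (real^'m)) set" and \<omega>\<^sub>1 \<omega>\<^sub>2 :: "real \<times> (real^'m) \<Rightarrow> real"
    assume H: "boundary_nbhd J U\<^sub>1 \<and> smooth_solution J F \<omega>\<^sub>0 U\<^sub>1 \<omega>\<^sub>1 \<and> boundary_nbhd J U\<^sub>2 \<and> smooth_solution J F \<omega>\<^sub>0 U\<^sub>2 \<omega>\<^sub>2"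
    define U where "U i = (if i then U\<^sub>1 else U\<^sub>2)" for i
    define \<omega> where "\<omega> i = (if i then \<omega>\<^sub>1 else \<omega>\<^sub>2)" for i
    have nb: "boundary_nbhd J (U i)" and sol: "smooth_solution J F \<omega>\<^sub>0 (U i) (\<omega> i)" for i
      using H by (auto simp: U_def \<omega>_def)
    have "\<exists>T. open T \<and> U i = half_space J \<inter> T" for i
      using nb[of i] by (auto simp: boundary_nbhd_def openin_open)
    then obtain T where T: "\<And>i. open (T i)" "\<And>i. U i = half_space J \<inter> T i" by metis
    have U0: "(0, y) \<in> U i" if "y \<in> coord_space J" for i y
      using nb[of i] that by (auto simp: boundary_nbhd_def)
    have "\<exists>f'. (\<forall>z\<in>U i. (\<omega> i has_derivative f' z) (at z within U i)) \<and> (\<forall>v. ck_on (Suc 0) (U i) (\<lambda>z. f' z v))" for i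
    proof -
      have "ck_on (Suc (Suc 0)) (U i) (\<omega> i)"
        using sol[of i] unfolding smooth_solution_def smooth_on_def Ck_on_eq_ck_on by blast
      then show ?thesis unfolding ck_on.simps(2)[of "Suc 0"] .
    qed
    then obtain f where fd: "\<And>i z. z \<in> U i \<Longrightarrow> (\<omega> i has_derivative f i z) (at z within U i)"
      and fc: "\<And>i v. ck_on (Suc 0) (U i) (\<lambda>z. f i z v)" by metis
    have pde: "x * vector_derivative (\<lambda>s. \<omega> i (s, y)) (at x within {0..}) = F (x, y, \<omega> i (x, y), grad J (\<lambda>y'. \<omega> i (x, y')) y)"
      if "(x, y) \<in> U i" for i x y
      using sol[of i] that unfolding smooth_solution_def by auto
    have init: "\<omega> i (0, y) = \<omega>\<^sub>0 y" if "y \<in> coord_space J" for i y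
      using sol[of i] that unfolding smooth_solution_def by auto
    have local: "\<exists>T'. open T' \<and> (0, y0) \<in> T' \<and> half_space J \<inter> T' \<subseteq> U\<^sub>1 \<inter> U\<^sub>2 \<and> (\<forall>z\<in>half_space J \<inter> T'. \<omega>\<^sub>1 z = \<omega>\<^sub>2 z)"
      if y0: "y0 \<in> coord_space J" for y0
    proof -
      define \<phi> where "\<phi> z = (fst z, P (snd z))" for z :: "real \<times> (real^'m)"
      have \<phi>l: "bounded_linear \<phi>"
        unfolding \<phi>_def by (intro bounded_linear_Pair bounded_linear_fst bounded_linear_compose[OF bP bounded_linear_snd])
      have "open (\<phi> -` (T True \<inter> T False))"
        by (intro continuous_open_vimage open_Int T) (use \<phi>l in \<open>simp add: linear_continuous_at\<close>)
      moreover have "(0, y0) \<in> \<phi> -` (T True \<inter> T False)"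
        using U0[OF y0] T(2) by (simp add: \<phi>_def Pid[OF y0])
      ultimately obtain r where r: "r > 0" "{0..r} \<times> cball y0 r \<subseteq> \<phi> -` (T True \<inter> T False)"
        by (rule box_in_open)
      define S where "S = {0..r} \<times> cball y0 r"
      have \<phi>S: "\<phi> z \<in> U i" if "z \<in> S" for z i
      proof -
        have "\<phi> z \<in> T i" using r(2) that by (cases i) (auto simp: S_def)
        moreover have "\<phi> z \<in> half_space J" using that Pin by (auto simp: S_def \<phi>_def half_space_def)
        ultimately show ?thesis using T(2) by blast
      qed
      define v where "v i z = \<omega> i (\<phi> z) - w0 (snd z)" for i z
      define v' where "v' i z h = f i (\<phi> z) (\<phi> h) - D w0 (snd z) (snd h)" for i z h
      have "\<exists>\<epsilon>>0. \<forall>x y. 0 \<le> x \<longrightarrow> x < \<epsilon> \<longrightarrow> norm (y - y0) < \<epsilon> \<longrightarrow> v True (x, y) = v False (x, y)"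
      proof (rule solutions_agree_near[where \<omega> = v and f' = v', OF Fhs Fhq0 Fhw r(1) S_def])
        fix i :: bool
        show "(v i has_derivative v' i z) (at z within S)" if z: "z \<in> S" for z
        proof -
          have "((\<lambda>z. \<omega> i (\<phi> z)) has_derivative (\<lambda>h. f i (\<phi> z) (\<phi> h))) (at z within S)"
            by (rule has_derivative_in_compose2[where t = "U i" and g = "\<omega> i" and g' = "f i" and f' = \<phi>])
              (use fd \<phi>S z bounded_linear_imp_has_derivative[OF \<phi>l] in auto)
          moreover have "((\<lambda>z. w0 (snd z)) has_derivative (\<lambda>h. D w0 (snd z) (snd h))) (at z within S)"
            by (rule has_derivative_compose[OF _ csmooth_deriv[OF w0s]]) (auto intro!: derivative_eq_intros)
          ultimately show ?thesis unfolding v_def[abs_def] v'_def[abs_def] by (rule has_derivative_diff)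
        qed
        show "ck_on (Suc 0) S (\<lambda>z. v' i z h)" for h
        proof -
          have 1: "ck_on (Suc 0) S (\<lambda>z. f i (\<phi> z) (\<phi> h))"
            by (rule ck_on_compose[OF fc ck_on_linear[OF \<phi>l]]) (use \<phi>S in auto)
          have "csmooth (\<lambda>z::real \<times> (real^'m). - D w0 (snd z) (snd h))" by (intro csm w0s)
          then have "ck_on (Suc 0) S (\<lambda>z. - D w0 (snd z) (snd h))"
            unfolding csmooth_def using ck_on_subset by blast
          from ck_on_add[OF 1 this] show ?thesis by (simp add: v'_def)
        qed
        show "v i (0, y) = 0" for y
          using init[OF Pin[of y]] by (simp add: v_def \<phi>_def w0_def)
        fix x y assume h: "0 < x" "x < r" "norm (y - y0) < r"
        have yb: "y \<in> ball y0 r" and zS: "(x, y) \<in> S" using h by (auto simp: S_def dist_norm norm_minus_commute)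
        have zU: "(x, P y) \<in> U i" using \<phi>S[OF zS, of i] by (simp add: \<phi>_def)
        have linf: "linear (f i (x, P y))" by (rule has_derivative_linear[OF fd[OF zU]])
        have "((\<lambda>s. \<omega> i (s, P y)) has_derivative (\<lambda>t. f i (x, P y) (t, 0))) (at x within {0<..<r})"
        proof (rule has_derivative_in_compose2[where t = "U i" and g = "\<omega> i" and g' = "f i" and f = "\<lambda>s. (s, P y)" and f' = "\<lambda>t. (t, 0)"])
          show "(\<lambda>s. (s, P y)) ` {0<..<r} \<subseteq> U i"
          proof clarify
            fix s assume "s \<in> {0<..<r}"
            then have "(s, y) \<in> S" using yb by (auto simp: S_def)
            then show "(s, P y) \<in> U i" using \<phi>S[of "(s, y)" i] by (simp add: \<phi>_def)
          qed
          show "((\<lambda>s. (s, P y)) has_derivative (\<lambda>t. (t, 0))) (at x within {0<..<r})" by (auto intro!: derivative_eq_intros)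
        qed (use h fd in auto)
        moreover have "at x within {0<..<r} = at x" using h by (intro at_within_open) auto
        moreover have "(\<lambda>t. f i (x, P y) (t, 0)) = (\<lambda>t. t *\<^sub>R f i (x, P y) (1, 0))"
          using linear_scale[OF linf, of _ "(1, 0)", symmetric] by simp
        ultimately have "((\<lambda>s. \<omega> i (s, P y)) has_vector_derivative f i (x, P y) (1, 0)) (at x)"
          unfolding has_vector_derivative_def by (simp only:)
        then have "((\<lambda>s. \<omega> i (s, P y)) has_vector_derivative f i (x, P y) (1, 0)) (at x within {0..})"
          by (rule has_vector_derivative_at_within)
        then have vd: "vector_derivative (\<lambda>s. \<omega> i (s, P y)) (at x within {0..}) = f i (x, P y) (1, 0)"
          by (rule vector_derivative_within[OF nbot[OF less_imp_le[OF h(1)]]])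
        have "((\<lambda>q. \<omega> i (x, P q)) has_derivative (\<lambda>q. f i (x, P y) (0, P q))) (at y within ball y0 r)"
        proof (rule has_derivative_in_compose2[where t = "U i" and g = "\<omega> i" and g' = "f i" and f = "\<lambda>q. (x, P q)" and f' = "\<lambda>q. (0, P q)"])
          show "(\<lambda>q. (x, P q)) ` ball y0 r \<subseteq> U i"
          proof clarify
            fix q assume "q \<in> ball y0 r"
            then have "(x, q) \<in> S" using h by (auto simp: S_def)
            then show "(x, P q) \<in> U i" using \<phi>S[of "(x, q)" i] by (simp add: \<phi>_def)
          qed
          show "((\<lambda>q. (x, P q)) has_derivative (\<lambda>q. (0, P q))) (at y within ball y0 r)"
            by (intro has_derivative_Pair has_derivative_const bounded_linear_imp_has_derivative bP)
        qed (use yb fd in auto)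
        then have dl: "((\<lambda>q. \<omega> i (x, proj J q)) has_derivative (\<lambda>q. f i (x, P y) (0, P q))) (at y)"
          using at_within_open[OF yb open_ball] by (simp add: P_def)
        from grad_eq_gradv[OF this] have gr: "grad J (\<lambda>y'. \<omega> i (x, y')) (P y) = gradv (\<lambda>q. f i (x, P y) (0, P q))"
          by (simp add: P_def)
        define G where "G = gradv (\<lambda>q. f i (x, P y) (0, P q))"
        \<comment> \<open>The gradient along the subspace lies in the subspace, so the projection inside \<open>Fh\<close> does not change it.\<close>
        have PG: "P G = G" using grad_in[of J "\<lambda>y'. \<omega> i (x, y')" "P y"] unfolding gr G_def[symmetric] by (rule Pid)
        have "gradv (\<lambda>q. v' i (x, y) (0, q)) = G - g y"
        proof (rule gradv_eq)
          fix q
          show "v' i (x, y) (0, q) = (G - g y) \<bullet> q"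
            using gradv_inner[OF has_derivative_linear[OF dl], of q] gradv_inner[OF csmooth_linear_D[OF w0s], of y q]
            by (simp add: v'_def \<phi>_def inner_diff_left G_def g_def)
        qed
        moreover have "v' i (x, y) (1, 0) = f i (x, P y) (1, 0)"
          using linear_0[OF csmooth_linear_D[OF w0s, of y]] linear_0[OF linP] by (simp add: v'_def \<phi>_def)
        moreover have "x * f i (x, P y) (1, 0) = F (x, P y, \<omega> i (x, P y), G)"
          using pde[OF zU] unfolding vd gr G_def .
        ultimately show "x * v' i (x, y) (1, 0) = Fh (x, y, v i (x, y), gradv (\<lambda>h. v' i (x, y) (0, h)))"
          by (simp add: Fh v_def \<phi>_def PG)
      qed
      then obtain \<epsilon> where \<epsilon>: "\<epsilon> > 0" "\<And>x y. 0 \<le> x \<Longrightarrow> x < \<epsilon> \<Longrightarrow> norm (y - y0) < \<epsilon> \<Longrightarrow> v True (x, y) = v False (x, y)"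
        by blast
      let ?T = "({..<\<epsilon>} \<times> ball y0 \<epsilon>) \<inter> (T True \<inter> T False)"
      have "open ?T" by (intro open_Int open_Times open_lessThan open_ball T)
      moreover have "(0, y0) \<in> ?T" using \<epsilon>(1) U0[OF y0] T(2) by auto
      moreover have "half_space J \<inter> ?T \<subseteq> U\<^sub>1 \<inter> U\<^sub>2"
        using T(2)[of True] T(2)[of False] by (auto simp: U_def)
      moreover have "\<omega>\<^sub>1 z = \<omega>\<^sub>2 z" if z: "z \<in> half_space J \<inter> ?T" for z
      proof -
        obtain x y where xy: "z = (x, y)" by (cases z)
        have "v True (x, y) = v False (x, y)"
          using z by (intro \<epsilon>(2)) (auto simp: xy half_space_def dist_norm norm_minus_commute)
        moreover have "P y = y" using z by (intro Pid) (auto simp: xy half_space_def)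
        ultimately show ?thesis by (simp add: v_def \<phi>_def \<omega>_def xy)
      qed
      ultimately show ?thesis by blast
    qed
    define TT where "TT = \<Union>{T'. open T' \<and> half_space J \<inter> T' \<subseteq> U\<^sub>1 \<inter> U\<^sub>2 \<and> (\<forall>z\<in>half_space J \<inter> T'. \<omega>\<^sub>1 z = \<omega>\<^sub>2 z)}"
    have "open TT" unfolding TT_def by blast
    then have "openin (top_of_set (half_space J)) (half_space J \<inter> TT)" by (auto simp: openin_open)
    moreover have "{0} \<times> coord_space J \<subseteq> half_space J \<inter> TT"
    proof clarify
      fix y :: "real^'m" assume y: "y \<in> coord_space J"
      have "(0, y) \<in> TT" using local[OF y] unfolding TT_def by blast
      then show "(0, y) \<in> half_space J \<inter> TT" using y by (simp add: half_space_def)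
    qed
    moreover have "half_space J \<inter> TT \<subseteq> U\<^sub>1 \<inter> U\<^sub>2" "\<forall>z\<in>half_space J \<inter> TT. \<omega>\<^sub>1 z = \<omega>\<^sub>2 z"
      unfolding TT_def by blast+
    ultimately show "\<exists>V. boundary_nbhd J V \<and> V \<subseteq> U\<^sub>1 \<inter> U\<^sub>2 \<and> (\<forall>z\<in>V. \<omega>\<^sub>1 z = \<omega>\<^sub>2 z)"
      unfolding boundary_nbhd_def by blast
  qed
qed

end
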